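(* Let $X_1,\dots,X_n$ be i.i.d. random variables with density $p$ as described in the context, $h\in\mathfrak{R}$, and let $a_n\to\infty$ with $m(t_n)=a_n$. Suppose that, as $n\to\infty$, $$\frac{\psi(t_n)^2}{\sqrt n\,\psi'(t_n)}\longrightarrow0,$$ and that $\eta_n>0$ is a sequence with $$\eta_n\to0,\qquad \frac{n\,h(a_n)\,\eta_n}{\log n}\to\infty .$$ Let $S_n=X_1+\dots+X_n$ and let $p_{A_n}(y_1)=p(X_1=y_1\mid S_n\ge na_n)$ be the conditional density of $X_1$ given $\{S_n\ge na_n\}$ at a fixed point $y_1$. Then $$p_{A_n}(y_1)=g_{A_n}(y_1)\left(1+o\left(\frac1{\sqrt n}\right)\right),$$ where $$g_{A_n}(y_1)=n\,t_n\,s(t_n)\,e^{nI(a_n)}\int_{a_n}^{a_n+\eta_n} g_\tau(y_1)\exp\big(-nI(\tau)-\log s(t_\tau)\big)\,d\tau,$$ with $g_\tau(y_1)=\pi^\tau(y_1)$ and $t_\tau$ defined by $m(t_\tau)=\tau$.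
   Context: Density: $p$ is a uniformly bounded probability density, $p(x)=c\exp(-(g(x)-q(x)))$ for $x\in\mathbb{R}_+$ (and $p=0$ on negative reals), with $c>0$ a normalizing constant. The function $g$ is positive, $g(x)/x\to\infty$ as $x\to\infty$, and $h:=g'$. There is a constant $\vartheta>0$ such that for all large $x$, $\sup_{|v-x|<\vartheta x}|q(v)|\le 1/\sqrt{x h(x)}$. Regularity classes: $l\in R_0$ if $l(x)=\exp\left(\int_1^x\frac{\epsilon(u)}{u}du\right)$ for $x\ge1$, where $\epsilon$ is twice differentiable and $\epsilon(x)\to0$ as $x\to\infty$. For $\beta>0$, $h\in R_\beta$ if for $x$ large enough $h(x)=x^\beta l(x)$ with $l\in R_0$ whose function $\epsilon$ satisfies $\limsup_{x\to\infty}x|\epsilon'(x)|<\infty$ and $\limsup_{x\to\infty}x^2|\epsilon''(x)|<\infty$. A function $l\in R_0$ belongs to $\widetilde{R_0}$ if $l(x)\to\infty$ as $x\to\infty$, $\lim_{x\to\infty}\frac{x\epsilon'(x)}{\epsilon(x)}=0$, $\lim_{x\to\infty}\frac{x^2\epsilon''(x)}{\epsilon(x)}=0$, and $\liminf_{x\to\infty}x^\eta\epsilon(x)>0$ for some $\eta\in(0,1/4)$. $h\in R_\infty$ if $h$ is increasing and strictly monotone and its inverse $\psi$ belongs to $\widetilde{R_0}$. Here $\psi(u):=h^{\leftarrow}(u):=\inf\{x:h(x)\ge u\}$ (this notation is used for all $h$). $\mathfrak{R}:=R_\beta\cup R_\infty$ (any $\beta>0$). $\Phi(t)=\int_0^\infty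 e^{tx}p(x)\,dx$; $m(t)=\frac{d}{dt}\log\Phi(t)$; $s^2(t)=\frac{d}{dt}m(t)$ with $s(t)>0$. The tilted density is $\pi^{a}(x)=\frac{e^{tx}p(x)}{\Phi(t)}$ with $t$ the unique solution of $m(t)=a$. Rate function: $I(x):=x\,m^{-1}(x)-\log\Phi(m^{-1}(x))$.
   Formalization: The formal theorem additionally assumes that h is bounded above on every interval (0,b]; without this ψ(u)=inf{x: h(x)≥u} can stay bounded or vanish identically (e.g. g=1+x²/2+√x), making the condition on ψ²/(√n ψ′) an undefined 0/0. It is automatic for h in R_∞. *)

theory Defs
  imports "HOL-Probability.Probability" "HOL-Library.Landau_Symbols"
begin

section \<open>Generalized inverse and regularity classes\<close>

text \<open>
  The function \<open>h = g'\<close> lives on the open half-line \<open>(0, \<infinity>)\<close>; its values at nonpositive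
  arguments are irrelevant throughout. If \<open>h\<close> is unbounded above on some interval \<open>(0, b]\<close>, the
  generalized inverse is bounded (and is constantly 0 if \<open>h\<close> is unbounded near 0); statements
  about its growth therefore have to assume that \<open>h\<close> is bounded above on each such interval. This
  is automatic for increasing \<open>h\<close> and for \<open>h\<close> continuous on \<open>[0, \<infinity>)\<close>.
\<close>

definition gen_inverse :: "(real \<Rightarrow> real) \<Rightarrow> real \<Rightarrow> real" where
  "gen_inverse h u = Inf {x. 0 < x \<and> u \<le> h x}"

text \<open>
  \<open>R0_rep l \<epsilon> \<epsilon>1 \<epsilon>2\<close>: \<open>l\<close> belongs to the class $R_0$, represented by the function \<open>\<epsilon>\<close>,
  which has the first and second derivatives \<open>\<epsilon>1\<close> and \<open>\<epsilon>2\<close> on \<open>[1, \<infinity>)\<close> (one-sided at 1).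
\<close>

definition R0_rep ::
  "(real \<Rightarrow> real) \<Rightarrow> (real \<Rightarrow> real) \<Rightarrow> (real \<Rightarrow> real) \<Rightarrow> (real \<Rightarrow> real) \<Rightarrow> bool" where
  "R0_rep l \<epsilon> \<epsilon>1 \<epsilon>2 \<longleftrightarrow>
     (\<forall>x\<ge>1. (\<epsilon> has_real_derivative \<epsilon>1 x) (at x within {1..})) \<and>
     (\<forall>x\<ge>1. (\<epsilon>1 has_real_derivative \<epsilon>2 x) (at x within {1..})) \<and>
     (\<epsilon> \<longlongrightarrow> 0) at_top \<and>
     (\<forall>x\<ge>1. l x = exp (integral {1..x} (\<lambda>u. \<epsilon> u / u)))"

definition R_beta :: "real \<Rightarrow> (real \<Rightarrow> real) set" where
  "R_beta \<beta> = {h. \<exists>l \<epsilon> \<epsilon>1 \<epsilon>2. R0_rep l \<epsilon> \<epsilon>1 \<epsilon>2 \<and>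
     (\<forall>\<^sub>F x in at_top. h x = x powr \<beta> * l x) \<and>
     Limsup at_top (\<lambda>x. ereal (x * \<bar>\<epsilon>1 x\<bar>)) < \<infinity> \<and>
     Limsup at_top (\<lambda>x. ereal (x\<^sup>2 * \<bar>\<epsilon>2 x\<bar>)) < \<infinity>}"

definition R0_tilde :: "(real \<Rightarrow> real) set" where
  "R0_tilde = {l. \<exists>\<epsilon> \<epsilon>1 \<epsilon>2. R0_rep l \<epsilon> \<epsilon>1 \<epsilon>2 \<and>
     filterlim l at_top at_top \<and>
     ((\<lambda>x. x * \<epsilon>1 x / \<epsilon> x) \<longlongrightarrow> 0) at_top \<and>
     ((\<lambda>x. x\<^sup>2 * \<epsilon>2 x / \<epsilon> x) \<longlongrightarrow> 0) at_top \<and>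
     (\<exists>\<eta>\<in>{0<..<1/4}. Liminf at_top (\<lambda>x. ereal (x powr \<eta> * \<epsilon> x)) > 0)}"

definition R_infinity :: "(real \<Rightarrow> real) set" where
  "R_infinity = {h. strict_mono_on {0<..} h \<and> gen_inverse h \<in> R0_tilde}"

definition R_class :: "(real \<Rightarrow> real) set" where
  "R_class = (\<Union>\<beta>\<in>{0<..}. R_beta \<beta>) \<union> R_infinity"


section \<open>Exponential tilting\<close>

definition mgf :: "(real \<Rightarrow> real) \<Rightarrow> real \<Rightarrow> real" where
  "mgf p t = (LINT x:{0..}|lborel. exp (t * x) * p x)"

definition tilt_mean :: "(real \<Rightarrow> real) \<Rightarrow> real \<Rightarrow> real" where
  "tilt_mean p t = deriv (\<lambda>u. ln (mgf p u)) t"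

definition tilt_sd :: "(real \<Rightarrow> real) \<Rightarrow> real \<Rightarrow> real" where
  "tilt_sd p t = sqrt (deriv (tilt_mean p) t)"

definition tilt_param :: "(real \<Rightarrow> real) \<Rightarrow> real \<Rightarrow> real" where
  "tilt_param p a = (THE t. tilt_mean p t = a)"

definition tilted_density :: "(real \<Rightarrow> real) \<Rightarrow> real \<Rightarrow> real \<Rightarrow> real" where
  "tilted_density p a x = exp (tilt_param p a * x) * p x / mgf p (tilt_param p a)"

definition rate_fun :: "(real \<Rightarrow> real) \<Rightarrow> real \<Rightarrow> real" where
  "rate_fun p x = x * tilt_param p x - ln (mgf p (tilt_param p x))"


section \<open>Conditional density of the first summand\<close>

text \<open>
  A density of the conditional law of \<open>X 1\<close> given \<open>X 1 + \<dots> + X n \<ge> b\<close> is only determined almost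
  everywhere. Statements about its value at a fixed point refer to the version given by Bayes'
  rule, in which the likelihood of the event given \<open>X 1 = y\<close> is the probability that
  \<open>y + X 2 + \<dots> + X n \<ge> b\<close>. The lemma \<open>distributed_cond_density_first\<close> shows that this is
  indeed a Lebesgue density of the conditional law.
\<close>

definition cond_density_first ::
  "'a measure \<Rightarrow> (nat \<Rightarrow> 'a \<Rightarrow> real) \<Rightarrow> (real \<Rightarrow> real) \<Rightarrow> nat \<Rightarrow> real \<Rightarrow> real \<Rightarrow> real" where
  "cond_density_first M X p n b y =
     p y * measure M {\<omega> \<in> space M. y + (\<Sum>i=2..n. X i \<omega>) \<ge> b}
         / measure M {\<omega> \<in> space M. (\<Sum>i=1..n. X i \<omega>) \<ge> b}"

lemma distributed_cond_density_first:
  fixes X :: "nat \<Rightarrow> 'a \<Rightarrow> real" and p :: "real \<Rightarrow> real"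
  assumes M: "prob_space M"
    and indep: "prob_space.indep_vars M (\<lambda>_. borel) X {1..}"
    and dens: "distributed M lborel (X 1) (\<lambda>x. ennreal (p x))"
    and p_nonneg: "\<And>x. 0 \<le> p x"
    and n: "n \<ge> 1"
    and pos: "measure M {\<omega> \<in> space M. (\<Sum>i=1..n. X i \<omega>) \<ge> b} > 0"
  shows "distributed (uniform_measure M {\<omega> \<in> space M. (\<Sum>i=1..n. X i \<omega>) \<ge> b}) lborel (X 1)
           (\<lambda>y. ennreal (cond_density_first M X p n b y))"
proof -
  interpret prob_space M by fact
  define Y where "Y = X 1"
  define T where "T = (\<lambda>\<omega>. \<Sum>i=2..n. X i \<omega>)"
  define S where "S = {\<omega> \<in> space M. (\<Sum>i=1..n. X i \<omega>) \<ge> b}"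
  define G where "G = (\<lambda>y. emeasure M {\<omega> \<in> space M. y + T \<omega> \<ge> b})"
  have X_meas: "X i \<in> borel_measurable M" if "i \<ge> 1" for i
    using indep that unfolding indep_vars_def by auto
  have X1 [measurable]: "Y \<in> borel_measurable M" unfolding Y_def by (rule X_meas) simp
  have T [measurable]: "T \<in> borel_measurable M"
    unfolding T_def by (intro borel_measurable_sum X_meas) auto
  have split: "(\<Sum>i=1..n. X i \<omega>) = Y \<omega> + T \<omega>" for \<omega>
    using n unfolding T_def Y_def
    by (subst sum.atLeast_Suc_atMost) (simp_all add: numeral_2_eq_2)
  have S_eq: "S = {\<omega> \<in> space M. Y \<omega> + T \<omega> \<ge> b}" unfolding S_def split ..
  have S_sets [measurable]: "S \<in> sets M" unfolding S_eq by measurable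
  have pn [measurable]: "(\<lambda>x. ennreal (p x)) \<in> borel_measurable borel"
    using dens unfolding Y_def[symmetric] by (auto simp: distributed_def)
  have dist_X1: "distr M borel (Y) = density lborel (\<lambda>x. ennreal (p x))"
  proof -
    have "distr M borel (Y) = distr M lborel (Y)" by (rule distr_cong) auto
    then show ?thesis using dens unfolding Y_def[symmetric] by (simp add: distributed_def)
  qed
  have iv: "indep_var borel (Y) borel T"
    unfolding T_def Y_def
    by (rule indep_vars_sum) (auto intro: indep_vars_subset[OF indep])
  then have prod: "distr M borel (Y) \<Otimes>\<^sub>M distr M borel T
      = distr M (borel \<Otimes>\<^sub>M borel) (\<lambda>\<omega>. (Y \<omega>, T \<omega>))"
    by (simp add: indep_var_distribution_eq)
  interpret T: prob_space "distr M borel T" by (rule prob_space_distr) simp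
  interpret X: prob_space "distr M borel (Y)" by (rule prob_space_distr) simp
  have G_alt: "G y = emeasure (distr M borel T) (Pair y -` {z. fst z + snd z \<ge> b})" for y
    unfolding G_def by (subst emeasure_distr) (auto intro!: arg_cong[where f="emeasure M"])
  have Gm [measurable]: "G \<in> borel_measurable borel"
  proof -
    have "{z::real \<times> real. fst z + snd z \<ge> b} \<in> sets (borel \<Otimes>\<^sub>M distr M borel T)"
    proof -
      have "{z \<in> space (borel \<Otimes>\<^sub>M borel). fst z + snd z \<ge> b} \<in> sets (borel \<Otimes>\<^sub>M (borel::real measure))"
        by measurable
      moreover have "sets (borel \<Otimes>\<^sub>M distr M borel T) = sets ((borel::real measure) \<Otimes>\<^sub>M borel)"
        by (intro sets_pair_measure_cong) auto
      ultimately show ?thesis by (simp add: space_pair_measure)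
    qed
    from T.measurable_emeasure_Pair[OF this] show ?thesis unfolding G_alt .
  qed
  have joint: "emeasure M (S \<inter> Y -` A \<inter> space M)
      = (\<integral>\<^sup>+ y. ennreal (p y) * G y * indicator A y \<partial>lborel)" if A [measurable]: "A \<in> sets borel" for A
  proof -
    let ?B = "{z::real \<times> real. fst z \<in> A \<and> fst z + snd z \<ge> b}"
    have B: "?B \<in> sets (borel \<Otimes>\<^sub>M borel)"
    proof -
      have "{z \<in> space (borel \<Otimes>\<^sub>M borel). fst z \<in> A \<and> fst z + snd z \<ge> b}
              \<in> sets (borel \<Otimes>\<^sub>M (borel::real measure))" by measurable
      then show ?thesis by (simp add: space_pair_measure)
    qed
    have "emeasure M (S \<inter> Y -` A \<inter> space M)
        = emeasure (distr M (borel \<Otimes>\<^sub>M borel) (\<lambda>\<omega>. (Y \<omega>, T \<omega>))) ?B"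
      using B by (subst emeasure_distr) (auto simp: S_eq intro!: arg_cong[where f="emeasure M"])
    also have "\<dots> = emeasure (distr M borel (Y) \<Otimes>\<^sub>M distr M borel T) ?B"
      by (simp add: prod)
    also have "\<dots> = (\<integral>\<^sup>+ y. emeasure (distr M borel T) (Pair y -` ?B) \<partial>distr M borel (Y))"
    proof (rule T.emeasure_pair_measure_alt)
      have "sets (distr M borel (Y) \<Otimes>\<^sub>M distr M borel T) = sets ((borel::real measure) \<Otimes>\<^sub>M borel)"
        by (intro sets_pair_measure_cong) auto
      then show "?B \<in> sets (distr M borel (Y) \<Otimes>\<^sub>M distr M borel T)" using B by simp
    qed
    also have "\<dots> = (\<integral>\<^sup>+ y. G y * indicator A y \<partial>distr M borel (Y))"
      by (intro nn_integral_cong) (auto simp: G_alt indicator_def vimage_def)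
    also have "\<dots> = (\<integral>\<^sup>+ y. ennreal (p y) * (G y * indicator A y) \<partial>lborel)"
      unfolding dist_X1 by (rule nn_integral_density) measurable
    finally show ?thesis by (simp add: mult.assoc)
  qed
  have Spos: "emeasure M S \<noteq> 0" "emeasure M S \<noteq> \<infinity>"
    using pos by (auto simp: S_def emeasure_eq_measure)
  have cd: "ennreal (cond_density_first M X p n b y) = ennreal (p y) * G y / emeasure M S" for y
    using pos unfolding cond_density_first_def G_def T_def S_def
    by (simp add: emeasure_eq_measure divide_ennreal ennreal_mult[symmetric] p_nonneg)
  have "distr (uniform_measure M S) lborel (Y)
      = density lborel (\<lambda>y. ennreal (cond_density_first M X p n b y))"
  proof (rule measure_eqI)
    fix A assume "A \<in> sets (distr (uniform_measure M S) lborel (Y))"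
    then have A [measurable]: "A \<in> sets borel" by simp
    have "emeasure (distr (uniform_measure M S) lborel (Y)) A
        = emeasure (uniform_measure M S) (Y -` A \<inter> space M)"
      by (subst emeasure_distr) auto
    also have "\<dots> = emeasure M (S \<inter> (Y -` A \<inter> space M)) / emeasure M S"
      by (rule emeasure_uniform_measure) auto
    also have "\<dots> = (\<integral>\<^sup>+ y. ennreal (p y) * G y * indicator A y \<partial>lborel) / emeasure M S"
      using joint[OF A] by (simp add: Int_assoc)
    also have "\<dots> = (\<integral>\<^sup>+ y. ennreal (p y) * G y * indicator A y / emeasure M S \<partial>lborel)"
      by (rule nn_integral_divide[symmetric]) measurable
    also have "\<dots> = (\<integral>\<^sup>+ y. ennreal (cond_density_first M X p n b y) * indicator A y \<partial>lborel)"
      by (intro nn_integral_cong) (auto simp: cd indicator_def)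
    also have "\<dots> = emeasure (density lborel (\<lambda>y. ennreal (cond_density_first M X p n b y))) A"
      by (subst emeasure_density) (auto simp: cd)
    finally show "emeasure (distr (uniform_measure M S) lborel (Y)) A = \<dots>" .
  qed simp
  then show ?thesis
    unfolding distributed_def S_def[symmetric] Y_def[symmetric] by (auto simp: cd)
qed

definition gA :: "(real \<Rightarrow> real) \<Rightarrow> nat \<Rightarrow> real \<Rightarrow> real \<Rightarrow> real \<Rightarrow> real \<Rightarrow> real" where
  "gA p n t a \<eta> y =
     real n * t * tilt_sd p t * exp (real n * rate_fun p a) *
     (LINT \<tau>:{a..a + \<eta>}|lborel.
        tilted_density p \<tau> y *
        exp (- real n * rate_fun p \<tau> - ln (tilt_sd p (tilt_param p \<tau>))))"

end

theory Submission
  imports Defs "HOL-Real_Asymp.Real_Asymp"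
begin

text \<open>
  Under the density tilted by \<open>t = t\<^sub>n\<close>, with mean \<open>a = a\<^sub>n\<close> and standard deviation \<open>s\<close>, the
  quotient of \<open>p\<^sub>A(y)\<close> and \<open>\<pi>\<^sup>a(y)\<close> is \<open>K(n - 1, (a - y)/s) / K(n, 0)\<close>, where
  \<open>K(k, d) = \<integral> \<zeta>(v)\<^sup>k exp(- i v d) / (t s + i v) dv\<close> and \<open>\<zeta>\<close> is the characteristic function of
  the standardised tilted density. The integrand of \<open>K(n - 1, d) - K(n, 0)\<close> contains the factor
  \<open>exp(- i v d) - \<zeta>(v) = - i v d + O(v\<^sup>2 (1 + d\<^sup>2))\<close>; the linear term is odd up to a skewness
  correction, so the quotient is \<open>1 + O((1 + d\<^sup>2) / n)\<close>, and no Edgeworth expansion is needed. The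
  growth hypothesis says that \<open>a\<^sup>2 / s\<^sup>2\<close> is of smaller order than \<open>\<surd>n\<close>.

  The constants are uniform in \<open>t\<close> because \<open>h'\<close> varies by bounded factors on the scale of the tilted
  density: the latter is comparable to a bump of width \<open>\<surd>\<psi>'(t)\<close> at \<open>\<psi>(t)\<close> with exponential
  tails. Only constant factors matter here, so \<open>q\<close> enters through its boundedness alone.

  The logarithmic derivative in \<open>\<tau>\<close> of the integrand of \<open>g\<^sub>A\<close> is
  \<open>- n t\<^sub>\<tau> + (y - \<tau>) / s\<^sup>2 - \<mu>\<^sub>3 / (2 s\<^sup>4)\<close>, with \<open>s\<close> and the third central moment \<open>\<mu>\<^sub>3\<close> taken at
  \<open>t\<^sub>\<tau>\<close>; hence the integral is \<open>1 / (n t)\<close> times the integrand at \<open>a\<close>, up to an admissible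
  relative error, as soon as \<open>\<eta>\<close> exceeds \<open>log n / (n t)\<close>.
\<close>

section \<open>Fourier inversion for exponential tails\<close>

text \<open>Since \<open>t n\<close> tends to infinity, the tilted summands form a triangular array
  and no expansion for a fixed law applies; every constant must be uniform over a class of
  standardised densities. The class is \<open>std_density\<close>, and its conditions serve
  different ranges of \<open>v\<close>: the third moment fixes the characteristic function near 0,
  the lower bound on an interval keeps it away from 1 elsewhere, and the sup bound makes its square
  integrable, so that all but two factors of a power can be spent on exponential smallness. The
  point \<open>y\<close> is fixed while the tilted mass moves away from it, so nothing is
  approximated at \<open>y\<close>: the tilted density there is an exact common factor of both
  sides. The relative error is of order \<open>(1 + a^2 / s^2) / n\<close> for the conditional
  density, and the same plus \<open>ln n / n\<close> for the integral, where
  \<open>ln n / (n t)\<close> is the length over which the integrand drops by a factor of about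
  \<open>n\<close>. Under the growth hypothesis all of this is of smaller order than
  \<open>1 / sqrt n\<close>.\<close>

lemma gaussian_fourier:
  fixes x \<sigma> :: real
  assumes "\<sigma> > 0"
  shows "(CLINT u|lborel. iexp (u * x) * exp (- ((\<sigma> * u)\<^sup>2 / 2))) = 2 * pi * normal_density 0 \<sigma> x"
proof -
  have "(CLINT u|lborel. iexp (u * x) * exp (- ((\<sigma> * u)\<^sup>2 / 2)))
     = \<bar>1/\<sigma>\<bar> *\<^sub>R (CLINT u|lborel. iexp ((0 + 1/\<sigma> * u) * x) * exp (- ((\<sigma> * (0 + 1/\<sigma> * u))\<^sup>2 / 2)))"
    using assms by (intro lborel_integral_real_affine) auto
  also have "(\<lambda>u. iexp ((0 + 1/\<sigma> * u) * x) * exp (- ((\<sigma> * (0 + 1/\<sigma> * u))\<^sup>2 / 2)))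
      = (\<lambda>u. sqrt (2*pi) * (std_normal_density u *\<^sub>R iexp (x / \<sigma> * u)))"
    using assms by (auto simp: std_normal_density_def scaleR_conv_of_real mult.commute)
  also have "(CLINT u|lborel. sqrt (2*pi) * (std_normal_density u *\<^sub>R iexp (x / \<sigma> * u)))
      = sqrt (2*pi) * (CLINT u|lborel. (std_normal_density u *\<^sub>R iexp (x / \<sigma> * u)))"
    by (rule integral_mult_right_zero)
  also have "(CLINT u|lborel. (std_normal_density u *\<^sub>R iexp (x / \<sigma> * u))) = char std_normal_distribution (x/\<sigma>)"
    unfolding char_def by (subst integral_density) auto
  also have "\<dots> = complex_of_real (exp (- ((x/\<sigma>)^2) / 2))"
    by (simp add: char_std_normal_distribution)
  finally have 1: "(CLINT u|lborel. iexp (u * x) * exp (- ((\<sigma> * u)\<^sup>2 / 2)))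
     = complex_of_real (\<bar>1/\<sigma>\<bar> * (sqrt (2*pi) * exp (- ((x/\<sigma>)^2) / 2)))"
    by (simp only: scaleR_conv_of_real of_real_mult)
  have "sqrt (2*pi) * sqrt (2*pi) = 2 * pi" by simp
  then have "\<bar>1/\<sigma>\<bar> * (sqrt (2*pi) * exp (- ((x/\<sigma>)^2) / 2)) = 2 * pi * normal_density 0 \<sigma> x"
    using assms unfolding normal_density_def
    by (simp add: real_sqrt_mult field_simps power_divide)
  then show ?thesis using 1 by simp
qed

lemma integrable_gaussian:
  fixes \<sigma> :: real
  assumes "\<sigma> > 0"
  shows "integrable lborel (\<lambda>u. exp (- ((\<sigma> * u)\<^sup>2 / 2)))"
proof -
  have "(\<lambda>u. exp (- ((\<sigma> * u)\<^sup>2 / 2))) = (\<lambda>u. sqrt (2 * pi * (1/\<sigma>)\<^sup>2) * normal_density 0 (1/\<sigma>) u)"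
    using assms unfolding normal_density_def by (auto simp: power_divide power_mult_distrib)
  then show ?thesis using assms by simp
qed

section \<open>Inversion with a Gaussian convergence factor\<close>

context real_distribution begin

text \<open>The inversion integral of a general law need not converge. With a Gaussian damping
  factor Fubini applies, and the result is the law convolved with a normal density of small width
  \<open>\<sigma>\<close>, evaluated at \<open>b\<close>.\<close>

lemma char_gaussian:
  assumes "\<sigma> > 0"
  shows "(CLINT u|lborel. char M u * iexp (- (u * b)) * exp (- ((\<sigma> * u)\<^sup>2 / 2)))
     = 2 * pi * (LINT x|M. normal_density 0 \<sigma> (x - b))"
proof -
  interpret P: pair_sigma_finite M lborel ..
  define f where "f = (\<lambda>x u. iexp (u * (x - b)) * complex_of_real (exp (- ((\<sigma> * u)\<^sup>2 / 2))))"
  have fm: "case_prod f \<in> borel_measurable (M \<Otimes>\<^sub>M lborel)"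
    unfolding f_def by measurable
  have nf: "norm (f x u) = exp (- ((\<sigma> * u)\<^sup>2 / 2))" for x u
    by (simp only: f_def norm_mult norm_exp_i_times) simp
  have int: "integrable (M \<Otimes>\<^sub>M lborel) (case_prod f)"
  proof (rule P.Fubini_integrable[OF fm])
    show "integrable M (\<lambda>x. LINT y|lborel. norm (case (x, y) of (x, y) \<Rightarrow> f x y))"
      by (simp add: nf)
    show "AE x in M. integrable lborel (\<lambda>y. case (x, y) of (x, y) \<Rightarrow> f x y)"
    proof (rule AE_I2)
      fix x
      show "integrable lborel (\<lambda>y. case (x, y) of (x, y) \<Rightarrow> f x y)"
        by (rule Bochner_Integration.integrable_bound[OF integrable_gaussian[OF assms]])
           (auto simp: nf, simp add: f_def)
    qed
  qed
  have "(CLINT u|lborel. char M u * iexp (- (u * b)) * exp (- ((\<sigma> * u)\<^sup>2 / 2)))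
      = (CLINT u|lborel. CLINT x|M. f x u)"
  proof (rule Bochner_Integration.integral_cong[OF refl])
    fix u
    have "char M u * iexp (- (u * b)) * exp (- ((\<sigma> * u)\<^sup>2 / 2))
      = (CLINT x|M. iexp (u * x) * (iexp (- (u * b)) * exp (- ((\<sigma> * u)\<^sup>2 / 2))))"
      unfolding char_def by (subst integral_mult_left_zero) (simp add: mult.assoc)
    also have "\<dots> = (CLINT x|M. f x u)"
      unfolding f_def by (intro Bochner_Integration.integral_cong)
        (auto simp: exp_add[symmetric] algebra_simps exp_of_real[symmetric] simp del: exp_of_real)
    finally show "char M u * iexp (- (u * b)) * exp (- ((\<sigma> * u)\<^sup>2 / 2)) = (CLINT x|M. f x u)" .
  qed
  also have "\<dots> = (CLINT x|M. CLINT u|lborel. f x u)"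
    by (rule P.Fubini_integral[OF int])
  also have "\<dots> = (CLINT x|M. complex_of_real (2 * pi * normal_density 0 \<sigma> (x - b)))"
    unfolding f_def by (intro Bochner_Integration.integral_cong refl) (subst gaussian_fourier[OF assms], simp)
  also have "\<dots> = 2 * pi * (LINT x|M. normal_density 0 \<sigma> (x - b))"
    by (subst integral_complex_of_real) (simp)
  finally show ?thesis .
qed

text \<open>One half of Plancherel. Averaging \<open>char_gaussian\<close> over \<open>b\<close>
  with respect to \<open>M\<close> itself turns the factor \<open>iexp (- (u * b))\<close> into the
  conjugate of \<open>char M u\<close>; so the damped integral of the squared modulus is
  \<open>2 * pi\<close> times an average of the smoothed density, hence at most
  \<open>2 * pi * B\<close>. Fatou's lemma removes the damping.\<close>

lemma char_square_nn_integral_le: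
  assumes M: "M = density lborel (\<lambda>x. ennreal (f x))" and [measurable]: "f \<in> borel_measurable borel"
    and f: "\<And>x. 0 \<le> f x" "\<And>x. f x \<le> B"
  shows "(\<integral>\<^sup>+u. ennreal ((cmod (char M u))\<^sup>2) \<partial>lborel) \<le> ennreal (2 * pi * B)"
proof -
  have B: "B \<ge> 0" using f(1)[of 0] f(2)[of 0] by simp
  have conv: "(LINT x|M. normal_density 0 \<sigma> (x - b)) \<le> B" "(LINT x|M. normal_density 0 \<sigma> (x - b)) \<ge> 0"
    if "\<sigma> > 0" for \<sigma> b
  proof -
    have nd: "normal_density 0 \<sigma> (x - b) = normal_density b \<sigma> x" for x
      by (simp add: normal_density_def)
    have "(LINT x|M. normal_density 0 \<sigma> (x - b)) = (LINT x|lborel. f x * normal_density b \<sigma> x)"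
      unfolding nd M by (subst integral_density) (auto simp: f)
    also have "\<dots> \<le> (LINT x|lborel. B * normal_density b \<sigma> x)"
    proof (rule integral_mono)
      show i: "integrable lborel (\<lambda>x. B * normal_density b \<sigma> x)" using that by simp
      show "integrable lborel (\<lambda>x. f x * normal_density b \<sigma> x)"
        by (rule Bochner_Integration.integrable_bound[OF i]) (auto simp: f B abs_mult intro!: mult_right_mono)
      show "f x * normal_density b \<sigma> x \<le> B * normal_density b \<sigma> x" for x
        by (intro mult_right_mono f normal_density_nonneg)
    qed
    also have "\<dots> = B" using that by simp
    finally show "(LINT x|M. normal_density 0 \<sigma> (x - b)) \<le> B" .
    show "(LINT x|M. normal_density 0 \<sigma> (x - b)) \<ge> 0"
      by (rule integral_nonneg_AE) (auto simp: normal_density_nonneg)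
  qed
  define F where "F = (\<lambda>\<sigma> u. (cmod (char M u))\<^sup>2 * exp (- ((\<sigma> * u)\<^sup>2 / 2)))"
  have Fi: "integrable lborel (F \<sigma>)" if "\<sigma> > 0" for \<sigma>
  proof (rule Bochner_Integration.integrable_bound[OF integrable_gaussian[OF that]])
    show "AE x in lborel. norm (F \<sigma> x) \<le> norm (exp (- ((\<sigma> * x)\<^sup>2 / 2)))"
      unfolding F_def using cmod_char_le_1 by (auto simp: power_le_one)
  qed (simp add: F_def)
  have FB: "(LINT u|lborel. F \<sigma> u) \<le> 2 * pi * B" if \<sigma>: "\<sigma> > 0" for \<sigma>
  proof -
    interpret P: pair_sigma_finite M lborel ..
    define k where "k = (\<lambda>b u. char M u * iexp (- (u * b)) * complex_of_real (exp (- ((\<sigma> * u)\<^sup>2 / 2))))"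
    have km: "case_prod k \<in> borel_measurable (M \<Otimes>\<^sub>M lborel)"
      unfolding k_def by measurable
    have nk: "norm (k x u) = cmod (char M u) * exp (- ((\<sigma> * u)\<^sup>2 / 2))" for x u
      by (simp only: k_def norm_mult norm_exp_i_times) simp
    have ik: "integrable lborel (k x)" for x
    proof (rule Bochner_Integration.integrable_bound[OF integrable_gaussian[OF \<sigma>]])
      show "AE u in lborel. norm (k x u) \<le> norm (exp (- ((\<sigma> * u)\<^sup>2 / 2)))"
        by (auto simp: nk cmod_char_le_1)
    qed (simp add: k_def)
    have int: "integrable (M \<Otimes>\<^sub>M lborel) (case_prod k)"
      by (rule P.Fubini_integrable[OF km]) (auto simp: ik, simp add: nk)
    have "complex_of_real (LINT u|lborel. F \<sigma> u) = (CLINT u|lborel. complex_of_real (F \<sigma> u))"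
      by simp
    also have "\<dots> = (CLINT u|lborel. CLINT b|M. k b u)"
    proof (rule Bochner_Integration.integral_cong[OF refl])
      fix u
      have c: "(CLINT b|M. iexp (- (u * b))) = cnj (char M u)"
      proof -
        have "cnj (char M u) = (CLINT b|M. cnj (iexp (u * b)))"
          unfolding char_def by (rule Bochner_Integration.integral_cnj[symmetric])
        also have "\<dots> = (CLINT b|M. iexp (- (u * b)))"
          by (intro Bochner_Integration.integral_cong refl) (simp add: exp_cnj)
        finally show ?thesis by simp
      qed
      have "complex_of_real (F \<sigma> u) = char M u * cnj (char M u) * exp (- ((\<sigma> * u)\<^sup>2 / 2))"
        unfolding F_def complex_norm_square[symmetric] by simp
      also have "\<dots> = (char M u * exp (- ((\<sigma> * u)\<^sup>2 / 2))) * (CLINT b|M. iexp (- (u * b)))"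
        unfolding c by simp
      also have "\<dots> = (CLINT b|M. (char M u * exp (- ((\<sigma> * u)\<^sup>2 / 2))) * iexp (- (u * b)))"
        by (rule integral_mult_right_zero[symmetric])
      also have "\<dots> = (CLINT b|M. k b u)" unfolding k_def by (simp add: mult_ac)
      finally show "complex_of_real (F \<sigma> u) = (CLINT b|M. k b u)" .
    qed
    also have "\<dots> = (CLINT b|M. CLINT u|lborel. k b u)"
      by (rule P.Fubini_integral[OF int])
    also have "\<dots> = (CLINT b|M. complex_of_real (2 * pi * (LINT x|M. normal_density 0 \<sigma> (x - b))))"
      unfolding k_def char_gaussian[OF \<sigma>] by simp
    also have "\<dots> = complex_of_real (LINT b|M. (2 * pi * (LINT x|M. normal_density 0 \<sigma> (x - b))))"
      by (rule integral_complex_of_real)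
    finally have eq: "(LINT u|lborel. F \<sigma> u) = (LINT b|M. (2 * pi * (LINT x|M. normal_density 0 \<sigma> (x - b))))"
      using of_real_eq_iff by blast
    also have "\<dots> \<le> 2 * pi * B"
    proof (rule integral_le_const)
      have "(\<lambda>b. LINT x|M. normal_density 0 \<sigma> (x - b)) \<in> borel_measurable M"
        by (rule borel_measurable_lebesgue_integral) (auto simp: normal_density_def)
      then show "integrable M (\<lambda>b. 2 * pi * (LINT x|M. normal_density 0 \<sigma> (x - b)))"
        by (intro integrable_mult_right integrable_const_bound[where B = B])
           (auto simp: conv[OF \<sigma>])
      show "AE b in M. 2 * pi * (LINT x|M. normal_density 0 \<sigma> (x - b)) \<le> 2 * pi * B"
        using conv[OF \<sigma>] by (auto intro!: mult_left_mono)
    qed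
    finally show ?thesis .
  qed
  have "(\<integral>\<^sup>+u. ennreal ((cmod (char M u))\<^sup>2) \<partial>lborel)
      = (\<integral>\<^sup>+u. liminf (\<lambda>n. ennreal (F (1 / real (Suc n)) u)) \<partial>lborel)"
  proof (rule nn_integral_cong)
    fix u
    have "(\<lambda>n. ennreal (F (1 / real (Suc n)) u)) \<longlonglongrightarrow> ennreal ((cmod (char M u))\<^sup>2 * exp (- ((0 * u)\<^sup>2 / 2)))"
      unfolding F_def
      by (intro tendsto_intros tendsto_ennrealI LIMSEQ_Suc[OF lim_1_over_n]) auto
    then have "liminf (\<lambda>n. ennreal (F (1 / real (Suc n)) u)) = ennreal ((cmod (char M u))\<^sup>2)"
      using lim_imp_Liminf[OF sequentially_bot] by fastforce
    then show "ennreal ((cmod (char M u))\<^sup>2) = liminf (\<lambda>n. ennreal (F (1 / real (Suc n)) u))" by simp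
  qed
  also have "\<dots> \<le> liminf (\<lambda>n. \<integral>\<^sup>+u. ennreal (F (1 / real (Suc n)) u) \<partial>lborel)"
    by (rule nn_integral_liminf) (simp add: F_def)
  also have "\<dots> \<le> liminf (\<lambda>n::nat. ennreal (2 * pi * B))"
  proof (rule Liminf_mono, rule always_eventually, rule allI)
    fix n
    have "(\<integral>\<^sup>+u. ennreal (F (1 / real (Suc n)) u) \<partial>lborel) = ennreal (LINT u|lborel. F (1 / real (Suc n)) u)"
      by (rule nn_integral_eq_integral[OF Fi]) (auto simp: F_def)
    also have "\<dots> \<le> ennreal (2 * pi * B)" by (intro ennreal_leI FB) simp
    finally show "(\<integral>\<^sup>+u. ennreal (F (1 / real (Suc n)) u) \<partial>lborel) \<le> ennreal (2 * pi * B)" .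
  qed
  also have "\<dots> = ennreal (2 * pi * B)" by (simp add: Liminf_const)
  finally show ?thesis .
qed

lemma char_square_integrable:
  assumes M: "M = density lborel (\<lambda>x. ennreal (f x))" and fm: "f \<in> borel_measurable borel"
    and f: "\<And>x. 0 \<le> f x" "\<And>x. f x \<le> B"
  shows "integrable lborel (\<lambda>u. (cmod (char M u))\<^sup>2)"
    and "(LINT u|lborel. (cmod (char M u))\<^sup>2) \<le> 2 * pi * B"
proof -
  have B: "B \<ge> 0" using f(1)[of 0] f(2)[of 0] by simp
  note le = char_square_nn_integral_le[OF assms]
  show i: "integrable lborel (\<lambda>u. (cmod (char M u))\<^sup>2)"
    by (rule integrableI_bounded) (use le in \<open>auto simp: top.extremum_strict less_top[symmetric] top_unique\<close>)
  show "(LINT u|lborel. (cmod (char M u))\<^sup>2) \<le> 2 * pi * B"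
    using le B nn_integral_eq_integral[OF i] by (simp add: ennreal_le_iff)
qed

text \<open>An atom at \<open>b\<close> would force the smoothed density at \<open>b\<close> to be
  at least its mass times \<open>1 / (\<sigma> * sqrt (2 * pi))\<close>, which is unbounded as
  \<sigma> tends to 0, whereas the damped inversion integral stays below the integral of the modulus
  of the characteristic function.\<close>

lemma atomless_if_integrable_char:
  assumes i: "integrable lborel (char M)"
  shows "measure M {b} = 0"
proof -
  define C where "C = (LINT u|lborel. cmod (char M u))"
  have C: "C \<ge> 0" unfolding C_def by simp
  have *: "measure M {b} \<le> \<sigma> * C" if \<sigma>: "\<sigma> > 0" for \<sigma>
  proof -
    have ind: "integrable M (\<lambda>x. normal_density 0 \<sigma> (x - b))"
      by (rule integrable_const_bound[where B = "normal_density 0 \<sigma> 0"])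
         (auto simp: normal_density_def divide_simps)
    have in2: "integrable M (indicator {b} :: real \<Rightarrow> real)"
      by (rule integrable_const_bound[where B = 1]) (auto simp: indicator_def)
    have "measure M {b} * normal_density 0 \<sigma> 0 = (LINT x|M. indicator {b} x * normal_density 0 \<sigma> 0)"
      by simp
    also have "\<dots> \<le> (LINT x|M. normal_density 0 \<sigma> (x - b))"
      by (intro integral_mono ind integrable_mult_left in2) (auto simp: indicator_def)
    finally have "2 * pi * (measure M {b} * normal_density 0 \<sigma> 0) \<le> 2 * pi * (LINT x|M. normal_density 0 \<sigma> (x - b))"
      by simp
    also have "\<dots> = Re (CLINT u|lborel. char M u * iexp (- (u * b)) * exp (- ((\<sigma> * u)\<^sup>2 / 2)))"
      by (subst char_gaussian[OF \<sigma>]) simp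
    also have "\<dots> \<le> cmod (CLINT u|lborel. char M u * iexp (- (u * b)) * exp (- ((\<sigma> * u)\<^sup>2 / 2)))"
      by (rule complex_Re_le_cmod)
    also have "\<dots> \<le> (LINT u|lborel. cmod (char M u * iexp (- (u * b)) * exp (- ((\<sigma> * u)\<^sup>2 / 2))))"
      by (rule integral_norm_bound)
    also have "\<dots> \<le> C"
      unfolding C_def
    proof (rule integral_mono')
      show "integrable lborel (\<lambda>u. cmod (char M u))" using i by simp
      show "cmod (char M u * iexp (- (u * b)) * exp (- ((\<sigma> * u)\<^sup>2 / 2))) \<le> cmod (char M u)" for u
        unfolding norm_mult norm_exp_i_times by (simp add: mult_left_le)
    qed auto
    finally have le: "2 * pi * (measure M {b} * normal_density 0 \<sigma> 0) \<le> C" .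
    have "measure M {b} \<le> \<sigma> * (2 * pi * (measure M {b} * normal_density 0 \<sigma> 0))"
    proof -
      have "sqrt (2 * pi) \<ge> 1" using pi_ge_two by (simp add: real_le_rsqrt)
      moreover have "\<sigma> * (2 * pi * (measure M {b} * normal_density 0 \<sigma> 0)) = measure M {b} * (2 * pi / sqrt (2*pi))"
        using \<sigma> unfolding normal_density_def by (simp add: real_sqrt_mult)
      moreover have "2 * pi / sqrt (2*pi) = sqrt (2*pi)" using real_div_sqrt[of "2*pi"] by simp
      ultimately have "\<sigma> * (2 * pi * (measure M {b} * normal_density 0 \<sigma> 0)) = measure M {b} * sqrt (2 * pi)"
        by metis
      moreover have "measure M {b} * sqrt (2 * pi) \<ge> measure M {b} * 1"
        using \<open>sqrt (2 * pi) \<ge> 1\<close> by (intro mult_left_mono) auto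
      ultimately show ?thesis by argo
    qed
    also have "\<dots> \<le> \<sigma> * C" using le \<sigma> by (intro mult_left_mono) auto
    finally show ?thesis .
  qed
  have "measure M {b} \<le> 0"
  proof (rule field_le_epsilon)
    fix e :: real assume "e > 0"
    then have "measure M {b} \<le> e / (C + 1) * C" using C by (intro *) auto
    also have "\<dots> \<le> e" using \<open>e > 0\<close> C by (simp add: field_simps)
    finally show "measure M {b} \<le> 0 + e" by simp
  qed
  then show ?thesis by (simp add: measure_le_0_iff)
qed

text \<open>Levy's formula is a limit over growing symmetric intervals and asks for end points
  without mass. Integrability of the characteristic function supplies both: there are no atoms, and
  since the kernel is bounded by \<open>v\<close>, dominated convergence replaces the limit by an
  absolutely convergent integral.\<close>

lemma measure_Ioc_char:
  assumes i: "integrable lborel (char M)" and "v \<ge> 0"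
  shows "complex_of_real (measure M {b<..b+v})
    = 1 / (2 * pi) * (CLINT u|lborel. iexp (- (u * b)) * ((1 - iexp (- (u * v))) / (\<i> * u)) * char M u)"
proof -
  define F where "F = (\<lambda>u. (iexp (- (u * b)) - iexp (- (u * (b + v)))) / (\<i> * u) * char M u)"
  have F_eq: "F = (\<lambda>u. iexp (- (u * b)) * ((1 - iexp (- (u * v))) / (\<i> * u)) * char M u)"
    unfolding F_def by (intro ext) (simp add: algebra_simps exp_add[symmetric] diff_divide_distrib)
  have Fb: "cmod (F u) \<le> v * cmod (char M u)" for u
  proof -
    have "cmod (1 - iexp (- (u * v))) \<le> \<bar>u * v\<bar>"
      using iexp_approx1[of "-(u * v)" 0] by (simp add: norm_minus_commute)
    then have "cmod ((1 - iexp (- (u * v))) / (\<i> * u)) \<le> v"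
      using \<open>v \<ge> 0\<close> by (cases "u = 0") (auto simp: norm_divide norm_mult abs_mult divide_simps mult.commute)
    then show ?thesis unfolding F_eq norm_mult norm_exp_i_times by (simp add: mult_right_mono)
  qed
  have Fi: "integrable lborel F"
    by (rule Bochner_Integration.integrable_bound[of _ "\<lambda>u. v * cmod (char M u)"])
       (use i Fb \<open>v \<ge> 0\<close> in \<open>auto simp: F_def\<close>)
  have "(\<lambda>T. 1 / (2 * pi) * (CLBINT t=-real T..real T. F t)) \<longlonglongrightarrow> measure M {b<..b+v}"
    using Levy_Inversion[of b "b+v"] \<open>v \<ge> 0\<close> atomless_if_integrable_char[OF i] unfolding F_def by simp
  moreover have "(\<lambda>T. 1 / (2 * pi) * (CLBINT t=-real T..real T. F t)) \<longlonglongrightarrow> 1 / (2 * pi) * (CLINT u|lborel. F u)"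
  proof (intro tendsto_mult tendsto_const)
    have "(\<lambda>T. CLINT t|lborel. indicator {-real T<..<real T} t *\<^sub>R F t) \<longlonglongrightarrow> (CLINT u|lborel. F u)"
    proof (rule integral_dominated_convergence)
      show "integrable lborel (\<lambda>u. cmod (F u))" using Fi by simp
      show "AE u in lborel. (\<lambda>T. indicator {-real T<..<real T} u *\<^sub>R F u) \<longlonglongrightarrow> F u"
      proof (rule AE_I2, rule tendsto_eventually)
        fix u :: real
        obtain N where "\<bar>u\<bar> < real N" using reals_Archimedean2 by blast
        then show "\<forall>\<^sub>F T in sequentially. indicator {-real T<..<real T} u *\<^sub>R F u = F u"
          by (intro eventually_sequentiallyI[of N]) (auto simp: indicator_def)
      qed
    qed (use Fi in \<open>auto simp: indicator_def\<close>)
    then show "(\<lambda>T. CLBINT t=-real T..real T. F t) \<longlonglongrightarrow> (CLINT u|lborel. F u)"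
      by (simp add: interval_lebesgue_integral_def set_lebesgue_integral_def einterval_def greaterThanLessThan_def greaterThan_def lessThan_def Int_def)
  qed
  ultimately show ?thesis unfolding F_eq using LIMSEQ_unique by blast
qed

end

section \<open>Exponential weights as averages over intervals of random length\<close>

lemma exponential_distribution_atleast:
  assumes l: "l > 0" and r: "r \<ge> 0"
  shows "measure (density lborel (exponential_density l)) {r..} = exp (- l * r)"
proof -
  let ?E = "density lborel (exponential_density l)"
  interpret E: prob_space ?E
    by (rule prob_space_exponential_density[OF l])
  have "distributed ?E lborel (\<lambda>x. x) (exponential_density l)"
    unfolding distributed_def by (auto simp: distr_id2)
  from E.exponential_distributedD_gt[OF this r l]
  have "measure ?E {r<..} = exp (- r * l)" by (simp add: greaterThan_def)
  moreover have "measure ?E {r..} = measure ?E {r<..}"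
  proof (rule measure_eq_AE)
    have "AE x in lborel. x \<noteq> r" by (rule AE_lborel_singleton)
    then show "AE x in ?E. (x \<in> {r..}) = (x \<in> {r<..})"
      by (subst AE_density) (auto elim: eventually_mono)
  qed auto
  ultimately show ?thesis by (simp add: mult.commute)
qed

lemma integrable_exponential_moment:
  assumes l: "l > 0"
  shows "integrable lborel (\<lambda>v. exponential_density l v * v ^ k)"
proof (rule integrableI_nonneg)
  show "AE x in lborel. 0 \<le> exponential_density l x * x ^ k"
    using l by (auto simp: exponential_density_def)
  have "(\<integral>\<^sup>+ x. ennreal (exponential_density l x * x ^ k) \<partial>lborel) = fact k / (fact 0 * l ^ k)"
    using nn_integral_erlang_ith_moment[OF l, of 0 k] by simp
  then show "(\<integral>\<^sup>+ x. ennreal (exponential_density l x * x ^ k) \<partial>lborel) < \<infinity>" by simp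
qed simp

lemma integral_exponential_iexp:
  assumes l: "l > 0"
  shows "(CLINT v|density lborel (exponential_density l). iexp (- (u * v))) = l / (l + \<i> * u)"
proof -
  define w where "w = complex_of_real l + \<i> * u"
  have w0: "w \<noteq> 0" using l by (auto simp: complex_eq_iff w_def)
  define f where "f = (\<lambda>v::real. l * exp (- w * v))"
  define F where "F = (\<lambda>v::real. - (l / w) * exp (- w * v))"
  have nf: "norm (exp (- w * v)) = exp (- l * v)" for v :: real by (simp add: norm_exp_eq_Re w_def)
  have fE: "exponential_density l v *\<^sub>R iexp (- (u * v)) = indicator {0..} v *\<^sub>R f v" for v
    by (auto simp: exponential_density_def f_def w_def indicator_def scaleR_conv_of_real exp_of_real[symmetric]
        exp_add[symmetric] algebra_simps simp del: exp_of_real)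
  have AEeq: "AE v in lborel. indicator {0..} v *\<^sub>R f v = indicator {0<..} v *\<^sub>R f v"
    using AE_lborel_singleton[of 0] by (rule eventually_mono) (auto simp: indicator_def)
  have int0: "integrable lborel (\<lambda>v. exponential_density l v *\<^sub>R iexp (- (u * v)))"
    by (rule Bochner_Integration.integrable_bound[OF integrable_exponential_moment[OF l, of 0]])
       (auto simp: norm_mult)
  have int: "set_integrable lborel {0<..} f"
    unfolding set_integrable_def
  proof (rule integrable_cong_AE_imp[OF int0])
    show "AE v in lborel. exponential_density l v *\<^sub>R iexp (- (u * v)) = indicator {0<..} v *\<^sub>R f v"
      unfolding fE using AEeq by (auto elim: eventually_mono)
  qed (simp add: f_def)
  have "(CLINT v|density lborel (exponential_density l). iexp (- (u * v)))
     = (CLINT v|lborel. exponential_density l v *\<^sub>R iexp (- (u * v)))"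
    by (rule integral_density) (use l in \<open>auto\<close>)
  also have "\<dots> = (CLINT v|lborel. indicator {0<..} v *\<^sub>R f v)"
    unfolding fE by (rule integral_cong_AE) (use AEeq in \<open>auto simp: f_def\<close>)
  also have "\<dots> = (CLBINT v=ereal 0..\<infinity>. f v)"
    unfolding interval_integral_to_infinity_eq set_lebesgue_integral_def ..
  also have "\<dots> = 0 - (- (l / w))"
  proof (rule interval_integral_FTC_integrable)
    fix v :: real
    show "(F has_vector_derivative f v) (at v)"
    proof -
      have "((\<lambda>z. - (l / w) * exp (- w * z)) has_field_derivative l * exp (- w * v)) (at (complex_of_real v))"
        using w0 by (auto intro!: derivative_eq_intros)
      then show ?thesis
        unfolding F_def f_def by (rule has_vector_derivative_real_field)
    qed
    show "isCont f v" unfolding f_def by (intro continuous_intros)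
  next
    show "set_integrable lborel (einterval (ereal 0) \<infinity>) f" using int by simp
    show "((F \<circ> real_of_ereal) \<longlongrightarrow> - (l / w)) (at_right (ereal 0))"
    proof -
      have "isCont F 0" unfolding F_def by (intro continuous_intros)
      then have "(F \<longlongrightarrow> - (l / w)) (at_right 0)"
        unfolding F_def isCont_def by (auto intro: filterlim_at_split[THEN iffD1, THEN conjunct2])
      then show ?thesis unfolding ereal_tendsto_simps .
    qed
    have "(F \<longlongrightarrow> 0) at_top"
    proof (rule tendsto_norm_zero_cancel)
      have "((\<lambda>v. norm (- (l / w)) * exp (- l * v)) \<longlongrightarrow> norm (- (l / w)) * 0) at_top"
        using l by (intro tendsto_mult tendsto_const) real_asymp
      then show "((\<lambda>v. norm (F v)) \<longlongrightarrow> 0) at_top"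
        unfolding F_def norm_mult nf by simp
    qed
    then show "((F \<circ> real_of_ereal) \<longlongrightarrow> 0) (at_left \<infinity>)" unfolding ereal_tendsto_simps .
  qed simp
  finally show ?thesis by (simp add: w_def)
qed

text \<open>For \<open>z > d\<close> the weight \<open>exp (- l * (z - d))\<close> is the
  probability that an exponential variable with rate \<open>l\<close> is at least
  \<open>z - d\<close>. Hence the left side is the average of the mass of \<open>{d<..d+v}\<close>
  over an exponential \<open>v\<close>, and inversion on bounded intervals suffices: averaging
  \<open>1 - iexp (- (u * v))\<close> gives \<open>\<i> * u / (l + \<i> * u)\<close>, whose
  numerator cancels the singular denominator.\<close>

lemma (in real_distribution) exp_tail_char:
  assumes i: "integrable lborel (char M)" and l: "l > 0"
  shows "complex_of_real (LINT z|M. indicator {d..} z * exp (- l * (z - d)))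
    = 1 / (2 * pi) * (CLINT u|lborel. char M u * iexp (- (u * d)) / (l + \<i> * u))"
proof -
  define E where "E = density lborel (exponential_density l)"
  interpret E: prob_space E
    unfolding E_def by (rule prob_space_exponential_density[OF l])
  have sE[measurable_cong, simp]: "sets E = sets borel" "space E = UNIV" by (auto simp: E_def)
  interpret P: pair_sigma_finite M E ..
  interpret P2: pair_sigma_finite E lborel ..
  define w where "w = (\<lambda>z v. indicator {d<..d+v} z :: real)"
  have wm: "case_prod w \<in> borel_measurable (M \<Otimes>\<^sub>M E)"
  proof -
    have "case_prod w = indicator {x. d < fst x \<and> fst x \<le> d + snd x}"
      by (auto simp: w_def indicator_def fun_eq_iff)
    then show ?thesis by simp
  qed
  have wi: "integrable (M \<Otimes>\<^sub>M E) (case_prod w)"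
  proof (rule Bochner_Integration.integrable_bound[of _ "\<lambda>_. 1 :: real"])
    interpret PP: pair_prob_space M E ..
    show "integrable (M \<Otimes>\<^sub>M E) (\<lambda>_. 1 :: real)" by simp
  qed (use wm in \<open>auto simp: w_def\<close>)
  have "(LINT z|M. indicator {d..} z * exp (- l * (z - d))) = (LINT z|M. LINT v|E. w z v)"
  proof (rule integral_cong_AE)
    show "(\<lambda>z. LINT v|E. w z v) \<in> borel_measurable M"
      using wm by (rule E.borel_measurable_lebesgue_integral)
    \<comment> \<open>At \<open>z = d\<close> the weight is 1 but the half-open interval leaves
      \<open>d\<close> out; the absence of atoms makes this point negligible.\<close>
    have "AE z in M. z \<noteq> d"
      using atomless_if_integrable_char[OF i, of d]
      by (intro AE_I[where N = "{d}"]) (auto simp: emeasure_eq_measure)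
    then show "AE z in M. indicator {d..} z * exp (- l * (z - d)) = (LINT v|E. w z v)"
    proof (rule eventually_mono)
      fix z assume "z \<noteq> d"
      show "indicator {d..} z * exp (- l * (z - d)) = (LINT v|E. w z v)"
      proof (cases "z > d")
        case True
        then have "w z = indicator {z - d..}" by (auto simp: w_def indicator_def fun_eq_iff)
        then show ?thesis
          using exponential_distribution_atleast[OF l, of "z - d"] True by (simp add: E_def[symmetric])
      qed (use \<open>z \<noteq> d\<close> in \<open>simp add: w_def\<close>)
    qed
  qed simp
  also have "\<dots> = (LINT v|E. LINT z|M. w z v)"
    by (rule P.Fubini_integral[OF wi, symmetric])
  also have "\<dots> = (LINT v|E. measure M {d<..d+v})" by (simp add: w_def)
  finally have "complex_of_real (LINT z|M. indicator {d..} z * exp (- l * (z - d)))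
     = (CLINT v|E. complex_of_real (measure M {d<..d+v}))" by simp
  also define k where "k = (\<lambda>v u. iexp (- (u * d)) * ((1 - iexp (- (u * v))) / (\<i> * u)) * char M u)"
  have AE0: "AE v in E. v \<ge> 0"
    unfolding E_def by (subst AE_density) (auto simp: exponential_density_def)
  have km: "case_prod k \<in> borel_measurable (E \<Otimes>\<^sub>M lborel)"
    unfolding k_def by measurable
  have kb: "cmod (k v u) \<le> \<bar>v\<bar> * cmod (char M u)" for v u
  proof -
    have "cmod (1 - iexp (- (u * v))) \<le> \<bar>u * v\<bar>"
      using iexp_approx1[of "-(u * v)" 0] by (simp add: norm_minus_commute)
    then have "cmod ((1 - iexp (- (u * v))) / (\<i> * u)) \<le> \<bar>v\<bar>"
      by (cases "u = 0") (auto simp: norm_divide norm_mult abs_mult divide_simps mult.commute)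
    then show ?thesis unfolding k_def norm_mult norm_exp_i_times by (simp add: mult_right_mono)
  qed
  have ki: "integrable lborel (k v)" for v
    by (rule Bochner_Integration.integrable_bound[of _ "\<lambda>u. \<bar>v\<bar> * cmod (char M u)"])
       (use i kb in \<open>auto simp: k_def\<close>)
  \<comment> \<open>The kernel grows linearly in \<open>v\<close>, so joint integrability rests on
    the first moment of the exponential law.\<close>
  have Ev: "integrable E (\<lambda>v. v)"
    unfolding E_def using integrable_exponential_moment[OF l, of 1]
    by (subst integrable_density) (use l in \<open>auto\<close>)
  have kint: "integrable (E \<Otimes>\<^sub>M lborel) (case_prod k)"
  proof (rule P2.Fubini_integrable[OF km])
    show "integrable E (\<lambda>v. LINT u|lborel. norm (case (v, u) of (v, u) \<Rightarrow> k v u))"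
    proof (rule Bochner_Integration.integrable_bound)
      show "integrable E (\<lambda>v. \<bar>v\<bar> * (LINT u|lborel. cmod (char M u)))" using Ev by simp
      show "(\<lambda>v. LINT u|lborel. norm (case (v, u) of (v, u) \<Rightarrow> k v u)) \<in> borel_measurable E"
        using km by (intro lborel.borel_measurable_lebesgue_integral) simp
      show "AE v in E. norm (LINT u|lborel. norm (case (v, u) of (v, u) \<Rightarrow> k v u))
         \<le> norm (\<bar>v\<bar> * (LINT u|lborel. cmod (char M u)))"
      proof (rule AE_I2)
        fix v
        have "(LINT u|lborel. cmod (k v u)) \<le> (LINT u|lborel. \<bar>v\<bar> * cmod (char M u))"
          using i kb ki by (intro integral_mono) auto
        then show "norm (LINT u|lborel. norm (case (v, u) of (v, u) \<Rightarrow> k v u))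
         \<le> norm (\<bar>v\<bar> * (LINT u|lborel. cmod (char M u)))" by simp
      qed
    qed
  qed (simp add: ki)
  have "(CLINT v|E. complex_of_real (measure M {d<..d+v})) = (CLINT v|E. 1 / (2 * pi) * (CLINT u|lborel. k v u))"
  proof (rule integral_cong_AE)
    show "AE v in E. complex_of_real (measure M {d<..d+v}) = 1 / (2 * pi) * (CLINT u|lborel. k v u)"
      using AE0 by (rule eventually_mono) (simp add: measure_Ioc_char[OF i] k_def)
    show "(\<lambda>v. 1 / (2 * pi) * (CLINT u|lborel. k v u)) \<in> borel_measurable E"
      using km by (intro borel_measurable_times borel_measurable_const lborel.borel_measurable_lebesgue_integral) simp
    have "(\<lambda>v. LINT z|M. w z v) \<in> borel_measurable E"
      using wm by (intro borel_measurable_lebesgue_integral) (use measurable_pair_swap[OF wm] in simp)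
    then show "(\<lambda>v. complex_of_real (measure M {d<..d+v})) \<in> borel_measurable E"
      by (simp add: w_def)
  qed
  also have "\<dots> = 1 / (2 * pi) * (CLINT v|E. CLINT u|lborel. k v u)"
    by (rule integral_mult_right_zero)
  also have "(CLINT v|E. CLINT u|lborel. k v u) = (CLINT u|lborel. CLINT v|E. k v u)"
    by (rule P2.Fubini_integral[OF kint, symmetric])
  also have "\<dots> = (CLINT u|lborel. char M u * iexp (- (u * d)) / (l + \<i> * u))"
  proof (rule integral_cong_AE)
    show "(\<lambda>u. CLINT v|E. k v u) \<in> borel_measurable lborel"
      using km by (intro E.borel_measurable_lebesgue_integral) (use measurable_pair_swap[OF km] in simp)
    \<comment> \<open>The identity fails at \<open>u = 0\<close>, where division by zero gives the
      kernel the value 0 instead of its limit.\<close>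
    show "AE u in lborel. (CLINT v|E. k v u) = char M u * iexp (- (u * d)) / (l + \<i> * u)"
      using AE_lborel_singleton[of 0]
    proof (rule eventually_mono)
      fix u :: real assume u: "u \<noteq> 0"
      have "complex_of_real l + \<i> * u \<noteq> 0" using l by (auto simp: complex_eq_iff)
      have ii: "integrable E (\<lambda>v. iexp (- (u * v)))"
        by (rule E.integrable_const_bound[where B = 1]) auto
      have "(CLINT v|E. k v u) = (CLINT v|E. (iexp (- (u * d)) * char M u / (\<i> * u)) * (1 - iexp (- (u * v))))"
        unfolding k_def by (intro Bochner_Integration.integral_cong refl) (simp add: divide_simps)
      also have "\<dots> = (iexp (- (u * d)) * char M u / (\<i> * u)) * (CLINT v|E. 1 - iexp (- (u * v)))"
        by (rule integral_mult_right_zero)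
      also have "(CLINT v|E. 1 - iexp (- (u * v))) = 1 - (CLINT v|E. iexp (- (u * v)))"
        using ii by (subst Bochner_Integration.integral_diff) (use E.prob_space in auto)
      also have "\<dots> = 1 - l / (l + \<i> * u)"
        unfolding E_def integral_exponential_iexp[OF l] ..
      also have "(iexp (- (u * d)) * char M u / (\<i> * u)) * \<dots> = char M u * iexp (- (u * d)) / (l + \<i> * u)"
        using u \<open>complex_of_real l + \<i> * u \<noteq> 0\<close> by (simp add: divide_simps)
      finally show "(CLINT v|E. k v u) = char M u * iexp (- (u * d)) / (l + \<i> * u)" .
    qed
  qed simp
  finally show ?thesis .
qed

section \<open>The kernel of a standardised density\<close>

text \<open>The four parameters are the quantities on which the later constants may depend. The
  interval where \<open>f\<close> is at least \<open>c\<close> has a free centre, since the bulk of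
  a tilted density lies around \<open>\<psi>(t)\<close>, which need not be its mean.\<close>

definition std_density :: "real \<Rightarrow> real \<Rightarrow> real \<Rightarrow> real \<Rightarrow> (real \<Rightarrow> real) \<Rightarrow> bool" where
  "std_density C B c r f \<longleftrightarrow> f \<in> borel_measurable borel \<and> (\<forall>x. 0 \<le> f x \<and> f x \<le> B) \<and>
     has_bochner_integral lborel f 1 \<and> has_bochner_integral lborel (\<lambda>x. f x * x) 0 \<and>
     has_bochner_integral lborel (\<lambda>x. f x * x\<^sup>2) 1 \<and>
     integrable lborel (\<lambda>x. f x * \<bar>x\<bar> ^ 3) \<and> (LINT x|lborel. f x * \<bar>x\<bar> ^ 3) \<le> C \<and>
     (\<exists>z. \<forall>x. \<bar>x - z\<bar> \<le> r \<longrightarrow> c \<le> f x)"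

section \<open>Characteristic functions, uniformly over the class\<close>

lemma real_distribution_density:
  assumes "f \<in> borel_measurable borel" "\<And>x. 0 \<le> f x" "has_bochner_integral lborel f 1"
  shows "real_distribution (density lborel (\<lambda>x. ennreal (f x)))"
proof (intro real_distribution.intro real_distribution_axioms.intro prob_spaceI)
  have "emeasure (density lborel (\<lambda>x. ennreal (f x))) UNIV = (\<integral>\<^sup>+x. ennreal (f x) \<partial>lborel)"
    using assms(1) by (subst emeasure_density) auto
  also have "\<dots> = 1"
    using assms(2,3) by (subst nn_integral_eq_integral) (auto simp: has_bochner_integral_iff)
  finally show "emeasure (density lborel (\<lambda>x. ennreal (f x))) (space (density lborel (\<lambda>x. ennreal (f x)))) = 1"
    by simp
qed auto

lemma char_density:
  assumes "f \<in> borel_measurable borel" "\<And>x. 0 \<le> f x"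
  shows "char (density lborel (\<lambda>x. ennreal (f x))) v = (CLINT x|lborel. f x *\<^sub>R iexp (v * x))"
  unfolding char_def using assms by (subst integral_density) auto

lemma integrable_density_iexp:
  assumes "f \<in> borel_measurable borel" "\<And>x. 0 \<le> f x" "integrable lborel f"
  shows "integrable lborel (\<lambda>x. f x *\<^sub>R iexp (v * x))"
  by (rule Bochner_Integration.integrable_bound[OF assms(3)]) (use assms in \<open>auto simp: norm_mult\<close>)

lemma char_taylor:
  assumes "std_density C B c r f"
  shows "cmod (char (density lborel (\<lambda>x. ennreal (f x))) v - complex_of_real (1 - v\<^sup>2 / 2)) \<le> C * \<bar>v\<bar> ^ 3 / 6"
proof -
  note * = assms[unfolded std_density_def]
  have f: "f \<in> borel_measurable borel" "\<And>x. 0 \<le> f x" "integrable lborel f" "integral\<^sup>L lborel f = 1"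
    "integrable lborel (\<lambda>x. f x * x)" "(LINT x|lborel. f x * x) = 0"
    "integrable lborel (\<lambda>x. f x * x\<^sup>2)" "(LINT x|lborel. f x * x\<^sup>2) = 1"
    using * by (auto simp: has_bochner_integral_iff)
  define T where "T = (\<lambda>x. complex_of_real (f x) + \<i> * v * complex_of_real (f x * x)
      - (v\<^sup>2 / 2) * complex_of_real (f x * x\<^sup>2))"
  have Ti: "integrable lborel T" unfolding T_def using f by (auto simp del: of_real_mult)
  have Tv: "integral\<^sup>L lborel T = complex_of_real (1 - v\<^sup>2 / 2)"
    unfolding T_def using f by (simp del: of_real_mult)
  have "char (density lborel (\<lambda>x. ennreal (f x))) v - complex_of_real (1 - v\<^sup>2 / 2)
     = (CLINT x|lborel. f x *\<^sub>R iexp (v * x) - T x)"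
    unfolding char_density[OF f(1,2)] Tv[symmetric]
    by (rule Bochner_Integration.integral_diff[symmetric, OF integrable_density_iexp Ti]) (use f in auto)
  also have "cmod \<dots> \<le> (LINT x|lborel. cmod (f x *\<^sub>R iexp (v * x) - T x))"
    by (rule integral_norm_bound)
  also have "\<dots> \<le> (LINT x|lborel. \<bar>v\<bar> ^ 3 / 6 * (f x * \<bar>x\<bar> ^ 3))"
  proof (rule integral_mono')
    show "integrable lborel (\<lambda>x. \<bar>v\<bar> ^ 3 / 6 * (f x * \<bar>x\<bar> ^ 3))" using * by simp
    fix x
    have "f x *\<^sub>R iexp (v * x) - T x = f x *\<^sub>R (iexp (v * x) - (\<Sum>k\<le>2. (\<i> * complex_of_real (v * x)) ^ k / fact k))"
      by (simp add: T_def numeral_2_eq_2 scaleR_conv_of_real algebra_simps power2_eq_square)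
    also have "cmod \<dots> = f x * cmod (iexp (v * x) - (\<Sum>k\<le>2. (\<i> * complex_of_real (v * x)) ^ k / fact k))"
      using f(2)[of x] by (simp only: norm_scaleR)
    also have "\<dots> \<le> f x * (\<bar>v * x\<bar> ^ 3 / 6)"
    proof (rule mult_left_mono)
      have "Suc 2 = 3" "fact (3::nat) = (6::real)" by (simp_all add: fact_numeral)
      then show "cmod (iexp (v * x) - (\<Sum>k\<le>2. (\<i> * complex_of_real (v * x)) ^ k / fact k)) \<le> \<bar>v * x\<bar> ^ 3 / 6"
        using iexp_approx1[of "v * x" 2] by metis
    qed (rule f(2))
    finally show "cmod (f x *\<^sub>R iexp (v * x) - T x) \<le> \<bar>v\<bar> ^ 3 / 6 * (f x * \<bar>x\<bar> ^ 3)"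
      by (simp add: abs_mult power_mult_distrib mult_ac)
  qed (use f in auto)
  also have "\<dots> = \<bar>v\<bar> ^ 3 / 6 * (LINT x|lborel. f x * \<bar>x\<bar> ^ 3)" by simp
  also have "\<dots> \<le> \<bar>v\<bar> ^ 3 / 6 * C" using * by (intro mult_left_mono) auto
  finally show ?thesis by (simp add: mult_ac)
qed

lemma abs_sin_less: "x > 0 \<Longrightarrow> \<bar>sin x\<bar> < (x::real)"
proof -
  assume x: "x > 0"
  show ?thesis
  proof (cases "x > 1")
    case True then show ?thesis using abs_sin_le_one[of x] by linarith
  next
    case False
    then have "0 < sin x" using x pi_gt3 by (intro sin_gt_zero) auto
    moreover have "sin x < x"
    proof -
      obtain z where z: "0 < z" "z < x" "sin x - sin 0 = (x - 0) * cos z"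
        using MVT2[of 0 x sin cos] x by auto
      have "cos z < cos 0" using z False pi_gt3 by (intro cos_monotone_0_pi) auto
      then show ?thesis using z x by simp
    qed
    ultimately show ?thesis by simp
  qed
qed

text \<open>Up to \<open>max 2 y0\<close> the quotient attains a maximum below 1 by compactness;
  beyond that the trivial bound 1 for the sine is at most half the argument.\<close>

lemma abs_sin_le_mult:
  assumes "y0 > 0"
  shows "\<exists>q<1. q \<ge> 0 \<and> (\<forall>y::real. \<bar>y\<bar> \<ge> y0 \<longrightarrow> \<bar>sin y\<bar> \<le> q * \<bar>y\<bar>)"
proof -
  let ?g = "\<lambda>y::real. \<bar>sin y\<bar> / y"
  obtain q1 where q1: "q1 < 1" "\<And>y. y0 \<le> y \<Longrightarrow> y \<le> max 2 y0 \<Longrightarrow> ?g y \<le> q1"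
  proof -
    have "\<exists>x\<in>{y0..max 2 y0}. \<forall>y\<in>{y0..max 2 y0}. ?g y \<le> ?g x"
      using assms by (intro continuous_attains_sup continuous_intros) auto
    then obtain x where x: "x \<in> {y0..max 2 y0}" "\<And>y. y\<in>{y0..max 2 y0} \<Longrightarrow> ?g y \<le> ?g x" by blast
    have "?g x < 1" using x(1) assms abs_sin_less[of x] by (simp add: divide_simps)
    then show ?thesis using x that by auto
  qed
  define q where "q = max q1 (1/2)"
  have pos: "\<bar>sin y\<bar> \<le> q * y" if "y \<ge> y0" for y
  proof (cases "y \<le> max 2 y0")
    case True
    then have "?g y \<le> q" using q1(2)[of y] that by (auto simp: q_def)
    then show ?thesis using assms that by (simp add: divide_simps)
  next
    case False
    then have "1 \<le> (1/2) * y" by auto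
    also have "\<dots> \<le> q * y" using assms that by (intro mult_right_mono) (auto simp: q_def)
    finally show ?thesis using abs_sin_le_one[of y] by linarith
  qed
  show ?thesis
  proof (intro exI[of _ q] conjI allI impI)
    fix y :: real assume "\<bar>y\<bar> \<ge> y0"
    then show "\<bar>sin y\<bar> \<le> q * \<bar>y\<bar>" using pos[of "\<bar>y\<bar>"] by (cases "y \<ge> 0") auto
  qed (use q1 in \<open>auto simp: q_def\<close>)
qed

text \<open>Splitting off the uniform part \<open>c\<close> on an interval of radius \<open>r\<close> keeps the characteristic
  function away from 1, uniformly in the density.\<close>

lemma char_away_from_zero:
  assumes "C > 0" "c > 0" "r > 0" "v0 > 0"
  shows "\<exists>\<kappa><1. \<kappa> > 0 \<and> (\<forall>f v. std_density C B c r f \<longrightarrow> \<bar>v\<bar> \<ge> v0 \<longrightarrow>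
           cmod (char (density lborel (\<lambda>x. ennreal (f x))) v) \<le> \<kappa>)"
proof -
  obtain q where q: "q < 1" "q \<ge> 0" "\<And>y. \<bar>y\<bar> \<ge> r * v0 \<Longrightarrow> \<bar>sin y\<bar> \<le> q * \<bar>y\<bar>"
    using abs_sin_le_mult[of "r * v0"] assms by auto
  \<comment> \<open>The part of \<open>f\<close> outside the uniform block has mass
    \<open>1 - 2 * r * c\<close>, and the transform of the block is at most
    \<open>2 * r * c * q\<close>, with \<open>q < 1\<close> from the sine quotient. The maximum with
    \<open>1/2\<close> only makes \<kappa> positive.\<close>
  define \<kappa> where "\<kappa> = max (1/2) (1 - 2 * r * c * (1 - q))"
  have "cmod (char (density lborel (\<lambda>x. ennreal (f x))) v) \<le> \<kappa>"
    if sd: "std_density C B c r f" and v: "\<bar>v\<bar> \<ge> v0" for f v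
  proof -
    note * = sd[unfolded std_density_def]
    have f: "f \<in> borel_measurable borel" "\<And>x. 0 \<le> f x" "integrable lborel f" "integral\<^sup>L lborel f = 1"
      using * by (auto simp: has_bochner_integral_iff)
    obtain z where z: "\<And>x. \<bar>x - z\<bar> \<le> r \<Longrightarrow> c \<le> f x" using * by auto
    have v_nz: "v \<noteq> 0" using v assms by auto
    define u where "u = (\<lambda>x. c * indicator {z - r..z + r} x :: real)"
    have u_le: "u x \<le> f x" "0 \<le> u x" for x using z[of x] f(2)[of x] assms by (auto simp: u_def indicator_def)
    have ui: "integrable lborel u" "integral\<^sup>L lborel u = 2 * r * c"
      using assms by (auto simp: u_def)
    have um: "u \<in> borel_measurable borel" by (simp add: u_def)
    have "(CLINT x|lborel. u x *\<^sub>R iexp (v * x)) = c * (CLBINT x=z-r..z+r. iexp (v * x))"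
    proof -
      have "(CLINT x|lborel. u x *\<^sub>R iexp (v * x)) = (CLINT x|lborel. c * (indicator {z-r..z+r} x *\<^sub>R iexp (v * x)))"
        by (intro Bochner_Integration.integral_cong) (auto simp: u_def indicator_def scaleR_conv_of_real)
      also have "\<dots> = c * (CLINT x|lborel. (indicator {z-r..z+r} x *\<^sub>R iexp (v * x)))"
        by (rule integral_mult_right_zero)
      also have "(CLINT x|lborel. (indicator {z-r..z+r} x *\<^sub>R iexp (v * x))) = (CLBINT x=z-r..z+r. iexp (v * x))"
        using assms by (subst interval_integral_Icc) (auto simp: set_lebesgue_integral_def)
      finally show ?thesis .
    qed
    also have "(CLBINT x=z-r..z+r. iexp (v * x)) = iexp (v * (z + r)) / (\<i> * v) - iexp (v * (z - r)) / (\<i> * v)"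
    proof (rule interval_integral_FTC_finite)
      show "continuous_on {min (z-r) (z+r)..max (z-r) (z+r)} (\<lambda>x. iexp (v * x))"
        by (intro continuous_intros)
      fix x assume "min (z-r) (z+r) \<le> x" "x \<le> max (z-r) (z+r)"
      have "((\<lambda>w. exp (\<i> * (v * w)) / (\<i> * v)) has_field_derivative exp (\<i> * (v * x))) (at (complex_of_real x))"
        using v_nz by (auto intro!: derivative_eq_intros simp: field_simps)
      from has_vector_derivative_real_field[OF this]
      show "((\<lambda>x. iexp (v * x) / (\<i> * v)) has_vector_derivative iexp (v * x)) (at x within {min (z-r) (z+r)..max (z-r) (z+r)})"
        by (auto intro: has_vector_derivative_at_within)
    qed
    also have "\<dots> = iexp (v * (z - r)) * (iexp (2 * (r * v)) - 1) / (\<i> * v)"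
      by (simp add: diff_divide_distrib[symmetric] algebra_simps exp_add[symmetric])
    finally have "cmod (CLINT x|lborel. u x *\<^sub>R iexp (v * x)) = c * (cmod (iexp (2 * (r * v)) - 1) / \<bar>v\<bar>)"
      using assms by (simp only: norm_mult norm_divide norm_exp_i_times) simp
    also have "\<dots> = 2 * c * \<bar>sin (r * v)\<bar> / \<bar>v\<bar>"
      by (subst dist_exp_i_1) simp
    also have "\<dots> \<le> 2 * c * (q * \<bar>r * v\<bar>) / \<bar>v\<bar>"
      using assms v by (intro divide_right_mono mult_left_mono q) (auto simp: abs_mult)
    also have "\<dots> = 2 * r * c * q" using v_nz assms by (simp add: abs_mult)
    finally have le: "cmod (CLINT x|lborel. u x *\<^sub>R iexp (v * x)) \<le> 2 * r * c * q" .
    have "char (density lborel (\<lambda>x. ennreal (f x))) v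
       = (CLINT x|lborel. (f x - u x) *\<^sub>R iexp (v * x)) + (CLINT x|lborel. u x *\<^sub>R iexp (v * x))"
      unfolding char_density[OF f(1,2)] 
    proof (subst Bochner_Integration.integral_add[symmetric])
      show "integrable lborel (\<lambda>x. (f x - u x) *\<^sub>R iexp (v * x))"
        by (rule integrable_density_iexp) (use f um ui u_le in auto)
      show "integrable lborel (\<lambda>x. u x *\<^sub>R iexp (v * x))"
        by (rule integrable_density_iexp) (use um ui u_le in auto)
    qed (simp add: scaleR_add_left[symmetric])
    also have "cmod \<dots> \<le> cmod (CLINT x|lborel. (f x - u x) *\<^sub>R iexp (v * x)) + 2 * r * c * q"
      by (rule norm_triangle_le) (use le in simp)
    also have "cmod (CLINT x|lborel. (f x - u x) *\<^sub>R iexp (v * x)) \<le> (LINT x|lborel. cmod ((f x - u x) *\<^sub>R iexp (v * x)))"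
      by (rule integral_norm_bound)
    also have "\<dots> = (LINT x|lborel. f x - u x)"
      using u_le by (intro Bochner_Integration.integral_cong) (auto simp: norm_mult)
    also have "\<dots> = 1 - 2 * r * c" using f ui by simp
    finally show ?thesis by (simp add: \<kappa>_def algebra_simps)
  qed
  moreover have "\<kappa> < 1" "\<kappa> > 0" using q assms by (auto simp: \<kappa>_def)
  ultimately show ?thesis by blast
qed

text \<open>Scaling by \<open>sqrt n / 2\<close>. The exponent \<open>n * v\<^sup>2 / 8\<close> is
  what remains of \<open>exp (- (v\<^sup>2 / 4))\<close> raised to the power \<open>n - 2\<close>,
  which is at least \<open>n / 2\<close> once \<open>n >= 4\<close>.\<close>

lemma gaussian_moment:
  fixes j :: nat
  shows "\<exists>\<Gamma>\<ge>0. \<forall>n>0. integrable lborel (\<lambda>v. \<bar>v\<bar> ^ j * exp (- (n * v\<^sup>2 / 8))) \<and>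
     (LINT v|lborel. \<bar>v\<bar> ^ j * exp (- (n * v\<^sup>2 / 8))) = \<Gamma> / sqrt n ^ (j + 1)"
proof (intro exI[of _ "2 ^ (j + 1) * sqrt (2 * pi) * (LINT x|lborel. std_normal_density x * \<bar>x\<bar> ^ j)"] conjI allI impI)
  show "0 \<le> 2 ^ (j + 1) * sqrt (2 * pi) * (LINT x|lborel. std_normal_density x * \<bar>x\<bar> ^ j)"
    by (intro mult_nonneg_nonneg Bochner_Integration.integral_nonneg) auto
  fix n :: real assume n: "n > 0"
  define a where "a = sqrt n / 2"
  have a: "a > 0" using n by (simp add: a_def)
  have eq: "\<bar>v\<bar> ^ j * exp (- (n * v\<^sup>2 / 8)) = (sqrt (2 * pi) / a ^ j) * (std_normal_density (0 + a * v) * \<bar>0 + a * v\<bar> ^ j)" for v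
  proof -
    have n4: "n = 4 * a\<^sup>2" using n by (simp add: a_def power_divide)
    show ?thesis
      using a unfolding std_normal_density_def n4 by (simp add: power_mult_distrib abs_mult)
  qed
  have i: "integrable lborel (\<lambda>v. std_normal_density (0 + a * v) * \<bar>0 + a * v\<bar> ^ j)"
    by (rule lborel_integrable_real_affine[OF integrable_std_normal_moment_abs]) (use a in simp)
  show "integrable lborel (\<lambda>v. \<bar>v\<bar> ^ j * exp (- (n * v\<^sup>2 / 8)))" unfolding eq using i by simp
  define I where "I = (LINT x|lborel. std_normal_density x * \<bar>x\<bar> ^ j)"
  have "I = a * (LINT v|lborel. std_normal_density (0 + a * v) * \<bar>0 + a * v\<bar> ^ j)"
    using a unfolding I_def by (subst lborel_integral_real_affine[of a _ 0]) auto
  moreover have "(LINT v|lborel. \<bar>v\<bar> ^ j * exp (- (n * v\<^sup>2 / 8))) = sqrt (2 * pi) / a ^ j * (LINT v|lborel. std_normal_density (0 + a * v) * \<bar>0 + a * v\<bar> ^ j)"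
    unfolding eq by (rule integral_mult_right_zero)
  ultimately have "(LINT v|lborel. \<bar>v\<bar> ^ j * exp (- (n * v\<^sup>2 / 8))) = sqrt (2 * pi) / a ^ j * (I / a)"
    using a by simp
  also have "\<dots> = 2 ^ (j + 1) * sqrt (2 * pi) * I / sqrt n ^ (j + 1)"
    using n by (simp add: a_def power_divide divide_simps)
  finally show "(LINT v|lborel. \<bar>v\<bar> ^ j * exp (- (n * v\<^sup>2 / 8)))
     = 2 ^ (j + 1) * sqrt (2 * pi) * (LINT x|lborel. std_normal_density x * \<bar>x\<bar> ^ j) / sqrt n ^ (j + 1)"
    unfolding I_def .
qed

text \<open>A power of a nearly real number is nearly real. Applied to the characteristic function,
  whose imaginary part is cubic at 0, this shows that the term of first order is harmless.\<close>

lemma abs_Im_power_le: "\<bar>Im (z ^ Suc k)\<bar> \<le> real (Suc k) * cmod z ^ k * \<bar>Im z\<bar>"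
proof (induction k)
  case (Suc k)
  have "\<bar>Im (z ^ Suc (Suc k))\<bar> = \<bar>Re z * Im (z ^ Suc k) + Im z * Re (z ^ Suc k)\<bar>"
    by simp
  also have "\<dots> \<le> cmod z * \<bar>Im (z ^ Suc k)\<bar> + \<bar>Im z\<bar> * cmod z ^ Suc k"
    using abs_Re_le_cmod[of z] abs_Re_le_cmod[of "z ^ Suc k"]
    by (intro abs_triangle_ineq[THEN order_trans] add_mono)
       (auto simp: abs_mult norm_power[symmetric] simp del: power_Suc intro!: mult_mono)
  also have "\<dots> \<le> cmod z * (real (Suc k) * cmod z ^ k * \<bar>Im z\<bar>) + \<bar>Im z\<bar> * cmod z ^ Suc k"
    using Suc.IH by (intro add_mono mult_left_mono) auto
  also have "\<dots> = real (Suc (Suc k)) * cmod z ^ Suc k * \<bar>Im z\<bar>"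
    by (simp add: algebra_simps)
  finally show ?case .
qed simp

text \<open>The modulus of the denominator is at least its real part \<open>l\<close>, and
  \<open>w - 1 / l = - (\<i> * v * w) / l\<close>. For \<open>l >= 1\<close> the squares in the
  denominators leave bounds relative to the natural size \<open>1 / l\<close>.\<close>

lemma inverse_kernel_bounds:
  fixes l v :: real
  assumes "l > 0"
  defines "w \<equiv> 1 / (complex_of_real l + \<i> * complex_of_real v)"
  shows "cmod w \<le> 1 / l" "\<bar>Im w\<bar> \<le> \<bar>v\<bar> / l\<^sup>2" "cmod (w - 1 / l) \<le> \<bar>v\<bar> / l\<^sup>2"
proof -
  define z where "z = complex_of_real l + \<i> * complex_of_real v"
  have z: "Re z = l" "Im z = v" by (auto simp: z_def)
  have nz: "z \<noteq> 0" using z assms by auto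
  have lz: "l \<le> cmod z" using complex_Re_le_cmod[of z] z by simp
  show w: "cmod w \<le> 1 / l"
    unfolding w_def z_def[symmetric] using lz assms by (simp add: norm_divide frac_le)
  have "w - 1 / l = - (\<i> * v * w) / l"
  proof -
    have "w * z = 1" unfolding w_def z_def[symmetric] using nz by simp
    then have "l * w - 1 = - (\<i> * v * w)" by (simp add: z_def algebra_simps)
    moreover have "w - 1 / l = (l * w - 1) / l" using assms(1) by (simp add: diff_divide_distrib)
    ultimately show ?thesis by simp
  qed
  then have "cmod (w - 1 / l) = \<bar>v\<bar> * cmod w / l"
    using assms by (simp add: norm_divide norm_mult)
  also have "\<dots> \<le> \<bar>v\<bar> * (1 / l) / l"
    using w assms by (intro divide_right_mono mult_left_mono) auto
  finally show *: "cmod (w - 1 / l) \<le> \<bar>v\<bar> / l\<^sup>2" by (simp add: power2_eq_square)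
  have "Im w = Im (w - 1 / l)" by simp
  also have "\<bar>\<dots>\<bar> \<le> cmod (w - 1 / l)" by (rule abs_Im_le_cmod)
  finally show "\<bar>Im w\<bar> \<le> \<bar>v\<bar> / l\<^sup>2" using * by linarith
qed

text \<open>The term of first order in \<open>v\<close> is odd up to the imaginary part of \<open>z\<close>, which is cubic; this is
  where the order \<open>1/n\<close> (instead of \<open>1/\<surd>n\<close>) of the relative error comes from.\<close>

lemma kernel_diff_pointwise:
  fixes z :: complex and v l \<delta> C :: real and n :: nat
  assumes z1: "cmod z \<le> exp (- (v\<^sup>2 / 4))" and z2: "cmod (z - complex_of_real (1 - v\<^sup>2 / 2)) \<le> C * \<bar>v\<bar> ^ 3 / 6"
    and Cv: "C * \<bar>v\<bar> \<le> 1" and n: "n \<ge> 4" and l: "l \<ge> 1" and C: "C \<ge> 0"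
  shows "\<bar>Re (z ^ (n - 1) * iexp (- (v * \<delta>)) / (l + \<i> * v) - z ^ n / (l + \<i> * v))\<bar>
    \<le> (1 + \<delta>\<^sup>2) / l * (exp (- (n * v\<^sup>2 / 8)) * (n * C * v ^ 4 + 2 * v\<^sup>2))"
proof -
  define w where "w = 1 / (complex_of_real l + \<i> * complex_of_real v)"
  define G where "G = exp (- (n * v\<^sup>2 / 8))"
  define E where "E = iexp (- (v * \<delta>))"
  \<comment> \<open>\<open>E - z\<close> with its linear part \<open>- \<i> * v * \<delta>\<close>
    taken out; what remains is quadratic in \<open>v\<close>.\<close>
  define R where "R = E - z + \<i> * v * \<delta>"
  define X where "X = z ^ (n - 1) * w"
  note w = inverse_kernel_bounds[of l v, folded w_def]
  have l0: "l > 0" using l by simp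
  have Iw: "\<bar>Im w\<bar> \<le> \<bar>v\<bar> / l"
    using w(2)[OF l0] l frac_le[of "\<bar>v\<bar>" "\<bar>v\<bar>" l "l\<^sup>2"] by (simp add: power2_eq_square)
  have zle1: "cmod z \<le> 1" using z1 by (rule order_trans) simp
  \<comment> \<open>\<open>k = n - 2\<close>: bounding the imaginary part of
    \<open>z ^ (n - 1)\<close> costs one more power, and \<open>n >= 4\<close> gives
    \<open>n <= 2 * k\<close>, so half of the Gaussian exponent survives.\<close>
  obtain k where k: "n = Suc (Suc k)" using n by (metis One_nat_def add_2_eq_Suc less_eqE numeral_Bit0 add.assoc)
  have zk: "cmod z ^ k \<le> G"
  proof -
    have "cmod z ^ k \<le> exp (- (v\<^sup>2 / 4)) ^ k" using z1 by (intro power_mono) auto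
    also have "\<dots> = exp (- (k * v\<^sup>2 / 4))" by (simp add: exp_of_nat_mult[symmetric])
    also have "\<dots> \<le> G"
      unfolding G_def using n k mult_right_mono[of "real n" "2 * real k" "v\<^sup>2"] by (simp add: mult_ac)
    finally show ?thesis .
  qed
  have zk1: "cmod (z ^ (n - 1)) \<le> G"
    using zk zle1 mult_left_le_one_le[of "cmod z ^ k" "cmod z"] by (simp add: k norm_mult norm_power)
  have Cv3: "C * \<bar>v\<bar> ^ 3 \<le> v\<^sup>2"
    using mult_right_mono[OF Cv, of "v\<^sup>2"] by (simp add: power3_eq_cube power2_eq_square mult_ac)
  have Imz: "\<bar>Im z\<bar> \<le> C * \<bar>v\<bar> ^ 3 / 6"
    using abs_Im_le_cmod[of "z - complex_of_real (1 - v\<^sup>2 / 2)"] z2 by simp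
  have z_1: "cmod (1 - z) \<le> v\<^sup>2 * (2 / 3)"
  proof -
    have "1 - z = complex_of_real (v\<^sup>2 / 2) - (z - complex_of_real (1 - v\<^sup>2 / 2))" by simp
    also have "cmod \<dots> \<le> cmod (complex_of_real (v\<^sup>2 / 2)) + cmod (z - complex_of_real (1 - v\<^sup>2 / 2))"
      by (rule norm_triangle_ineq4)
    also have "\<dots> \<le> v\<^sup>2 / 2 + C * \<bar>v\<bar> ^ 3 / 6"
      using z2 unfolding norm_of_real by simp
    finally show ?thesis using Cv3 by simp
  qed
  have R: "cmod R \<le> v\<^sup>2 * \<delta>\<^sup>2 / 2 + v\<^sup>2 * (2 / 3)"
  proof -
    have "R = (E - (1 - \<i> * v * \<delta>)) + (1 - z)" by (simp add: R_def)
    also have "cmod \<dots> \<le> cmod (E - (1 - \<i> * v * \<delta>)) + cmod (1 - z)" by (rule norm_triangle_ineq)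
    also have "cmod (E - (1 - \<i> * v * \<delta>)) \<le> v\<^sup>2 * \<delta>\<^sup>2 / 2"
      using iexp_approx1[of "- (v * \<delta>)" 1] unfolding E_def
      by (simp add: power2_eq_square abs_mult mult_ac)
    finally show ?thesis using z_1 by simp
  qed
  have ImX: "\<bar>Im X\<bar> \<le> (n * G * (C * \<bar>v\<bar> ^ 3 / 6) + G * \<bar>v\<bar>) / l"
  proof -
    have "\<bar>Im X\<bar> \<le> \<bar>Im (z ^ (n - 1))\<bar> * \<bar>Re w\<bar> + \<bar>Re (z ^ (n - 1))\<bar> * \<bar>Im w\<bar>"
      by (simp add: X_def abs_mult[symmetric] add.commute)
    also have "\<dots> \<le> (n * G * (C * \<bar>v\<bar> ^ 3 / 6)) * (1 / l) + G * (\<bar>v\<bar> / l)"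
    proof (intro add_mono mult_mono)
      have "\<bar>Im (z ^ (n - 1))\<bar> \<le> real (Suc k) * cmod z ^ k * \<bar>Im z\<bar>"
        using abs_Im_power_le[of z k] by (simp add: k)
      also have "\<dots> \<le> n * G * (C * \<bar>v\<bar> ^ 3 / 6)"
        using zk Imz by (intro mult_mono) (auto simp: k G_def)
      finally show "\<bar>Im (z ^ (n - 1))\<bar> \<le> n * G * (C * \<bar>v\<bar> ^ 3 / 6)" .
      show "\<bar>Re w\<bar> \<le> 1 / l" using abs_Re_le_cmod[of w] w(1)[OF l0] by simp
      show "\<bar>Re (z ^ (n - 1))\<bar> \<le> G" using abs_Re_le_cmod zk1 by (rule order_trans)
    qed (use C Iw in \<open>auto simp: G_def\<close>)
    finally show ?thesis by (simp add: add_divide_distrib)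
  qed
  \<comment> \<open>The linear term is \<open>X\<close> times a purely imaginary number, so only the
    imaginary part of \<open>X\<close> enters the real part.\<close>
  have "z ^ (n - 1) * iexp (- (v * \<delta>)) / (l + \<i> * v) - z ^ n / (l + \<i> * v) = X * R - \<i> * (v * \<delta>) * X"
    unfolding X_def R_def E_def w_def k by (simp add: diff_divide_distrib[symmetric]) (simp add: algebra_simps)
  then have "\<bar>Re (z ^ (n - 1) * iexp (- (v * \<delta>)) / (l + \<i> * v) - z ^ n / (l + \<i> * v))\<bar>
      = \<bar>Re (X * R) + (v * \<delta>) * Im X\<bar>" by simp
  also have "\<dots> \<le> cmod (X * R) + \<bar>v * \<delta>\<bar> * \<bar>Im X\<bar>"
    using abs_Re_le_cmod[of "X * R"] by (intro abs_triangle_ineq[THEN order_trans]) (simp add: abs_mult)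
  also have "\<dots> \<le> (G * (1 / l)) * (v\<^sup>2 * \<delta>\<^sup>2 / 2 + v\<^sup>2 * (2 / 3))
      + \<bar>v * \<delta>\<bar> * ((n * G * (C * \<bar>v\<bar> ^ 3 / 6) + G * \<bar>v\<bar>) / l)"
    unfolding norm_mult X_def
    using R ImX w(1)[OF l0] zk1 l0 by (intro add_mono mult_mono mult_left_mono) (auto simp: G_def X_def)
  also have "\<dots> = G / l * (v\<^sup>2 * \<delta>\<^sup>2 / 2 + v\<^sup>2 * (2 / 3) + \<bar>\<delta>\<bar> * (n * C * v ^ 4 / 6 + v\<^sup>2))"
  proof -
    define u where "u = \<bar>v\<bar>"
    have e: "v ^ 4 = u ^ 4" "v\<^sup>2 = u\<^sup>2" by (simp_all add: u_def)
    show ?thesis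
      unfolding abs_mult e u_def[symmetric] using l0
      by (simp add: field_simps power2_eq_square power3_eq_cube power4_eq_xxxx)
  qed
  also have "\<dots> \<le> G / l * ((1 + \<delta>\<^sup>2) * (n * C * v ^ 4 + 2 * v\<^sup>2))"
  proof (rule mult_left_mono)
    have d: "\<bar>\<delta>\<bar> \<le> (1 + \<delta>\<^sup>2) / 2"
      using zero_le_power2[of "\<bar>\<delta>\<bar> - 1"] by (simp add: power2_diff)
    have "\<bar>\<delta>\<bar> * (n * C * v ^ 4 / 6 + v\<^sup>2) \<le> (1 + \<delta>\<^sup>2) / 2 * (n * C * v ^ 4 / 6 + v\<^sup>2)"
      using d C by (intro mult_right_mono) auto
    also have "\<dots> \<le> (1 + \<delta>\<^sup>2) * (n * C * v ^ 4 + v\<^sup>2 / 2)"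
    proof -
      have "0 \<le> n * C * v ^ 4" using C by simp
      then have "1 / 2 * (n * C * v ^ 4 / 6 + v\<^sup>2) \<le> n * C * v ^ 4 + v\<^sup>2 / 2" by argo
      then have "(1 + \<delta>\<^sup>2) * (1 / 2 * (n * C * v ^ 4 / 6 + v\<^sup>2)) \<le> (1 + \<delta>\<^sup>2) * (n * C * v ^ 4 + v\<^sup>2 / 2)"
        by (intro mult_left_mono) auto
      then show ?thesis by simp
    qed
    finally have 1: "\<bar>\<delta>\<bar> * (n * C * v ^ 4 / 6 + v\<^sup>2) \<le> (1 + \<delta>\<^sup>2) * (n * C * v ^ 4 + v\<^sup>2 / 2)" .
    have 2: "v\<^sup>2 * \<delta>\<^sup>2 / 2 + v\<^sup>2 * (2 / 3) \<le> (1 + \<delta>\<^sup>2) * (3 / 2 * v\<^sup>2)"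
      using mult_nonneg_nonneg[of "v\<^sup>2" "\<delta>\<^sup>2"] zero_le_power2[of v] by (simp add: algebra_simps)
    show "v\<^sup>2 * \<delta>\<^sup>2 / 2 + v\<^sup>2 * (2 / 3) + \<bar>\<delta>\<bar> * (n * C * v ^ 4 / 6 + v\<^sup>2)
       \<le> (1 + \<delta>\<^sup>2) * (n * C * v ^ 4 + 2 * v\<^sup>2)"
      using add_mono[OF 2 1] by (rule order_trans) (simp add: field_simps)
  qed (use l in \<open>simp add: G_def\<close>)
  finally show ?thesis by (simp add: G_def mult_ac)
qed

text \<open>Both \<open>z\<close> and the Gaussian value \<open>g\<close> are bounded by
  \<open>\<rho> = exp (- (v\<^sup>2 / 4))\<close>. After division by \<rho> they lie in the unit
  disc, where \<open>n\<close>-th powers differ by at most \<open>n\<close> times the difference of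
  the bases; multiplying back keeps the Gaussian decay \<open>\<rho> ^ (n - 1)\<close>. Replacing
  \<open>1 / (l + \<i> * v)\<close> by \<open>1 / l\<close> costs the term linear in
  \<open>|v|\<close>.\<close>

lemma kernel_main_pointwise:
  fixes z :: complex and v l C :: real and n :: nat
  assumes z1: "cmod z \<le> exp (- (v\<^sup>2 / 4))" and z2: "cmod (z - complex_of_real (1 - v\<^sup>2 / 2)) \<le> C * \<bar>v\<bar> ^ 3 / 6"
    and v1: "\<bar>v\<bar> \<le> 1" and n: "n \<ge> 4" and l: "l \<ge> 1" and C: "C \<ge> 1"
  shows "\<bar>Re (z ^ n / (l + \<i> * v)) - exp (- (n * v\<^sup>2 / 2)) / l\<bar>
    \<le> exp (- (n * v\<^sup>2 / 8)) * (\<bar>v\<bar> + n * C * \<bar>v\<bar> ^ 3) / l"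
proof -
  define w where "w = 1 / (complex_of_real l + \<i> * complex_of_real v)"
  define G where "G = exp (- (n * v\<^sup>2 / 8))"
  define \<rho> where "\<rho> = exp (- (v\<^sup>2 / 4))"
  define g where "g = exp (- (v\<^sup>2 / 2))"
  have \<rho>: "\<rho> > 0" by (simp add: \<rho>_def)
  note w = inverse_kernel_bounds[of l v, folded w_def]
  have l0: "l > 0" using l by simp
  obtain k where k: "n = Suc k" using n by (cases n) auto
  have \<rho>k: "\<rho> ^ k \<le> G"
  proof -
    have "\<rho> ^ k = exp (- (k * v\<^sup>2 / 4))" by (simp add: \<rho>_def exp_of_nat_mult[symmetric])
    also have "\<dots> \<le> G"
      unfolding G_def using n k mult_right_mono[of "real n" "2 * real k" "v\<^sup>2"] by (simp add: mult_ac)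
    finally show ?thesis .
  qed
  have zn: "cmod (z ^ n) \<le> G"
  proof -
    have "cmod (z ^ n) \<le> \<rho> ^ n" unfolding norm_power \<rho>_def by (intro power_mono z1) auto
    also have "\<dots> \<le> \<rho> ^ k" using k by (intro power_decreasing) (auto simp: \<rho>_def)
    finally show ?thesis using \<rho>k by simp
  qed
  have gn: "exp (- (n * v\<^sup>2 / 2)) = g ^ n" by (simp add: g_def exp_of_nat_mult[symmetric])
  have zg: "cmod (z - g) \<le> C * \<bar>v\<bar> ^ 3"
  proof -
    have "\<bar>g - (1 - v\<^sup>2 / 2)\<bar> \<le> (v\<^sup>2 / 2)\<^sup>2 / 2"
    proof -
      have 1: "1 - v\<^sup>2 / 2 \<le> g" unfolding g_def using exp_ge_add_one_self[of "- (v\<^sup>2 / 2)"] by simp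
      define y where "y = v\<^sup>2 / 2"
      have y: "y \<ge> 0" by (simp add: y_def)
      have "g * (1 + y + y\<^sup>2 / 2) \<le> g * exp y"
        using exp_lower_Taylor_quadratic[OF y] by (intro mult_left_mono) (auto simp: g_def)
      also have "\<dots> = 1" by (simp add: g_def y_def exp_minus)
      also have "1 \<le> (1 - y + y\<^sup>2 / 2) * (1 + y + y\<^sup>2 / 2)"
      proof -
        have "(1 - y + y\<^sup>2 / 2) * (1 + y + y\<^sup>2 / 2) = 1 + (y\<^sup>2 / 2)\<^sup>2" by (simp add: algebra_simps power2_eq_square)
        then show ?thesis by simp
      qed
      finally have "g \<le> 1 - y + y\<^sup>2 / 2" using y by (simp add: mult_le_cancel_right add_pos_nonneg)
      then show ?thesis using 1 by (simp add: y_def)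
    qed
    also have "\<dots> \<le> C * \<bar>v\<bar> ^ 3 / 2"
    proof -
      have "(v\<^sup>2 / 2)\<^sup>2 / 2 = \<bar>v\<bar> * \<bar>v\<bar> ^ 3 / 8"
        unfolding power2_abs[of v, symmetric] by (simp add: power2_eq_square power3_eq_cube)
      also have "\<dots> \<le> \<bar>v\<bar> * \<bar>v\<bar> ^ 3 / 2" by simp
      also have "\<dots> \<le> C * \<bar>v\<bar> ^ 3 / 2" using v1 C by (intro divide_right_mono mult_right_mono) auto
      finally show ?thesis .
    qed
    finally have 1: "cmod (complex_of_real ((1 - v\<^sup>2 / 2) - g)) \<le> C * \<bar>v\<bar> ^ 3 / 2"
      unfolding norm_of_real by (subst abs_minus_commute) simp
    have "z - g = (z - complex_of_real (1 - v\<^sup>2 / 2)) + complex_of_real ((1 - v\<^sup>2 / 2) - g)" by simp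
    also have "cmod \<dots> \<le> C * \<bar>v\<bar> ^ 3 / 6 + C * \<bar>v\<bar> ^ 3 / 2"
      by (rule norm_triangle_le) (use z2 1 in simp)
    also have "\<dots> \<le> C * \<bar>v\<bar> ^ 3" using mult_nonneg_nonneg[of C "\<bar>v\<bar> ^ 3"] C by simp
    finally show ?thesis .
  qed
  have zgn: "cmod (z ^ n - complex_of_real g ^ n) \<le> n * G * (C * \<bar>v\<bar> ^ 3)"
  proof -
    have "cmod ((z / \<rho>) ^ n - (complex_of_real g / \<rho>) ^ n) \<le> n * cmod (z / \<rho> - complex_of_real g / \<rho>)"
    proof (rule norm_power_diff)
      show "cmod (z / \<rho>) \<le> 1" using z1 \<rho> by (simp add: norm_divide \<rho>_def)
      show "cmod (complex_of_real g / \<rho>) \<le> 1" using \<rho> by (simp add: norm_divide \<rho>_def g_def)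
    qed
    then have "cmod (z ^ n - complex_of_real g ^ n) / \<rho> ^ n \<le> n * (cmod (z - g) / \<rho>)"
      using \<rho> by (simp add: power_divide diff_divide_distrib[symmetric] norm_divide norm_power)
    then have "cmod (z ^ n - complex_of_real g ^ n) \<le> n * \<rho> ^ k * cmod (z - g)"
      using \<rho> by (simp add: k field_simps)
    also have "\<dots> \<le> n * G * (C * \<bar>v\<bar> ^ 3)"
      using \<rho>k zg \<rho> by (intro mult_mono) (auto simp: G_def)
    finally show ?thesis .
  qed
  have "\<bar>Re (z ^ n / (l + \<i> * v)) - exp (- (n * v\<^sup>2 / 2)) / l\<bar> = \<bar>Re (z ^ n * w - complex_of_real g ^ n / l)\<bar>"
    unfolding gn w_def by (simp flip: of_real_power)
  also have "\<dots> \<le> cmod (z ^ n * w - complex_of_real g ^ n / l)" by (rule abs_Re_le_cmod)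
  also have "z ^ n * w - complex_of_real g ^ n / l = z ^ n * (w - 1 / l) + (z ^ n - complex_of_real g ^ n) / l"
    by (simp add: algebra_simps diff_divide_distrib)
  also have "cmod \<dots> \<le> G * (\<bar>v\<bar> / l) + n * G * (C * \<bar>v\<bar> ^ 3) / l"
  proof (intro norm_triangle_le add_mono)
    have "\<bar>v\<bar> / l\<^sup>2 \<le> \<bar>v\<bar> / l"
      using l frac_le[of "\<bar>v\<bar>" "\<bar>v\<bar>" l "l\<^sup>2"] by (simp add: power2_eq_square)
    then have "cmod (w - 1 / l) \<le> \<bar>v\<bar> / l" using w(3)[OF l0] by simp
    then show "cmod (z ^ n * (w - 1 / l)) \<le> G * (\<bar>v\<bar> / l)"
      unfolding norm_mult using zn by (intro mult_mono) (auto simp: G_def)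
    show "cmod ((z ^ n - complex_of_real g ^ n) / l) \<le> n * G * (C * \<bar>v\<bar> ^ 3) / l"
      using zgn l0 by (simp add: norm_divide divide_right_mono)
  qed
  also have "\<dots> = G * (\<bar>v\<bar> + n * C * \<bar>v\<bar> ^ 3) / l"
    by (simp add: algebra_simps add_divide_distrib)
  finally show ?thesis unfolding G_def .
qed

text \<open>In the range \<open>C * |v| <= 1\<close> the cubic remainder is at most
  \<open>v\<^sup>2 / 6\<close>, so the quadratic loss \<open>v\<^sup>2 / 2\<close> is reduced to no
  less than \<open>v\<^sup>2 / 4\<close>.\<close>

lemma char_near_zero:
  assumes "std_density C B c r f" "C \<ge> 1" "C * \<bar>v\<bar> \<le> 1"
  shows "cmod (char (density lborel (\<lambda>x. ennreal (f x))) v) \<le> exp (- (v\<^sup>2 / 4))"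
proof -
  let ?z = "char (density lborel (\<lambda>x. ennreal (f x))) v"
  have v1: "\<bar>v\<bar> \<le> 1" using assms(2,3) mult_right_mono[of 1 C "\<bar>v\<bar>"] by simp
  then have v2: "v\<^sup>2 \<le> 1" by (simp add: abs_square_le_1)
  have Cv3: "C * \<bar>v\<bar> ^ 3 \<le> v\<^sup>2"
    using mult_right_mono[OF assms(3), of "v\<^sup>2"] by (simp add: power3_eq_cube power2_eq_square mult_ac)
  have "cmod ?z \<le> cmod (?z - complex_of_real (1 - v\<^sup>2 / 2)) + cmod (complex_of_real (1 - v\<^sup>2 / 2))"
    using norm_triangle_ineq[of "?z - complex_of_real (1 - v\<^sup>2 / 2)" "complex_of_real (1 - v\<^sup>2 / 2)"] by simp
  also have "\<dots> \<le> C * \<bar>v\<bar> ^ 3 / 6 + (1 - v\<^sup>2 / 2)"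
    using char_taylor[OF assms(1)] v2 unfolding norm_of_real by (intro add_mono) auto
  also have "\<dots> \<le> 1 + - (v\<^sup>2 / 4)" using Cv3 zero_le_power2[of v] by linarith
  also have "\<dots> \<le> exp (- (v\<^sup>2 / 4))" by (rule exp_ge_add_one_self)
  finally show ?thesis .
qed

text \<open>The exponent is \<open>n - 3\<close> because two of the \<open>n - 1\<close> factors of
  the characteristic function stay behind to be integrated as a square.\<close>

lemma power_times_poly_bounded:
  assumes "0 < \<kappa>" "\<kappa> < (1::real)"
  shows "\<exists>A>0. \<forall>n\<ge>3. \<kappa> ^ (n - 3) \<le> A / (real n * sqrt (real n))"
proof -
  have "(\<lambda>n. \<kappa> ^ n * (real (n + 3) * sqrt (real (n + 3)))) \<longlonglongrightarrow> 0"
    using assms by real_asymp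
  then have "Bseq (\<lambda>n. \<kappa> ^ n * (real (n + 3) * sqrt (real (n + 3))))"
    by (intro convergent_imp_Bseq convergentI)
  then obtain A where A: "A > 0" "\<And>n. norm (\<kappa> ^ n * (real (n + 3) * sqrt (real (n + 3)))) \<le> A"
    by (auto simp: Bseq_def)
  have "\<kappa> ^ (n - 3) \<le> A / (real n * sqrt (real n))" if "n \<ge> 3" for n
    using A(2)[of "n - 3"] that assms by (simp add: pos_le_divide_eq)
  then show ?thesis using A(1) by blast
qed

text \<open>The constant \<open>2 * pi\<close> of the inversion formula cancels in the quotient and is left out.\<close>

lemma tail_kernel_estimates:
  fixes C B c r :: real
  assumes C: "C \<ge> 1" and c: "c > 0" and r: "r > 0" and B: "B > 0"
  shows "\<exists>A>0. \<exists>N. \<forall>f n l \<delta>. std_density C B c r f \<longrightarrow> n \<ge> N \<longrightarrow> l \<ge> 1 \<longrightarrow>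
     (let Z = char (density lborel (\<lambda>x. ennreal (f x)));
          K = (\<lambda>k d. Re (CLINT v|lborel. Z v ^ k * iexp (- (v * d)) / (l + \<i> * v)))
      in integrable lborel (\<lambda>v. Z v ^ (n - 1)) \<and> integrable lborel (\<lambda>v. Z v ^ n) \<and>
         \<bar>K (n - 1) \<delta> - K n 0\<bar> \<le> A * (1 + \<delta>\<^sup>2) / (l * n * sqrt n) \<and> K n 0 \<ge> 1 / (l * sqrt n))"
proof -
  \<comment> \<open>The boundary between the range of the Taylor expansion and the range where the
    characteristic function is at most \<kappa>; neither depends on the density.\<close>
  define v0 where "v0 = 1 / C"
  have v0: "v0 > 0" "v0 \<le> 1" using C by (auto simp: v0_def)
  obtain \<kappa> where \<kappa>: "0 < \<kappa>" "\<kappa> < 1" and \<kappa>z: "\<And>f v. std_density C B c r f \<Longrightarrow> \<bar>v\<bar> \<ge> v0 \<Longrightarrow>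
           cmod (char (density lborel (\<lambda>x. ennreal (f x))) v) \<le> \<kappa>"
    using char_away_from_zero[of C c r v0 B] C c r v0 by (auto)
  obtain A0 where A0: "A0 > 0" "\<And>n. n \<ge> 3 \<Longrightarrow> \<kappa> ^ (n - 3) \<le> A0 / (real n * sqrt (real n))"
    using power_times_poly_bounded[OF \<kappa>] by blast
  define mom where "mom = (\<lambda>j n \<Gamma>. integrable lborel (\<lambda>v::real. \<bar>v\<bar> ^ j * exp (- (n * v\<^sup>2 / 8))) \<and>
     (LINT v|lborel. \<bar>v\<bar> ^ j * exp (- (n * v\<^sup>2 / 8))) = \<Gamma> / sqrt n ^ (j + 1))"
  have "\<forall>j. \<exists>\<Gamma>\<ge>0. \<forall>n>0. mom j n \<Gamma>" unfolding mom_def using gaussian_moment by blast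
  then obtain \<Gamma> where \<Gamma>: "\<And>j. \<Gamma> j \<ge> 0" "\<And>j n. n > 0 \<Longrightarrow> mom j n (\<Gamma> j)" by metis
  \<comment> \<open>\<open>A\<close> collects the moments from \<open>kernel_diff_pointwise\<close>
    and twice the tail \<open>2 * pi * B * A0\<close>, with 1 added for positivity.
    \<open>A2\<close> does the same for \<open>kernel_main_pointwise\<close>; \<open>N\<close> is so
    large that the resulting error \<open>A2 / n\<close> is at most
    \<open>1 / sqrt n\<close>.\<close>
  define A where "A = C * \<Gamma> 4 + 2 * \<Gamma> 2 + 4 * pi * B * A0 + 1"
  define A2 where "A2 = (1 + 1 / v0) * \<Gamma> 1 + C * \<Gamma> 3 + 2 * pi * B * A0"
  obtain N where N: "N \<ge> 4" "\<And>n. n \<ge> N \<Longrightarrow> A2 \<le> sqrt (real n)"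
  proof -
    have "filterlim (\<lambda>n. sqrt (real n)) at_top sequentially" by real_asymp
    then have "\<forall>\<^sub>F n in sequentially. A2 \<le> sqrt (real n)" by (simp add: filterlim_at_top)
    then obtain N0 where "\<And>n. n \<ge> N0 \<Longrightarrow> A2 \<le> sqrt (real n)" by (auto simp: eventually_sequentially)
    then show ?thesis using that[of "max 4 N0"] by auto
  qed
  have A: "A > 0" unfolding A_def using \<Gamma>(1) C B A0 by (intro add_nonneg_pos add_nonneg_nonneg) auto
  show ?thesis
  proof (intro exI[of _ A] exI[of _ N] conjI allI impI A)
    fix f n and l \<delta> :: real
    assume sd: "std_density C B c r f" and n: "n \<ge> N" and l: "l \<ge> 1"
    have n4: "n \<ge> 4" and n0: "real n > 0" using n N by auto
    define M where "M = density lborel (\<lambda>x. ennreal (f x))"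
    define Z where "Z = char M"
    have f: "f \<in> borel_measurable borel" "\<And>x. 0 \<le> f x" "\<And>x. f x \<le> B" "has_bochner_integral lborel f 1"
      using sd[unfolded std_density_def] by auto
    interpret M: real_distribution M
      unfolding M_def by (rule real_distribution_density) (use f in auto)
    have Z2: "integrable lborel (\<lambda>v. (cmod (Z v))\<^sup>2)" "(LINT v|lborel. (cmod (Z v))\<^sup>2) \<le> 2 * pi * B"
      unfolding Z_def using M.char_square_integrable[OF M_def f(1-3)] by auto
    have Zm[measurable]: "Z \<in> borel_measurable borel" unfolding Z_def by measurable
    have Z1: "cmod (Z v) \<le> 1" for v unfolding Z_def by (rule M.cmod_char_le_1)
    have Zk2: "cmod (Z v ^ k) \<le> (cmod (Z v))\<^sup>2" if "k \<ge> 2" for k v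
      unfolding norm_power using that Z1 by (intro power_decreasing) auto
    have Zi: "integrable lborel (\<lambda>v. Z v ^ k)" if "k \<ge> 2" for k
      by (rule Bochner_Integration.integrable_bound[OF Z2(1)]) (use Zk2[OF that] in auto)
    have Ztail: "cmod (Z v ^ k) \<le> \<kappa> ^ (n - 3) * (cmod (Z v))\<^sup>2" if "k \<ge> n - 1" "\<bar>v\<bar> \<ge> v0" for k v
    proof -
      have k: "k = (n - 3) + (k - (n - 3))" "k - (n - 3) \<ge> 2" using that n4 by auto
      have "cmod (Z v ^ k) = cmod (Z v) ^ (n - 3) * cmod (Z v) ^ (k - (n - 3))"
        by (subst k(1)) (simp add: norm_power norm_mult power_add)
      also have "\<dots> \<le> \<kappa> ^ (n - 3) * (cmod (Z v))\<^sup>2"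
        using \<kappa>z[OF sd that(2), folded M_def, folded Z_def] \<kappa> k(2) Z1
        by (intro mult_mono power_mono power_decreasing) auto
      finally show ?thesis .
    qed
    define w where "w = (\<lambda>v. complex_of_real l + \<i> * complex_of_real v)"
    have wm[measurable]: "w \<in> borel_measurable borel" unfolding w_def by measurable
    have l0: "l > 0" using l by simp
    have w1: "cmod (1 / w v) \<le> 1 / l" for v unfolding w_def using inverse_kernel_bounds(1)[OF l0] .
    have divw: "cmod (z / w v) \<le> cmod z / l" for z v
      using mult_left_mono[OF w1[of v], of "cmod z"] by (simp add: norm_divide)
    define k where "k = (\<lambda>j d v. Z v ^ j * iexp (- (v * d)) / w v)"
    have km[measurable]: "k j d \<in> borel_measurable borel" for j d unfolding k_def by measurable
    have kb: "cmod (k j d v) \<le> cmod (Z v ^ j) / l" for j d v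
      unfolding k_def using divw[of "Z v ^ j * iexp (- (v * d))" v] by (simp only: norm_mult norm_exp_i_times mult_1_right)
    have ki: "integrable lborel (k j d)" if "j \<ge> 2" for j d
      by (rule Bochner_Integration.integrable_bound[of _ "\<lambda>v. cmod (Z v ^ j) / l"])
         (use kb l0 Zi[OF that] in auto)
    have Rk: "Re (CLINT v|lborel. k j d v) = (LINT v|lborel. Re (k j d v))" if "j \<ge> 2" for j d
      using ki[OF that] by simp
    define G where "G = (\<lambda>v. exp (- (real n * v\<^sup>2 / 8)))"
    have mo: "integrable lborel (\<lambda>v. \<bar>v\<bar> ^ j * G v)" "(LINT v|lborel. \<bar>v\<bar> ^ j * G v) = \<Gamma> j / sqrt n ^ (j + 1)" for j
      using \<Gamma>(2)[OF n0, of j] unfolding mom_def G_def by auto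
    have mo': "has_bochner_integral lborel (\<lambda>v. \<bar>v\<bar> ^ j * G v) (\<Gamma> j / sqrt n ^ i)" if "i = j + 1" for i j
      using mo[of j] that by (simp add: has_bochner_integral_iff)
    have sq: "sqrt n * sqrt n = n" "sqrt n > 0" using n0 by auto
    have tail: "\<kappa> ^ (n - 3) \<le> A0 / (real n * sqrt (real n))" using A0(2)[of n] n4 by simp

    \<comment> \<open>A majorant for all \<open>v\<close>: the Gaussian terms serve near 0, and in
      the tail the two kernels are bounded separately, hence the factor 2 before \<kappa>.\<close>
    define D where "D = (\<lambda>v. (1 + \<delta>\<^sup>2) / l * (n * C * (\<bar>v\<bar> ^ 4 * G v) + 2 * (\<bar>v\<bar> ^ 2 * G v) + 2 * \<kappa> ^ (n - 3) * (cmod (Z v))\<^sup>2))"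
    have Di: "integrable lborel D" unfolding D_def
      by (intro integrable_mult_right Bochner_Integration.integrable_add mo Z2)
    have Dpt: "\<bar>Re (k (n - 1) \<delta> v) - Re (k n 0 v)\<bar> \<le> D v" for v
    proof (cases "C * \<bar>v\<bar> \<le> 1")
      case True
      have "\<bar>Re (k (n - 1) \<delta> v) - Re (k n 0 v)\<bar> = \<bar>Re (Z v ^ (n - 1) * iexp (- (v * \<delta>)) / (l + \<i> * v) - Z v ^ n / (l + \<i> * v))\<bar>"
        by (simp add: k_def w_def)
      also have "\<dots> \<le> (1 + \<delta>\<^sup>2) / l * (exp (- (n * v\<^sup>2 / 8)) * (n * C * v ^ 4 + 2 * v\<^sup>2))"
        by (rule kernel_diff_pointwise)
           (use char_near_zero[OF sd C True] char_taylor[OF sd, of v] n4 l C True in \<open>auto simp: Z_def M_def\<close>)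
      also have "\<dots> \<le> D v"
        unfolding D_def
      proof (rule mult_left_mono)
        have "exp (- (n * v\<^sup>2 / 8)) * (n * C * v ^ 4 + 2 * v\<^sup>2) = n * C * (\<bar>v\<bar> ^ 4 * G v) + 2 * (\<bar>v\<bar> ^ 2 * G v)"
          by (simp add: G_def algebra_simps)
        then show "exp (- (n * v\<^sup>2 / 8)) * (n * C * v ^ 4 + 2 * v\<^sup>2)
          \<le> n * C * (\<bar>v\<bar> ^ 4 * G v) + 2 * (\<bar>v\<bar> ^ 2 * G v) + 2 * \<kappa> ^ (n - 3) * (cmod (Z v))\<^sup>2"
          using \<kappa> by simp
      qed (use l in auto)
      finally show ?thesis .
    next
      case False
      then have v: "\<bar>v\<bar> \<ge> v0" using C by (simp add: v0_def divide_simps mult.commute)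
      have "\<bar>Re (k (n - 1) \<delta> v) - Re (k n 0 v)\<bar> \<le> cmod (k (n - 1) \<delta> v) + cmod (k n 0 v)"
        using abs_Re_le_cmod[of "k (n - 1) \<delta> v"] abs_Re_le_cmod[of "k n 0 v"] by linarith
      also have "\<dots> \<le> (\<kappa> ^ (n - 3) * (cmod (Z v))\<^sup>2) / l + (\<kappa> ^ (n - 3) * (cmod (Z v))\<^sup>2) / l"
        using Ztail[of "n - 1" v] Ztail[of n v] v l0
        by (intro add_mono order_trans[OF kb] divide_right_mono) auto
      also have "\<dots> = 1 / l * (2 * \<kappa> ^ (n - 3) * (cmod (Z v))\<^sup>2)" by simp
      also have "\<dots> \<le> D v"
        unfolding D_def using \<kappa> C l by (intro mult_mono divide_right_mono) (auto simp: G_def)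
      finally show ?thesis .
    qed
    have "\<bar>Re (CLINT v|lborel. k (n - 1) \<delta> v) - Re (CLINT v|lborel. k n 0 v)\<bar>
       = \<bar>LINT v|lborel. Re (k (n - 1) \<delta> v) - Re (k n 0 v)\<bar>"
      using n4 ki by (subst (1 2) Rk) (auto simp: Bochner_Integration.integral_diff)
    also have "\<dots> \<le> (LINT v|lborel. \<bar>Re (k (n - 1) \<delta> v) - Re (k n 0 v)\<bar>)"
      by (rule integral_abs_bound)
    also have "\<dots> \<le> (LINT v|lborel. D v)"
      by (rule integral_mono') (use Di Dpt in \<open>auto intro: order_trans[OF abs_ge_zero]\<close>)
    also have "(LINT v|lborel. D v) = (1 + \<delta>\<^sup>2) / l * (n * C * (\<Gamma> 4 / sqrt n ^ 5) + 2 * (\<Gamma> 2 / sqrt n ^ 3)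
        + 2 * \<kappa> ^ (n - 3) * (LINT v|lborel. (cmod (Z v))\<^sup>2))"
      unfolding D_def
      by (rule has_bochner_integral_integral_eq)
         (intro has_bochner_integral_mult_right has_bochner_integral_add mo' has_bochner_integral_integrable Z2(1); simp)
    also have "\<dots> \<le> (1 + \<delta>\<^sup>2) / l * (A / (n * sqrt n))"
    proof (rule mult_left_mono)
      have "n * C * (\<Gamma> 4 / sqrt n ^ 5) = C * \<Gamma> 4 / (n * sqrt n)"
        using sq by (simp add: eval_nat_numeral divide_simps) 
      moreover have "2 * (\<Gamma> 2 / sqrt n ^ 3) = 2 * \<Gamma> 2 / (n * sqrt n)"
        using sq by (simp add: eval_nat_numeral)
      moreover have "2 * \<kappa> ^ (n - 3) * (LINT v|lborel. (cmod (Z v))\<^sup>2) \<le> 2 * (A0 / (n * sqrt n)) * (2 * pi * B)"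
        using Z2 tail \<kappa> A0(1) by (intro mult_mono) auto
      moreover have "2 * (A0 / (n * sqrt n)) * (2 * pi * B) = 4 * pi * B * A0 / (n * sqrt n)" by simp
      moreover have "0 \<le> 1 / (n * sqrt n)" by simp
      ultimately show "n * C * (\<Gamma> 4 / sqrt n ^ 5) + 2 * (\<Gamma> 2 / sqrt n ^ 3)
        + 2 * \<kappa> ^ (n - 3) * (LINT v|lborel. (cmod (Z v))\<^sup>2) \<le> A / (n * sqrt n)"
        unfolding A_def add_divide_distrib by linarith
    qed (use l in simp)
    finally have diff: "\<bar>Re (CLINT v|lborel. k (n - 1) \<delta> v) - Re (CLINT v|lborel. k n 0 v)\<bar> \<le> A * (1 + \<delta>\<^sup>2) / (l * n * sqrt n)"
      by (simp add: mult_ac)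

    define g where "g = (\<lambda>v. exp (- (real n * v\<^sup>2 / 2)) / l)"
    have g: "integrable lborel g" "(LINT v|lborel. g v) = sqrt (2 * pi) / (l * sqrt n)"
    proof -
      have eq: "g = (\<lambda>v. sqrt (2 * pi) / (l * sqrt n) * normal_density 0 (1 / sqrt n) v)"
        using n0 l0 by (auto simp: g_def normal_density_def real_sqrt_divide real_sqrt_mult power_divide field_simps)
      have "integrable lborel (normal_density 0 (1 / sqrt n))" "integral\<^sup>L lborel (normal_density 0 (1 / sqrt n)) = 1"
        using n0 by auto
      then show "integrable lborel g" "(LINT v|lborel. g v) = sqrt (2 * pi) / (l * sqrt n)"
        unfolding eq by auto
    qed
    \<comment> \<open>The comparison Gaussian has to be dominated away from 0 as well; there
      \<open>1 <= |v| / v0\<close>, which accounts for the summand \<open>1 / v0\<close> in front of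
      the first moment.\<close>
    define H where "H = (\<lambda>v. 1 / l * ((1 + 1 / v0) * (\<bar>v\<bar> ^ 1 * G v) + n * C * (\<bar>v\<bar> ^ 3 * G v) + \<kappa> ^ (n - 3) * (cmod (Z v))\<^sup>2))"
    have Hi: "integrable lborel H" unfolding H_def
      by (intro integrable_mult_right Bochner_Integration.integrable_add mo Z2)
    have Hpt: "\<bar>Re (k n 0 v) - g v\<bar> \<le> H v" for v
    proof (cases "C * \<bar>v\<bar> \<le> 1")
      case True
      then have v1: "\<bar>v\<bar> \<le> 1" using C mult_right_mono[of 1 C "\<bar>v\<bar>"] by simp
      have "\<bar>Re (k n 0 v) - g v\<bar> = \<bar>Re (Z v ^ n / (l + \<i> * v)) - exp (- (n * v\<^sup>2 / 2)) / l\<bar>"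
        by (simp add: k_def w_def g_def)
      also have "\<dots> \<le> exp (- (n * v\<^sup>2 / 8)) * (\<bar>v\<bar> + n * C * \<bar>v\<bar> ^ 3) / l"
        by (rule kernel_main_pointwise)
           (use char_near_zero[OF sd C True] char_taylor[OF sd, of v] n4 l C v1 in \<open>auto simp: Z_def M_def\<close>)
      also have "\<dots> = 1 / l * (\<bar>v\<bar> ^ 1 * G v + n * C * (\<bar>v\<bar> ^ 3 * G v))"
        by (simp add: G_def algebra_simps add_divide_distrib)
      also have "\<dots> \<le> H v"
        unfolding H_def
      proof (rule mult_left_mono)
        have "1 * (\<bar>v\<bar> ^ 1 * G v) \<le> (1 + 1 / v0) * (\<bar>v\<bar> ^ 1 * G v)"
          using v0 by (intro mult_right_mono) (auto simp: G_def)
        moreover have "0 \<le> \<kappa> ^ (n - 3) * (cmod (Z v))\<^sup>2" using \<kappa> by simp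
        ultimately show "\<bar>v\<bar> ^ 1 * G v + n * C * (\<bar>v\<bar> ^ 3 * G v)
          \<le> (1 + 1 / v0) * (\<bar>v\<bar> ^ 1 * G v) + n * C * (\<bar>v\<bar> ^ 3 * G v) + \<kappa> ^ (n - 3) * (cmod (Z v))\<^sup>2"
          by linarith
      qed (use l in auto)
      finally show ?thesis .
    next
      case False
      then have v: "\<bar>v\<bar> \<ge> v0" using C by (simp add: v0_def divide_simps mult.commute)
      have "\<bar>Re (k n 0 v)\<bar> \<le> 1 / l * (\<kappa> ^ (n - 3) * (cmod (Z v))\<^sup>2)"
        using abs_Re_le_cmod[of "k n 0 v"] kb[of n 0 v] divide_right_mono[OF Ztail[of n v], of l] v l0 by simp
      moreover have "g v \<le> 1 / l * (1 / v0 * (\<bar>v\<bar> ^ 1 * G v))"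
      proof -
        have "exp (- (real n * v\<^sup>2 / 2)) \<le> 1 * G v" unfolding G_def using n0 by simp
        also have "\<dots> \<le> (\<bar>v\<bar> / v0) * G v" using v v0 by (intro mult_right_mono) (auto simp: G_def)
        finally have "exp (- (real n * v\<^sup>2 / 2)) / l \<le> (\<bar>v\<bar> / v0 * G v) / l"
          using l0 by (intro divide_right_mono) auto
        then show ?thesis by (simp add: g_def mult_ac)
      qed
      moreover have "0 \<le> g v" using l0 by (simp add: g_def)
      moreover have "0 \<le> 1 / l * (\<bar>v\<bar> ^ 1 * G v)" "0 \<le> 1 / l * (n * C * (\<bar>v\<bar> ^ 3 * G v))"
        using l0 C by (auto simp: G_def)
      ultimately show ?thesis unfolding H_def ring_distribs by linarith
    qed
    have "\<bar>Re (CLINT v|lborel. k n 0 v) - (LINT v|lborel. g v)\<bar> = \<bar>LINT v|lborel. Re (k n 0 v) - g v\<bar>"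
      using n4 ki g(1) by (subst Rk) (auto simp: Bochner_Integration.integral_diff)
    also have "\<dots> \<le> (LINT v|lborel. \<bar>Re (k n 0 v) - g v\<bar>)"
      by (rule integral_abs_bound)
    also have "\<dots> \<le> (LINT v|lborel. H v)"
      by (rule integral_mono') (use Hi Hpt in \<open>auto intro: order_trans[OF abs_ge_zero]\<close>)
    also have "(LINT v|lborel. H v) = 1 / l * ((1 + 1 / v0) * (\<Gamma> 1 / sqrt n ^ 2) + n * C * (\<Gamma> 3 / sqrt n ^ 4)
        + \<kappa> ^ (n - 3) * (LINT v|lborel. (cmod (Z v))\<^sup>2))"
      unfolding H_def
      by (rule has_bochner_integral_integral_eq)
         (intro has_bochner_integral_mult_right has_bochner_integral_add mo' has_bochner_integral_integrable Z2(1); simp)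
    also have "\<dots> \<le> 1 / l * (A2 / n)"
    proof (rule mult_left_mono)
      have "(1 + 1 / v0) * (\<Gamma> 1 / sqrt n ^ 2) = (1 + 1 / v0) * \<Gamma> 1 / n" using n0 by simp
      moreover have "n * C * (\<Gamma> 3 / sqrt n ^ 4) = C * \<Gamma> 3 / n"
        using sq by (simp add: eval_nat_numeral divide_simps)
      moreover have "\<kappa> ^ (n - 3) * (LINT v|lborel. (cmod (Z v))\<^sup>2) \<le> (A0 / (n * sqrt n)) * (2 * pi * B)"
        using Z2 tail \<kappa> A0(1) by (intro mult_mono) auto
      moreover have "(A0 / (n * sqrt n)) * (2 * pi * B) \<le> 2 * pi * B * A0 / n"
      proof -
        have "A0 / (n * sqrt n) \<le> A0 / (n * 1)"
          using A0 n0 n4 by (intro divide_left_mono mult_left_mono) auto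
        then have "(A0 / (n * sqrt n)) * (2 * pi * B) \<le> (A0 / (n * 1)) * (2 * pi * B)"
          using B by (intro mult_right_mono) auto
        then show ?thesis by (simp add: mult_ac)
      qed
      ultimately show "(1 + 1 / v0) * (\<Gamma> 1 / sqrt n ^ 2) + n * C * (\<Gamma> 3 / sqrt n ^ 4)
        + \<kappa> ^ (n - 3) * (LINT v|lborel. (cmod (Z v))\<^sup>2) \<le> A2 / n"
        unfolding A2_def add_divide_distrib by linarith
    qed (use l in simp)
    also have "\<dots> \<le> 1 / l * (sqrt n / n)"
      using N(2)[OF n] l n0 by (intro mult_left_mono divide_right_mono) auto
    also have "sqrt n / n = 1 / sqrt n" using sq by (simp add: divide_simps)
    finally have "\<bar>Re (CLINT v|lborel. k n 0 v) - sqrt (2 * pi) / (l * sqrt n)\<bar> \<le> 1 / (l * sqrt n)"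
      unfolding g(2) by simp
    \<comment> \<open>The main term \<open>sqrt (2 * pi)\<close> is at least 2 in units of the error
      bound, so one unit is left as a lower bound.\<close>
    moreover have "2 * (1 / (l * sqrt n)) \<le> sqrt (2 * pi) / (l * sqrt n)"
    proof -
      have "2 / (l * sqrt n) \<le> sqrt (2 * pi) / (l * sqrt n)"
        using l0 sq pi_gt3 by (intro divide_right_mono real_le_rsqrt) auto
      then show ?thesis by simp
    qed
    moreover have "\<bar>x - y\<bar> \<le> e \<Longrightarrow> 2 * e \<le> y \<Longrightarrow> e \<le> x" for x y e :: real by linarith
    ultimately have low: "Re (CLINT v|lborel. k n 0 v) \<ge> 1 / (l * sqrt n)" by blast
    show "let Z = char (density lborel (\<lambda>x. ennreal (f x)));
          K = (\<lambda>k d. Re (CLINT v|lborel. Z v ^ k * iexp (- (v * d)) / (l + \<i> * v)))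
      in integrable lborel (\<lambda>v. Z v ^ (n - 1)) \<and> integrable lborel (\<lambda>v. Z v ^ n) \<and>
         \<bar>K (n - 1) \<delta> - K n 0\<bar> \<le> A * (1 + \<delta>\<^sup>2) / (l * n * sqrt n) \<and> K n 0 \<ge> 1 / (l * sqrt n)"
      unfolding Let_def M_def[symmetric] Z_def[symmetric] w_def[symmetric]
      using diff low Zi[of "n - 1"] Zi[of n] n4 unfolding k_def w_def by auto
  qed
qed

section \<open>Tail probabilities of sums\<close>

text \<open>Undoing the tilt turns the indicator of a half line into an exponential, whose Fourier
  transform is the factor \<open>1 / (t s + i v)\<close>.\<close>

lemma tilted_sum_tail:
  fixes M :: "'a measure" and X :: "nat \<Rightarrow> 'a \<Rightarrow> real" and p :: "real \<Rightarrow> real" and t m s b :: real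
  assumes M: "prob_space M"
    and indep: "prob_space.indep_vars M (\<lambda>_. borel) X J"
    and dens: "\<And>i. i \<in> J \<Longrightarrow> distributed M lborel (X i) (\<lambda>x. ennreal (p x))"
    and J: "finite J" "card J = k"
    and p_meas [measurable]: "p \<in> borel_measurable borel" and p_nonneg: "\<And>x. 0 \<le> p x"
    and int: "integrable lborel (\<lambda>x. exp (t * x) * p x)"
    and \<Phi>: "\<Phi> = (LINT x|lborel. exp (t * x) * p x)" "\<Phi> > 0"
    and s: "s > 0" and t: "t > 0"
  defines "Z \<equiv> char (density lborel (\<lambda>z. ennreal (s * (exp (t * (m + s * z)) * p (m + s * z) / \<Phi>))))"
  assumes Zint: "integrable lborel (\<lambda>v. Z v ^ k)"
  shows "complex_of_real (measure M {\<omega> \<in> space M. b \<le> (\<Sum>i\<in>J. X i \<omega>)})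
    = \<Phi> ^ k * exp (- (t * b)) / (2 * pi)
      * (CLINT v|lborel. Z v ^ k * iexp (- (v * ((b - k * m) / s))) / (complex_of_real (t * s) + \<i> * v))"
proof -
  interpret prob_space M by fact
  have Xm[measurable]: "X i \<in> borel_measurable M" if "i \<in> J" for i
    using indep that unfolding indep_vars_def by auto
  define S where "S = (\<lambda>\<omega>. \<Sum>i\<in>J. X i \<omega>)"
  have Sm[measurable]: "S \<in> borel_measurable M" unfolding S_def by (intro borel_measurable_sum Xm)
  \<comment> \<open>The density of the tilted law with respect to the original one, times a
    character of the standardised variable. By independence the product over \<open>J\<close> has
    expectation \<open>Z v ^ k\<close>.\<close>
  define Y where "Y = (\<lambda>v x. (exp (t * x) / \<Phi>) *\<^sub>R iexp (v * ((x - m) / s)))"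
  have Ym[measurable]: "Y v \<in> borel_measurable borel" for v unfolding Y_def by measurable
  have distX: "distr M borel (X i) = density lborel (\<lambda>x. ennreal (p x))" if "i \<in> J" for i
    using dens[OF that] unfolding distributed_def by (metis distr_cong sets_lborel)
  have Yint0: "integrable lborel (\<lambda>x. p x *\<^sub>R Y v x)" for v
    by (rule Bochner_Integration.integrable_bound[of _ "\<lambda>x. exp (t * x) * p x / \<Phi>"])
       (use int \<Phi> p_nonneg in \<open>auto simp: Y_def norm_mult mult.commute\<close>)
  have Yint: "integrable M (\<lambda>\<omega>. Y v (X i \<omega>))" if "i \<in> J" for i v
  proof -
    have "integrable (distr M borel (X i)) (Y v)"
      unfolding distX[OF that] using Yint0 p_nonneg by (subst integrable_density) auto
    then show ?thesis using that by (subst (asm) integrable_distr_eq) auto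
  qed
  have Yval: "(CLINT \<omega>|M. Y v (X i \<omega>)) = Z v" if "i \<in> J" for i v
  proof -
    have "(CLINT \<omega>|M. Y v (X i \<omega>)) = (CLINT x|distr M borel (X i). Y v x)"
      using that by (subst integral_distr) auto
    also have "\<dots> = (CLINT x|lborel. p x *\<^sub>R Y v x)"
      unfolding distX[OF that] using p_nonneg by (subst integral_density) auto
    also have "\<dots> = s *\<^sub>R (CLINT z|lborel. p (m + s * z) *\<^sub>R Y v (m + s * z))"
      using s by (subst lborel_integral_real_affine[of s _ m]) auto
    also have "\<dots> = (CLINT z|lborel. s *\<^sub>R (p (m + s * z) *\<^sub>R Y v (m + s * z)))"
      by (rule integral_scaleR_right[symmetric])
    also have "\<dots> = (CLINT z|lborel. (s * (exp (t * (m + s * z)) * p (m + s * z) / \<Phi>)) *\<^sub>R iexp (v * z))"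
      using s by (intro Bochner_Integration.integral_cong refl) (simp add: Y_def mult_ac)
    also have "\<dots> = Z v"
      unfolding Z_def using s \<Phi> p_nonneg by (subst char_density) auto
    finally show ?thesis .
  qed
  have iY: "indep_vars (\<lambda>_. borel) (\<lambda>i \<omega>. Y v (X i \<omega>)) J" for v
    by (rule indep_vars_compose2[OF indep]) auto
  have prodY: "(\<Prod>i\<in>J. Y v (X i \<omega>)) = (exp (t * S \<omega>) / \<Phi> ^ k) *\<^sub>R iexp (v * ((S \<omega> - k * m) / s))" for v \<omega>
  proof -
    have "(\<Prod>i\<in>J. Y v (X i \<omega>)) = complex_of_real (\<Prod>i\<in>J. exp (t * X i \<omega>) / \<Phi>) * (\<Prod>i\<in>J. iexp (v * ((X i \<omega> - m) / s)))"
      unfolding Y_def scaleR_conv_of_real of_real_prod prod.distrib ..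
    also have "(\<Prod>i\<in>J. exp (t * X i \<omega>) / \<Phi>) = exp (t * S \<omega>) / \<Phi> ^ k"
      using J by (simp add: prod_dividef exp_sum S_def sum_distrib_left)
    also have "(\<Prod>i\<in>J. iexp (v * ((X i \<omega> - m) / s))) = exp (\<Sum>i\<in>J. \<i> * complex_of_real (v * ((X i \<omega> - m) / s)))"
      using J by (simp add: exp_sum)
    also have "(\<Sum>i\<in>J. \<i> * complex_of_real (v * ((X i \<omega> - m) / s))) = \<i> * complex_of_real (\<Sum>i\<in>J. v * ((X i \<omega> - m) / s))"
      by (simp add: sum_distrib_left)
    also have "(\<Sum>i\<in>J. v * ((X i \<omega> - m) / s)) = v * ((S \<omega> - k * m) / s)"
      using J by (simp add: S_def sum_distrib_left[symmetric] sum_divide_distrib[symmetric] sum_subtractf)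
    finally show ?thesis by (simp add: scaleR_conv_of_real)
  qed
  have prod_int: "integrable M (\<lambda>\<omega>. \<Prod>i\<in>J. Y v (X i \<omega>))"
    and prod_val: "(CLINT \<omega>|M. (\<Prod>i\<in>J. Y v (X i \<omega>))) = Z v ^ k" for v
    using indep_vars_integrable[OF J(1) iY Yint, of v] indep_vars_lebesgue_integral[OF J(1) iY Yint, of v] Yval J(2) by auto
  define d where "d = (\<lambda>\<omega>. exp (t * S \<omega>) / \<Phi> ^ k)"
  have dm[measurable]: "d \<in> borel_measurable M" unfolding d_def by measurable
  have d0: "d \<omega> \<ge> 0" for \<omega> using \<Phi> by (simp add: d_def)
  \<comment> \<open>This gives total mass 1 to the tilted measure, through the product formula at
    \<open>v = 0\<close>.\<close>
  have Z0: "Z 0 = 1"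
  proof -
    have "integrable lborel (\<lambda>z. exp (t * (m + s * z)) * p (m + s * z))"
      using lborel_integrable_real_affine[OF int, of s m] s by simp
    have "Z 0 = (CLINT z|lborel. complex_of_real (s * (exp (t * (m + s * z)) * p (m + s * z) / \<Phi>)))"
      unfolding Z_def using s \<Phi> p_nonneg by (subst char_density) (auto simp: scaleR_conv_of_real)
    also have "\<dots> = complex_of_real (LINT z|lborel. s * (exp (t * (m + s * z)) * p (m + s * z) / \<Phi>))"
      by (rule integral_complex_of_real)
    also have "(LINT z|lborel. s * (exp (t * (m + s * z)) * p (m + s * z) / \<Phi>))
       = s * (LINT z|lborel. exp (t * (m + s * z)) * p (m + s * z)) / \<Phi>"
      by simp
    also have "s * (LINT z|lborel. exp (t * (m + s * z)) * p (m + s * z)) = \<Phi>"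
      unfolding \<Phi>(1) using s by (subst lborel_integral_real_affine[of s _ m]) auto
    finally show ?thesis using \<Phi>(2) by simp
  qed
  have dint: "integrable M d" and dval: "(LINT \<omega>|M. d \<omega>) = 1"
  proof -
    have i: "integrable M (\<lambda>\<omega>. complex_of_real (d \<omega>))" and v: "(CLINT \<omega>|M. complex_of_real (d \<omega>)) = 1"
      using prod_int[of 0] prod_val[of 0] unfolding prodY Z0 by (auto simp: d_def scaleR_conv_of_real)
    show "integrable M d" using integrable_Re[OF i] by simp
    show "(LINT \<omega>|M. d \<omega>) = 1" using v by (simp add: of_real_eq_1_iff)
  qed
  \<comment> \<open>The tilted law lives on the original sample space; under it the standardised sum
    \<open>U\<close> has characteristic function \<open>Z v ^ k\<close>, so no tilted copies of the
    variables have to be constructed.\<close>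
  define D where "D = density M (\<lambda>\<omega>. ennreal (d \<omega>))"
  define U where "U = (\<lambda>\<omega>. (S \<omega> - k * m) / s)"
  have Um[measurable]: "U \<in> borel_measurable M" unfolding U_def by measurable
  have UD[measurable]: "U \<in> borel_measurable D" by (simp add: D_def)
  interpret D: prob_space D
  proof
    have "emeasure D (space D) = (\<integral>\<^sup>+\<omega>. ennreal (d \<omega>) \<partial>M)"
      unfolding D_def by (subst emeasure_density) (auto intro!: nn_integral_cong)
    also have "\<dots> = 1" by (subst nn_integral_eq_integral[OF dint]) (auto simp: d0 dval)
    finally show "emeasure D (space D) = 1" .
  qed
  define R where "R = distr D borel U"
  interpret R: real_distribution R
    unfolding R_def by (rule D.real_distribution_distr) simp
  have charR: "char R v = Z v ^ k" for v
  proof -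
    have "char R v = (CLINT \<omega>|D. iexp (v * U \<omega>))"
      unfolding char_def R_def by (subst integral_distr) auto
    also have "\<dots> = (CLINT \<omega>|M. d \<omega> *\<^sub>R iexp (v * U \<omega>))"
      unfolding D_def by (subst integral_density) (auto simp: d0)
    also have "\<dots> = (CLINT \<omega>|M. (\<Prod>i\<in>J. Y v (X i \<omega>)))"
      unfolding prodY d_def U_def ..
    finally show ?thesis using prod_val by simp
  qed
  have ts: "t * s > 0" using t s by simp
  define \<delta> where "\<delta> = (b - k * m) / s"
  have "integrable lborel (char R)" using Zint by (simp add: charR[abs_def])
  from R.exp_tail_char[OF this ts, of \<delta>]
  have inv: "complex_of_real (LINT z|R. indicator {\<delta>..} z * exp (- (t * s) * (z - \<delta>)))
      = 1 / (2 * pi) * (CLINT v|lborel. Z v ^ k * iexp (- (v * \<delta>)) / (complex_of_real (t * s) + \<i> * v))"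
    by (simp add: charR)
  have "(LINT z|R. indicator {\<delta>..} z * exp (- (t * s) * (z - \<delta>)))
     = (LINT \<omega>|D. indicator {\<delta>..} (U \<omega>) * exp (- (t * s) * (U \<omega> - \<delta>)))"
    unfolding R_def by (subst integral_distr) auto
  also have "\<dots> = (LINT \<omega>|M. d \<omega> * (indicator {\<delta>..} (U \<omega>) * exp (- (t * s) * (U \<omega> - \<delta>))))"
    unfolding D_def by (subst integral_density) (auto simp: d0)
  also have "\<dots> = (LINT \<omega>|M. (exp (t * b) / \<Phi> ^ k) * indicator {\<omega> \<in> space M. b \<le> S \<omega>} \<omega>)"
  proof (rule Bochner_Integration.integral_cong[OF refl])
    fix \<omega> assume \<omega>: "\<omega> \<in> space M"
    have 1: "\<delta> \<le> U \<omega> \<longleftrightarrow> b \<le> S \<omega>" using s by (simp add: \<delta>_def U_def divide_le_cancel)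
    \<comment> \<open>The rate \<open>t * s\<close> of the exponential weight is chosen so that it
      cancels the tilt: on the event the product with \<open>d\<close> is constant, and the untilted
      probability remains.\<close>
    have "(t * s) * (U \<omega> - \<delta>) = t * (S \<omega> - b)"
      using s by (simp add: U_def \<delta>_def diff_divide_distrib[symmetric])
    then have "d \<omega> * exp (- (t * s) * (U \<omega> - \<delta>)) = exp (t * b) / \<Phi> ^ k"
      by (simp add: d_def exp_add[symmetric] algebra_simps)
    then show "d \<omega> * (indicator {\<delta>..} (U \<omega>) * exp (- (t * s) * (U \<omega> - \<delta>)))
       = (exp (t * b) / \<Phi> ^ k) * indicator {\<omega> \<in> space M. b \<le> S \<omega>} \<omega>"
      using 1 \<omega> by (auto simp: indicator_def)
  qed
  also have "\<dots> = exp (t * b) / \<Phi> ^ k * measure M {\<omega> \<in> space M. b \<le> S \<omega>}"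
  proof -
    have *: "{\<omega> \<in> space M. b \<le> S \<omega>} \<inter> space M = {\<omega> \<in> space M. b \<le> S \<omega>}" by auto
    show ?thesis
      by (subst integral_mult_right_zero, subst Bochner_Integration.integral_indicator) (simp only: *)
  qed
  finally have "measure M {\<omega> \<in> space M. b \<le> S \<omega>} = \<Phi> ^ k * exp (- (t * b)) * (LINT z|R. indicator {\<delta>..} z * exp (- (t * s) * (z - \<delta>)))"
    using \<Phi>(2) by (simp add: exp_minus field_simps)
  then show ?thesis
    using inv unfolding S_def \<delta>_def by (simp add: mult_ac)
qed

section \<open>Regular growth of the rate\<close>

text \<open>All that is used of the class \<open>R\<close>. With \<open>t = h x\<close>, the squared width of the density tilted
  by \<open>t\<close> is \<open>1 / h' x = \<psi>'(t)\<close>; the last two clauses say that \<open>\<psi>'\<close> changes by bounded factors when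
  \<open>t\<close> does and that \<open>t\<^sup>2 \<psi>'(t)\<close> tends to infinity.\<close>

definition regular_rate :: "(real \<Rightarrow> real) \<Rightarrow> (real \<Rightarrow> real) \<Rightarrow> real \<Rightarrow> real \<Rightarrow> bool" where
  "regular_rate h h' X C \<longleftrightarrow> X > 0 \<and> C \<ge> 1 \<and>
     (\<forall>x\<ge>X. (h has_real_derivative h' x) (at x) \<and> 0 < h' x \<and> 0 < h x \<and> gen_inverse h (h x) = x) \<and>
     filterlim h at_top at_top \<and>
     (\<forall>x\<ge>X. \<forall>x'\<ge>X. h x / 2 \<le> h x' \<longrightarrow> h x' \<le> 2 * h x \<longrightarrow> h' x' \<le> C * h' x) \<and>
     filterlim (\<lambda>x. (h x)\<^sup>2 / h' x) at_top at_top"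

section \<open>The inverse of a regular rate\<close>

lemma regular_rate_strict_mono:
  assumes "regular_rate h h' X C" "X \<le> x" "x < y"
  shows "h x < h y"
proof (rule DERIV_pos_imp_increasing[OF assms(3)])
  fix z assume "x \<le> z" "z \<le> y"
  then have "X \<le> z" using assms(2) by simp
  then show "\<exists>D. (h has_real_derivative D) (at z) \<and> 0 < D"
    using assms(1) unfolding regular_rate_def by blast
qed

text \<open>\<open>gen_inverse\<close> is only known to undo \<open>h\<close> at arguments beyond
  \<open>X\<close>. Since every value above \<open>h X\<close> is attained there, it is a two-sided
  inverse for such values, and the inverse function rule applies.\<close>

lemma regular_rate_inverse:
  assumes R: "regular_rate h h' X C" and t: "h X < t"
  shows "X < gen_inverse h t" "h (gen_inverse h t) = t" "deriv (gen_inverse h) t = 1 / h' (gen_inverse h t)"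
proof -
  have Rd: "(h has_real_derivative h' x) (at x)" and Rp: "0 < h' x" and Ri: "gen_inverse h (h x) = x" if "x \<ge> X" for x
    using R that unfolding regular_rate_def by blast+
  have Rl: "filterlim h at_top at_top" using R unfolding regular_rate_def by blast
  have ex: "\<exists>x>X. h x = y" if "h X < y" for y
  proof -
    have "eventually (\<lambda>x. y \<le> h x) at_top" using Rl by (simp add: filterlim_at_top)
    then obtain b0 where b0: "\<And>x. x \<ge> b0 \<Longrightarrow> y \<le> h x" by (auto simp: eventually_at_top_linorder)
    define b where "b = max b0 X"
    have "\<exists>x\<ge>X. x \<le> b \<and> h x = y"
      using that b0[of b] by (intro IVT) (auto simp: b_def intro: DERIV_isCont[OF Rd])
    then obtain x where "x \<ge> X" "h x = y" by blast
    moreover have "x \<noteq> X" using calculation that by auto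
    ultimately show ?thesis by (intro exI[of _ x]) simp
  qed
  have inv: "X < gen_inverse h y" "h (gen_inverse h y) = y" if hy: "h X < y" for y
  proof -
    obtain x where x: "x > X" "h x = y" using ex[OF hy] by blast
    then have "gen_inverse h y = x" using Ri[of x] by simp
    then show "X < gen_inverse h y" "h (gen_inverse h y) = y" using x by simp_all
  qed
  show xt: "X < gen_inverse h t" "h (gen_inverse h t) = t" using inv[OF t] .
  define x where "x = gen_inverse h t"
  have x: "X < x" "h x = t" using xt by (auto simp: x_def)
  have "isCont (gen_inverse h) (h x)"
  proof (rule isCont_inverse_function[where d = "(x - X) / 2" and f = h])
    show "0 < (x - X) / 2" using x by simp
    fix z assume z: "\<bar>z - x\<bar> \<le> (x - X) / 2"
    have "x - z \<le> \<bar>z - x\<bar>" by arith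
    also note z
    finally have "z \<ge> X" using x(1) by (simp add: field_simps)
    then show "gen_inverse h (h z) = z" "isCont h z" using Ri DERIV_isCont[OF Rd] by auto
  qed
  then have ic: "isCont (gen_inverse h) t" using x by simp
  have "DERIV (gen_inverse h) t :> inverse (h' x)"
  proof (rule DERIV_inverse_function[of h _ _ _ "h X" "t + 1"])
    show "DERIV h (gen_inverse h t) :> h' x" using Rd[of x] x by (simp add: x_def)
    show "h' x \<noteq> 0" using Rp[of x] x by simp
  qed (use ic t inv in auto)
  then show "deriv (gen_inverse h) t = 1 / h' (gen_inverse h t)"
    unfolding x_def by (simp add: DERIV_imp_deriv inverse_eq_divide)
qed

section \<open>Regular growth in the two classes\<close>

lemma R0_rep_deriv:
  assumes "R0_rep l \<epsilon> \<epsilon>1 \<epsilon>2" and x: "x > 1"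
  shows "(l has_real_derivative l x * \<epsilon> x / x) (at x)" and "(\<epsilon> has_real_derivative \<epsilon>1 x) (at x)"
proof -
  note R = assms(1)[unfolded R0_rep_def]
  have at1: "at x within {1..} = at x" using x by (intro at_within_interior) auto
  have Rd: "(\<epsilon> has_real_derivative \<epsilon>1 x) (at x within {1..})" if "x \<ge> 1" for x using R that by blast
  have Rl: "l x = exp (integral {1..x} (\<lambda>u. \<epsilon> u / u))" if "x \<ge> 1" for x using R that by blast
  show "(\<epsilon> has_real_derivative \<epsilon>1 x) (at x)" using Rd[of x] x unfolding at1 by simp
  have c: "continuous_on {1..} \<epsilon>"
    unfolding continuous_on_eq_continuous_within by (auto intro: DERIV_continuous[OF Rd])
  have "continuous_on {1..x + 1} (\<lambda>u. \<epsilon> u / u)"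
    by (intro continuous_intros continuous_on_subset[OF c]) auto
  from integral_has_real_derivative[OF this, of x]
  have "((\<lambda>y. integral {1..y} (\<lambda>u. \<epsilon> u / u)) has_real_derivative \<epsilon> x / x) (at x within {1..x + 1})"
    using x by auto
  moreover have "at x within {1..x + 1} = at x" using x by (intro at_within_interior) auto
  ultimately have "((\<lambda>y. exp (integral {1..y} (\<lambda>u. \<epsilon> u / u))) has_real_derivative
      exp (integral {1..x} (\<lambda>u. \<epsilon> u / u)) * (\<epsilon> x / x)) (at x)"
    by (simp only:) (rule DERIV_fun_exp)
  then have "((\<lambda>y. exp (integral {1..y} (\<lambda>u. \<epsilon> u / u))) has_real_derivative l x * \<epsilon> x / x) (at x)"
    using Rl[of x] x by simp
  then show "(l has_real_derivative l x * \<epsilon> x / x) (at x)"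
    by (rule has_field_derivative_transform_within_open[of _ _ _ "{1<..}"]) (use Rl x in auto)
qed

text \<open>The logarithmic derivative of \<open>h\<close> is
  \<open>(\<beta> + \<epsilon> x) / x\<close>, eventually between \<open>\<beta> / (2 * x)\<close>
  and \<open>3 * \<beta> / (2 * x)\<close>. So \<open>h x\<close> times
  \<open>x powr (- (\<beta> / 2))\<close> increases, and a factor 2 in \<open>h\<close> bounds the
  ratio of the arguments by \<open>2 powr (2 / \<beta>)\<close>, which bounds the change of
  \<open>h'\<close>. Moreover \<open>h' <= h\<close> for large arguments, so
  \<open>h\<^sup>2 / h'\<close> is at least \<open>h\<close>.\<close>

lemma regular_rate_R_beta:
  assumes h: "h \<in> R_beta \<beta>" and \<beta>: "\<beta> > 0" and bdd: "\<And>b. bdd_above (h ` {0<..b})"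
  shows "\<exists>h' X C. regular_rate h h' X C"
proof -
  obtain l \<epsilon> \<epsilon>1 \<epsilon>2 where R: "R0_rep l \<epsilon> \<epsilon>1 \<epsilon>2" and hl: "\<forall>\<^sub>F x in at_top. h x = x powr \<beta> * l x"
    using h unfolding R_beta_def by blast
  have e0: "(\<epsilon> \<longlongrightarrow> 0) at_top" and Rl: "\<And>x. x \<ge> 1 \<Longrightarrow> l x = exp (integral {1..x} (\<lambda>u. \<epsilon> u / u))"
    using R unfolding R0_rep_def by blast+
  have "\<forall>\<^sub>F x in at_top. \<bar>\<epsilon> x\<bar> < \<beta> / 2"
    using e0 \<beta> tendstoD[of \<epsilon> 0 at_top "\<beta> / 2"] by (auto simp: dist_real_def)
  with hl have "\<forall>\<^sub>F x in at_top. h x = x powr \<beta> * l x \<and> \<bar>\<epsilon> x\<bar> < \<beta> / 2" by (rule eventually_conj)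
  then obtain X0 where X0: "\<And>x. x \<ge> X0 \<Longrightarrow> h x = x powr \<beta> * l x" "\<And>x. x \<ge> X0 \<Longrightarrow> \<bar>\<epsilon> x\<bar> < \<beta> / 2"
    unfolding eventually_at_top_linorder by blast
  define X1 where "X1 = max X0 1 + 1"
  define h' where "h' = (\<lambda>x. h x * (\<beta> + \<epsilon> x) / x)"
  have X1: "X1 > 1" by (simp add: X1_def)
  have \<epsilon>: "\<bar>\<epsilon> x\<bar> < \<beta> / 2" if "x \<ge> X1" for x using X0(2)[of x] that by (auto simp: X1_def)
  have lpos: "l x > 0" if "x \<ge> 1" for x using Rl[OF that] by simp
  have hpos: "h x > 0" if "x \<ge> X1" for x
  proof -
    have "h x = x powr \<beta> * l x" "x \<ge> 1" using X0(1)[of x] that by (auto simp: X1_def)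
    then show ?thesis using lpos[of x] by simp
  qed
  have hd: "(h has_real_derivative h' x) (at x)" if "x \<ge> X1" for x
  proof -
    have x: "x > 1" "x > X0" using that by (auto simp: X1_def)
    have "((\<lambda>x. x powr \<beta> * l x) has_real_derivative \<beta> * x powr (\<beta> - 1) * l x + (l x * \<epsilon> x / x) * x powr \<beta>) (at x)"
      using x by (intro DERIV_mult R0_rep_deriv(1)[OF R] has_real_derivative_powr) auto
    moreover have "\<beta> * x powr (\<beta> - 1) * l x + (l x * \<epsilon> x / x) * x powr \<beta> = h' x"
      using x X0(1)[of x] by (simp add: h'_def powr_diff field_simps)
    ultimately have "((\<lambda>x. x powr \<beta> * l x) has_real_derivative h' x) (at x)" by metis
    then show ?thesis
      by (rule has_field_derivative_transform_within_open[of _ _ _ "{X0<..}"]) (use x X0(1) in auto)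
  qed
  have h'pos: "h' x > 0" if "x \<ge> X1" for x
    using that hpos[OF that] \<epsilon>[OF that] X1 \<beta> by (auto simp: h'_def abs_less_iff intro!: divide_pos_pos mult_pos_pos)
  have mono: "h x < h y" if "X1 \<le> x" "x < y" for x y
  proof (rule DERIV_pos_imp_increasing[OF that(2)])
    fix z assume "x \<le> z" "z \<le> y"
    then show "\<exists>D. (h has_real_derivative D) (at z) \<and> 0 < D"
      using hd[of z] h'pos[of z] that by (intro exI[of _ "h' z"]) auto
  qed
  have ratio: "h x * (y / x) powr (\<beta> / 2) \<le> h y" if "X1 \<le> x" "x \<le> y" for x y
  proof -
    have "h x * x powr (- (\<beta> / 2)) \<le> h y * y powr (- (\<beta> / 2))"
    proof (rule DERIV_nonneg_imp_nondecreasing[OF that(2)])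
      fix z assume z: "x \<le> z" "z \<le> y"
      then have z1: "z \<ge> X1" "z > 0" using that X1 by auto
      have "((\<lambda>x. h x * x powr (- (\<beta> / 2))) has_real_derivative
          h' z * z powr (- (\<beta> / 2)) + (- (\<beta> / 2) * z powr (- (\<beta> / 2) - 1)) * h z) (at z)"
        using z1 by (intro DERIV_mult hd has_real_derivative_powr) auto
      moreover have "h' z * z powr (- (\<beta> / 2)) + (- (\<beta> / 2) * z powr (- (\<beta> / 2) - 1)) * h z
         = h z * z powr (- (\<beta> / 2)) / z * (\<beta> / 2 + \<epsilon> z)"
      proof -
        have "z powr (- (\<beta> / 2) - 1) = z powr (- (\<beta> / 2)) / z" using z1 by (simp only: powr_diff) simp
        then show ?thesis using z1 by (simp only: h'_def) (simp add: divide_simps, simp add: algebra_simps)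
      qed
      moreover have "h z * z powr (- (\<beta> / 2)) / z * (\<beta> / 2 + \<epsilon> z) \<ge> 0"
        using z1 hpos[of z] \<epsilon>[of z] by (intro mult_nonneg_nonneg) (auto simp: abs_less_iff)
      ultimately show "\<exists>D. ((\<lambda>x. h x * x powr (- (\<beta> / 2))) has_real_derivative D) (at z) \<and> 0 \<le> D" by metis
    qed
    then have "h x * x powr (- (\<beta> / 2)) * y powr (\<beta> / 2) \<le> h y * y powr (- (\<beta> / 2)) * y powr (\<beta> / 2)"
      by (rule mult_right_mono) simp
    moreover have xy: "x > 0" "y > 0" using that X1 by auto
    moreover have "(y / x) powr (\<beta> / 2) = x powr (- (\<beta> / 2)) * y powr (\<beta> / 2)"
      using xy powr_divide[of y x "\<beta> / 2"] powr_minus_divide[of x "\<beta> / 2"] by simp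
    moreover have "y powr (- (\<beta> / 2)) * y powr (\<beta> / 2) = 1"
      using xy by (simp add: powr_add[symmetric])
    ultimately show ?thesis by (simp add: mult.assoc)
  qed
  have hlim: "filterlim h at_top at_top"
  proof (rule filterlim_at_top_mono)
    show "filterlim (\<lambda>y. h X1 * (y / X1) powr (\<beta> / 2)) at_top at_top"
    proof -
      have "h X1 > 0" "X1 > 0" using hpos[of X1] X1 by auto
      moreover have "filterlim (\<lambda>y. c * (y / k) powr (\<beta> / 2)) at_top at_top" if "c > 0" "k > 0" for c k :: real
        using that \<beta> by real_asymp
      ultimately show ?thesis by blast
    qed
    show "\<forall>\<^sub>F y in at_top. h X1 * (y / X1) powr (\<beta> / 2) \<le> h y"
      using eventually_ge_at_top[of X1] by (rule eventually_mono) (auto intro: ratio)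
  qed
  \<comment> \<open>Beyond a suitable \<open>X2\<close> the values of \<open>h\<close> exceed all
    those on \<open>(0, X1]\<close>; hence the infimum in \<open>gen_inverse\<close> only sees the
    range where \<open>h\<close> increases.\<close>
  obtain Bd where Bd: "\<And>x. 0 < x \<Longrightarrow> x \<le> X1 \<Longrightarrow> h x \<le> Bd"
  proof -
    obtain Bd where "\<And>z. z \<in> h ` {0<..X1} \<Longrightarrow> z \<le> Bd" using bdd[of X1] unfolding bdd_above_def by blast
    then show ?thesis using that[of Bd] by simp
  qed
  have "\<forall>\<^sub>F x in at_top. h x > Bd" using hlim unfolding filterlim_at_top_dense by blast
  then obtain X2 where X2: "\<And>x. x \<ge> X2 \<Longrightarrow> h x > Bd" unfolding eventually_at_top_linorder by blast
  define X where "X = max X1 X2"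
  \<comment> \<open>A factor 2 from \<open>h\<close>, 3 from \<open>\<beta> + \<epsilon>\<close>,
    and \<open>2 powr (2 / \<beta>)\<close> from the ratio of the arguments.\<close>
  define C where "C = 6 * 2 powr (2 / \<beta>)"
  have inv: "gen_inverse h (h x) = x" if "x \<ge> X" for x
  proof -
    have "{x'. 0 < x' \<and> h x \<le> h x'} = {x..}"
    proof (intro equalityI subsetI)
      fix x' assume x': "x' \<in> {x'. 0 < x' \<and> h x \<le> h x'}"
      have "Bd < h x" using X2[of x] that by (simp add: X_def)
      then have "\<not> x' \<le> X1" using Bd[of x'] x' by fastforce
      then have "x' < x \<Longrightarrow> h x' < h x" using mono[of x' x] by simp
      then show "x' \<in> {x..}" using x' by fastforce
    next
      fix x' assume x': "x' \<in> {x..}"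
      moreover have "X1 \<le> x" using that by (simp add: X_def)
      ultimately have "0 < x'" "h x \<le> h x'" using mono[of x x'] X1 by (cases "x' = x"; simp)+
      then show "x' \<in> {x'. 0 < x' \<and> h x \<le> h x'}" by simp
    qed
    then show ?thesis unfolding gen_inverse_def by simp
  qed
  have comp: "h' x' \<le> C * h' x" if x: "x \<ge> X" "x' \<ge> X" "h x / 2 \<le> h x'" "h x' \<le> 2 * h x" for x x'
  proof -
    have x1: "x \<ge> X1" "x' \<ge> X1" "x > 0" "x' > 0" using x X1 by (auto simp: X_def)
    have xx: "x / x' \<le> 2 powr (2 / \<beta>)"
    proof (cases "x' \<le> x")
      case True
      have "h x' * (x / x') powr (\<beta> / 2) \<le> h x' * 2"
        using ratio[OF x1(2) True] x(3) by simp
      then have "(x / x') powr (\<beta> / 2) \<le> 2" using hpos[OF x1(2)] by simp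
      then have "((x / x') powr (\<beta> / 2)) powr (2 / \<beta>) \<le> 2 powr (2 / \<beta>)"
        using \<beta> by (intro powr_mono2) auto
      then show ?thesis using \<beta> x1 by (simp add: powr_powr)
    next
      case False
      then have "x / x' \<le> 1" using x1 by simp
      also have "\<dots> \<le> 2 powr (2 / \<beta>)" using \<beta> by (intro ge_one_powr_ge_zero) auto
      finally show ?thesis .
    qed
    have "h' x' = h x' * ((\<beta> + \<epsilon> x') / x')" by (simp add: h'_def)
    also have "\<dots> \<le> (2 * h x) * ((3 * (\<beta> + \<epsilon> x)) * (2 powr (2 / \<beta>) / x))"
    proof (intro mult_mono x(4))
      have "1 / x' \<le> 2 powr (2 / \<beta>) / x" using xx x1 by (simp add: field_simps)
      moreover have "\<beta> + \<epsilon> x' \<le> 3 * (\<beta> + \<epsilon> x)" "0 \<le> \<beta> + \<epsilon> x"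
        using \<epsilon>[OF x1(1)] \<epsilon>[OF x1(2)] \<beta> by (auto simp: abs_less_iff)
      ultimately have "(\<beta> + \<epsilon> x') * (1 / x') \<le> (3 * (\<beta> + \<epsilon> x)) * (2 powr (2 / \<beta>) / x)"
        using x1 by (intro mult_mono) auto
      then show "(\<beta> + \<epsilon> x') / x' \<le> (3 * (\<beta> + \<epsilon> x)) * (2 powr (2 / \<beta>) / x)" by simp
    qed (use hpos[OF x1(1)] \<epsilon>[OF x1(2)] \<beta> x1 in \<open>auto simp: abs_less_iff\<close>)
    also have "\<dots> = C * h' x" by (simp add: C_def h'_def)
    finally show ?thesis .
  qed
  have lim: "filterlim (\<lambda>x. (h x)\<^sup>2 / h' x) at_top at_top"
  proof (rule filterlim_at_top_mono[OF hlim])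
    show "\<forall>\<^sub>F x in at_top. h x \<le> (h x)\<^sup>2 / h' x"
      using eventually_ge_at_top[of "max X1 (2 * \<beta>)"]
    proof (rule eventually_mono)
      fix x assume x: "max X1 (2 * \<beta>) \<le> x"
      have "\<beta> + \<epsilon> x \<le> x" using \<epsilon>[of x] x \<beta> by (auto simp: abs_less_iff)
      then have "h x * (\<beta> + \<epsilon> x) \<le> h x * x" using hpos[of x] x by (intro mult_left_mono) auto
      moreover have "0 < x" using x X1 by simp
      ultimately have "h' x \<le> h x" by (simp only: h'_def pos_divide_le_eq)
      then show "h x \<le> (h x)\<^sup>2 / h' x"
        using mult_left_mono[of "h' x" "h x" "h x"] h'pos[of x] hpos[of x] x
        by (simp only: pos_le_divide_eq power2_eq_square max.bounded_iff less_imp_le)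
    qed
  qed
  have "C \<ge> 6 * 1" unfolding C_def using \<beta> by (intro mult_left_mono ge_one_powr_ge_zero) auto
  then have "regular_rate h h' X C"
    unfolding regular_rate_def
  proof (intro conjI allI impI)
    fix x assume "X \<le> x"
    then have "X1 \<le> x" by (simp add: X_def)
    then show "(h has_real_derivative h' x) (at x)" "0 < h' x" "0 < h x" by (fact hd h'pos hpos)+
    show "gen_inverse h (h x) = x" by (rule inv) fact
  next
    show "0 < X" "1 \<le> C" using X1 \<open>C \<ge> 6 * 1\<close> by (simp_all add: X_def)
  next
    fix x x' assume "X \<le> x" "X \<le> x'" "h x / 2 \<le> h x'" "h x' \<le> 2 * h x"
    then show "h' x' \<le> C * h' x" by (rule comp)
  qed (use hlim lim in simp_all)
  then show ?thesis by blast
qed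

text \<open>Here the representation belongs to the inverse: \<open>\<psi>' = d\<close> with
  \<open>d u = \<psi> u * \<epsilon> u / u\<close>, and \<open>h' x = 1 / d (h x)\<close>. The
  condition on \<open>\<epsilon>1\<close> makes \<open>u * \<epsilon> u\<close> increase and
  \<open>\<epsilon> u / u\<close> decrease, which compares \<open>d\<close> at arguments within a
  factor 2. With \<open>u = h x\<close>, the quotient \<open>(h x)\<^sup>2 / h' x\<close> is
  \<open>u * \<epsilon> u * \<psi> u\<close>, and the lower bound on \<epsilon> makes it at least a
  constant times \<open>u powr (1 - \<eta>)\<close>.\<close>

lemma regular_rate_R_infinity:
  assumes h: "h \<in> R_infinity"
  shows "\<exists>h' X C. regular_rate h h' X C"
proof -
  define \<psi> where "\<psi> = gen_inverse h"
  have sm: "\<And>x y. 0 < x \<Longrightarrow> x < y \<Longrightarrow> h x < h y"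
    using h by (auto simp: R_infinity_def strict_mono_on_def)
  obtain \<epsilon> \<epsilon>1 \<epsilon>2 \<eta> where R: "R0_rep \<psi> \<epsilon> \<epsilon>1 \<epsilon>2" and lim: "filterlim \<psi> at_top at_top"
    and e1: "((\<lambda>x. x * \<epsilon>1 x / \<epsilon> x) \<longlongrightarrow> 0) at_top"
    and \<eta>: "0 < \<eta>" "\<eta> < 1/4" "Liminf at_top (\<lambda>x. ereal (x powr \<eta> * \<epsilon> x)) > 0"
    using h unfolding R_infinity_def R0_tilde_def \<psi>_def by auto
  have e0: "(\<epsilon> \<longlongrightarrow> 0) at_top" using R unfolding R0_rep_def by blast
  have inv: "\<psi> (h x) = x" if "x > 0" for x
  proof -
    have "{x'. 0 < x' \<and> h x \<le> h x'} = {x..}"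
    proof (intro equalityI subsetI)
      fix x' assume "x' \<in> {x'. 0 < x' \<and> h x \<le> h x'}"
      then show "x' \<in> {x..}" using sm[of x' x] by force
    next
      fix x' assume "x' \<in> {x..}"
      then show "x' \<in> {x'. 0 < x' \<and> h x \<le> h x'}"
        using sm[of x x'] that by (cases "x' = x") auto
    qed
    then show ?thesis unfolding \<psi>_def gen_inverse_def by simp
  qed
  obtain c where c: "c > 0" "\<forall>\<^sub>F x in at_top. c < x powr \<eta> * \<epsilon> x"
  proof -
    obtain c where "ereal 0 < ereal c" "ereal c < Liminf at_top (\<lambda>x. ereal (x powr \<eta> * \<epsilon> x))"
      using \<eta>(3) ereal_dense2 by (metis zero_ereal_def)
    then show ?thesis using less_LiminfD[of "ereal c" at_top] that by fastforce
  qed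
  have ev: "\<forall>\<^sub>F x in at_top. c < x powr \<eta> * \<epsilon> x \<and> \<bar>x * \<epsilon>1 x / \<epsilon> x\<bar> < 1 \<and> \<bar>\<epsilon> x\<bar> < 1 \<and> 1 \<le> \<psi> x"
    using c(2) tendstoD[OF e1, of 1] e0 tendstoD[of \<epsilon> 0 at_top 1] lim
    by (intro eventually_conj) (auto simp: filterlim_at_top)
  then obtain U0 where U0: "\<And>x. x \<ge> U0 \<Longrightarrow> c < x powr \<eta> * \<epsilon> x \<and> \<bar>x * \<epsilon>1 x / \<epsilon> x\<bar> < 1 \<and> \<bar>\<epsilon> x\<bar> < 1 \<and> 1 \<le> \<psi> x"
    unfolding eventually_at_top_linorder by blast
  define U where "U = max U0 1 + 1"
  have U: "U > 1" by (simp add: U_def)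
  have \<epsilon>: "0 < \<epsilon> u" "\<epsilon> u < 1" "\<bar>u * \<epsilon>1 u\<bar> < \<epsilon> u" "c < u powr \<eta> * \<epsilon> u" "1 \<le> \<psi> u" if "u \<ge> U" for u
  proof -
    have u: "u > 1" "u \<ge> U0" using that by (auto simp: U_def)
    note * = U0[OF u(2)]
    show "c < u powr \<eta> * \<epsilon> u" "1 \<le> \<psi> u" "\<epsilon> u < 1" using * by auto
    have "0 < u powr \<eta> * \<epsilon> u" using * c(1) by linarith
    then show "0 < \<epsilon> u" using u by (simp add: zero_less_mult_iff)
    then show "\<bar>u * \<epsilon>1 u\<bar> < \<epsilon> u" using * by (simp add: abs_divide)
  qed
  define d where "d = (\<lambda>u. \<psi> u * \<epsilon> u / u)"
  have \<psi>d: "(\<psi> has_real_derivative d u) (at u)" if "u > 1" for u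
    using R0_rep_deriv(1)[OF R that] by (simp add: d_def)
  have dpos: "d u > 0" if "u \<ge> U" for u
    using \<epsilon>[OF that] that U by (simp add: d_def)
  have \<psi>mono: "\<psi> u < \<psi> v" if "U \<le> u" "u < v" for u v
  proof (rule DERIV_pos_imp_increasing[OF that(2)])
    fix z assume "u \<le> z" "z \<le> v"
    then show "\<exists>D. (\<psi> has_real_derivative D) (at z) \<and> 0 < D"
      using \<psi>d[of z] dpos[of z] that U by (intro exI[of _ "d z"]) auto
  qed
  \<comment> \<open>For bounded \<open>h\<close> and large \<open>u\<close> the set defining \<psi>
    is empty, so \<psi> would be the fixed number \<open>Inf {}\<close> there and could not tend to
    infinity.\<close>
  have unb: "\<exists>x>0. h x > B" for B
  proof (rule ccontr)
    assume "\<not> (\<exists>x>0. B < h x)"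
    then have "\<psi> u = Inf {}" if "u > B" for u
      unfolding \<psi>_def gen_inverse_def using that by (intro arg_cong[where f=Inf]) force
    then have "\<forall>\<^sub>F u in at_top. \<psi> u = Inf {}"
      using eventually_gt_at_top[of B] by (rule eventually_mono[rotated])
    moreover have "\<forall>\<^sub>F u in at_top. \<psi> u > Inf {}" using lim by (simp add: filterlim_at_top_dense)
    ultimately have "\<forall>\<^sub>F u :: real in at_top. False" by eventually_elim simp
    then show False by simp
  qed
  obtain X0 where X0: "X0 > 0" "h X0 > U" using unb by blast
  define X where "X = X0 + 1"
  have hX0: "h x > U" if "x \<ge> X0" for x
    using X0 sm[of X0 x] that by (cases "x = X0") auto
  have inv2: "h (\<psi> u) = u" if "u > h X0" for u
  proof -
    have uU: "u > U" using that X0 by simp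
    have "\<psi> (h X0) < \<psi> u" using X0 that by (intro \<psi>mono) auto
    then have x: "\<psi> u > X0" using inv X0 by simp
    have "h (\<psi> u) > U" using hX0 x by simp
    moreover have "\<psi> (h (\<psi> u)) = \<psi> u" using x X0 by (intro inv) simp
    ultimately show ?thesis using \<psi>mono[of u "h (\<psi> u)"] \<psi>mono[of "h (\<psi> u)" u] uU
      by (cases u "h (\<psi> u)" rule: linorder_cases) auto
  qed
  define h' where "h' = (\<lambda>x. inverse (d (h x)))"
  have hXX: "h x > h X0" if "x \<ge> X" for x using sm[of X0 x] X0 that by (simp add: X_def)
  have hd: "(h has_real_derivative h' x) (at x)" if x: "x \<ge> X" for x
  proof -
    have "isCont h (\<psi> (h x))"
    proof (rule isCont_inverse_function[where d = "(h x - h X0) / 2" and f = \<psi>])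
      show "(h x - h X0) / 2 > 0" using hXX[OF x] by simp
      fix z assume z0: "\<bar>z - h x\<bar> \<le> (h x - h X0) / 2"
      have "h x - z \<le> \<bar>z - h x\<bar>" by arith
      also note z0
      finally have z: "z > h X0" using hXX[OF x] by (simp add: field_simps)
      then show "h (\<psi> z) = z" by (rule inv2)
      show "isCont \<psi> z" using z X0 U by (intro DERIV_isCont[OF \<psi>d]) simp
    qed
    then have "isCont h x" using inv[of x] x X0 by (simp add: X_def)
    moreover have "h x > U" using hX0[of x] x by (simp add: X_def)
    moreover have "d (h x) \<noteq> 0" using dpos[of "h x"] \<open>h x > U\<close> by simp
    ultimately show ?thesis
      unfolding h'_def using U x X0
      by (intro DERIV_inverse_function[of \<psi> _ _ _ 0 "x + 1"] \<psi>d) (auto simp: inv X_def)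
  qed
  have hlim: "filterlim h at_top at_top"
    unfolding filterlim_at_top
  proof
    fix Z
    obtain x where "x > 0" "h x > Z" using unb by blast
    then have "Z \<le> h y" if "y \<ge> x" for y using sm[of x y] that by (cases "y = x") auto
    then show "\<forall>\<^sub>F x in at_top. Z \<le> h x" by (auto simp: eventually_at_top_linorder)
  qed
  have mono1: "u * \<epsilon> u \<le> v * \<epsilon> v" if "U \<le> u" "u \<le> v" for u v
  proof (rule DERIV_nonneg_imp_nondecreasing[OF that(2)])
    fix z assume z: "u \<le> z" "z \<le> v"
    have "((\<lambda>z. z * \<epsilon> z) has_real_derivative 1 * \<epsilon> z + \<epsilon>1 z * z) (at z)"
      using z that U by (intro DERIV_mult DERIV_ident R0_rep_deriv(2)[OF R]) auto
    moreover have "0 \<le> 1 * \<epsilon> z + \<epsilon>1 z * z" using \<epsilon>(3)[of z] z that by (simp add: abs_less_iff mult.commute)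
    ultimately show "\<exists>D. ((\<lambda>z. z * \<epsilon> z) has_real_derivative D) (at z) \<and> 0 \<le> D" by blast
  qed
  have mono2: "\<epsilon> v / v \<le> \<epsilon> u / u" if "U \<le> u" "u \<le> v" for u v
  proof (rule DERIV_nonpos_imp_nonincreasing[OF that(2)])
    fix z assume z: "u \<le> z" "z \<le> v"
    have "((\<lambda>z. \<epsilon> z / z) has_real_derivative (\<epsilon>1 z * z - \<epsilon> z * 1) / (z * z)) (at z)"
      using z that U by (intro DERIV_divide DERIV_ident R0_rep_deriv(2)[OF R]) auto
    moreover have "(\<epsilon>1 z * z - \<epsilon> z * 1) / (z * z) \<le> 0"
      using \<epsilon>(3)[of z] z that by (intro divide_nonpos_nonneg) (auto simp: abs_less_iff mult.commute)
    ultimately show "\<exists>D. ((\<lambda>z. \<epsilon> z / z) has_real_derivative D) (at z) \<and> D \<le> 0" by blast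
  qed
  have mono3: "\<psi> v / v \<le> \<psi> u / u" if "U \<le> u" "u \<le> v" for u v
  proof (rule DERIV_nonpos_imp_nonincreasing[OF that(2)])
    fix z assume z: "u \<le> z" "z \<le> v"
    have z1: "z > 1" "z \<ge> U" using z that U by auto
    have "((\<lambda>z. \<psi> z / z) has_real_derivative (d z * z - \<psi> z * 1) / (z * z)) (at z)"
      using z1 by (intro DERIV_divide DERIV_ident \<psi>d) auto
    moreover have "(d z * z - \<psi> z * 1) / (z * z) \<le> 0"
      using \<epsilon>[OF z1(2)] z1 by (intro divide_nonpos_nonneg) (auto simp: d_def mult_le_cancel_left1)
    ultimately show "\<exists>D. ((\<lambda>z. \<psi> z / z) has_real_derivative D) (at z) \<and> D \<le> 0" by blast
  qed
  \<comment> \<open>For \<open>u <= v\<close> both \<psi> and \<open>u * \<epsilon> u\<close>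
    increase and only \<open>1 / u\<^sup>2\<close> is lost, a factor 4. For \<open>v < u\<close>
    both \<open>\<psi> u / u\<close> and \<open>\<epsilon> u / u\<close> decrease, and the loss is a
    factor 2.\<close>
  have dcomp: "d u \<le> 4 * d v" if uv: "u \<ge> U" "v \<ge> U" "u / 2 \<le> v" "v \<le> 2 * u" for u v
  proof -
    have p: "u > 0" "v > 0" "\<psi> u > 0" "\<psi> v > 0" "\<epsilon> u > 0" "\<epsilon> v > 0"
      using U uv \<epsilon>(1,5)[of u] \<epsilon>(1,5)[of v] by auto
    show ?thesis
    proof (cases "u \<le> v")
      case True
      have "\<psi> u \<le> \<psi> v" using \<psi>mono[of u v] True uv by (cases "u = v") auto
      have "d u = \<psi> u * (u * \<epsilon> u) * (1 / u\<^sup>2)" using p by (simp add: d_def power2_eq_square)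
      also have "\<dots> \<le> \<psi> v * (v * \<epsilon> v) * (4 / v\<^sup>2)"
      proof (rule mult_mono[OF mult_mono[OF \<open>\<psi> u \<le> \<psi> v\<close> mono1[OF uv(1) True]]])
        have "v\<^sup>2 \<le> (2 * u)\<^sup>2" using uv p by (intro power_mono) auto
        then show "1 / u\<^sup>2 \<le> 4 / v\<^sup>2" using p by (simp add: field_simps power_mult_distrib)
      qed (use p in auto)
      also have "\<dots> = 4 * d v" using p by (simp add: d_def power2_eq_square)
      finally show ?thesis .
    next
      case False
      have "\<psi> u \<le> \<psi> v * (u / v)" using mono3[of v u] False uv p by (simp add: field_simps)
      also have "\<dots> \<le> \<psi> v * 2" using uv p by (intro mult_left_mono) (auto simp: field_simps)
      finally have "\<psi> u * (\<epsilon> u / u) \<le> (\<psi> v * 2) * (\<epsilon> v / v)"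
        using mono2[of v u] False uv p by (intro mult_mono) auto
      moreover have "0 < d v" using dpos uv by simp
      ultimately show ?thesis by (simp add: d_def)
    qed
  qed
  have comp: "h' x' \<le> 4 * h' x" if x: "x \<ge> X" "x' \<ge> X" "h x / 2 \<le> h x'" "h x' \<le> 2 * h x" for x x'
  proof -
    have u: "h x > U" "h x' > U" using hX0 x by (auto simp: X_def)
    have "d (h x) \<le> 4 * d (h x')" using u x by (intro dcomp) auto
    moreover have "d (h x) > 0" "d (h x') > 0" using dpos u by auto
    ultimately show ?thesis by (simp add: h'_def field_simps)
  qed
  have lim2: "filterlim (\<lambda>x. (h x)\<^sup>2 / h' x) at_top at_top"
  proof (rule filterlim_at_top_mono)
    have "filterlim (\<lambda>u. c * u powr (1 - \<eta>)) at_top at_top" using c(1) \<eta> by real_asymp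
    then show "filterlim (\<lambda>x. c * h x powr (1 - \<eta>)) at_top at_top"
      by (rule filterlim_compose[OF _ hlim])
    show "\<forall>\<^sub>F x in at_top. c * h x powr (1 - \<eta>) \<le> (h x)\<^sup>2 / h' x"
      using eventually_ge_at_top[of X]
    proof (rule eventually_mono)
      fix x assume "X \<le> x"
      define u where "u = h x"
      have u: "u \<ge> U" "u > 0" using hX0[of x] \<open>X \<le> x\<close> U by (auto simp: X_def u_def)
      have "c * u powr (1 - \<eta>) \<le> (u powr \<eta> * \<epsilon> u) * u powr (1 - \<eta>)"
        using \<epsilon>(4)[OF u(1)] by (intro mult_right_mono) auto
      also have "\<dots> = (u powr \<eta> * u powr (1 - \<eta>)) * \<epsilon> u" by simp
      also have "\<dots> = u * \<epsilon> u * 1" using u by (simp add: powr_add[symmetric])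
      also have "\<dots> \<le> u * \<epsilon> u * \<psi> u" using \<epsilon>[OF u(1)] u by (intro mult_left_mono) auto
      also have "\<dots> = u\<^sup>2 / h' x" using u by (simp add: h'_def d_def u_def[symmetric] power2_eq_square)
      finally show "c * h x powr (1 - \<eta>) \<le> (h x)\<^sup>2 / h' x" by (simp add: u_def)
    qed
  qed
  have pos: "0 < h' x" "0 < h x" if "x \<ge> X" for x
    using dpos[of "h x"] hX0[of x] that U by (simp_all add: h'_def X_def)
  have "regular_rate h h' X 4"
    unfolding regular_rate_def
  proof (intro conjI allI impI)
    fix x assume x: "X \<le> x"
    show "(h has_real_derivative h' x) (at x)" "0 < h' x" "0 < h x" by (fact hd[OF x] pos[OF x])+
    show "gen_inverse h (h x) = x" using inv[of x] x X0(1) by (simp add: X_def \<psi>_def)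
  next
    show "0 < X" using X0(1) by (simp add: X_def)
  next
    fix x x' assume "X \<le> x" "X \<le> x'" "h x / 2 \<le> h x'" "h x' \<le> 2 * h x"
    then show "h' x' \<le> 4 * h' x" by (rule comp)
  qed (use hlim lim2 in simp_all)
  then show ?thesis by blast
qed

lemma regular_rate_R_class:
  assumes "h \<in> R_class" "\<And>b. bdd_above (h ` {0<..b})"
  shows "\<exists>h' X C. regular_rate h h' X C"
  using assms regular_rate_R_beta regular_rate_R_infinity unfolding R_class_def by blast

section \<open>Moments of the tilted density\<close>

text \<open>Exponential moments of every order allow differentiation in \<open>t\<close> on the
  whole line; positivity on the half-line excludes a degenerate variance.\<close>

locale exp_density =
  fixes p :: "real \<Rightarrow> real"
  assumes p_meas [measurable]: "p \<in> borel_measurable borel"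
    and p_nonneg: "\<And>x. 0 \<le> p x"
    and p_neg: "\<And>x. x < 0 \<Longrightarrow> p x = 0"
    and p_pos: "\<And>x. x \<ge> 0 \<Longrightarrow> p x > 0"
    and exp_int: "\<And>t. integrable lborel (\<lambda>x. exp (t * x) * p x)"
begin

section \<open>Unnormalised moments and their derivatives\<close>

definition emom :: "nat \<Rightarrow> real \<Rightarrow> real" where
  "emom k t = (LINT x|lborel. x ^ k * (exp (t * x) * p x))"

text \<open>One additional unit of tilt absorbs the power, because
  \<open>x ^ k <= fact k * exp x\<close> on the half-line.\<close>

lemma emom_integrable: "integrable lborel (\<lambda>x. x ^ k * (exp (t * x) * p x))"
proof (rule Bochner_Integration.integrable_bound)
  show "integrable lborel (\<lambda>x. fact k * (exp ((t + 1) * x) * p x))"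
    using exp_int by (intro integrable_mult_right) auto
  show "AE x in lborel. norm (x ^ k * (exp (t * x) * p x)) \<le> norm (fact k * (exp ((t + 1) * x) * p x))"
  proof (rule AE_I2)
    fix x :: real
    show "norm (x ^ k * (exp (t * x) * p x)) \<le> norm (fact k * (exp ((t + 1) * x) * p x))"
    proof (cases "x < 0")
      case False
      then have x: "x \<ge> 0" by simp
      have "x ^ k / fact k \<le> exp x"
      proof -
        have "(\<Sum>i\<in>{k}. x ^ i /\<^sub>R fact i) \<le> (\<Sum>i. x ^ i /\<^sub>R fact i)"
          using x by (intro sum_le_suminf summable_exp_generic) auto
        then show ?thesis by (simp add: exp_def divide_inverse mult.commute)
      qed
      then have "x ^ k \<le> fact k * exp x" by (simp add: divide_le_eq mult.commute)
      then have "x ^ k * (exp (t * x) * p x) \<le> (fact k * exp x) * (exp (t * x) * p x)"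
        using p_nonneg[of x] by (intro mult_right_mono) auto
      also have "\<dots> = fact k * (exp ((t + 1) * x) * p x)"
        by (simp add: exp_add algebra_simps)
      finally show ?thesis using x p_nonneg[of x] by simp
    qed (simp add: p_neg)
  qed
qed simp

text \<open>For increments \<open>h\<close> of modulus at most 1 the Taylor remainder of
  \<open>exp (h * x)\<close> is at most \<open>(h * x)\<^sup>2 * exp x\<close>. Integrated, this is
  \<open>h\<^sup>2\<close> times a moment at tilt \<open>t + 1\<close>, so the difference quotient
  is off by at most a constant times \<open>|h|\<close>.\<close>

lemma emom_deriv: "(emom k has_real_derivative emom (Suc k) t) (at t)"
  unfolding DERIV_def
proof (rule LIM_zero_cancel, rule Lim_null_comparison)
  define K where "K = emom (k + 2) (t + 1)"
  show "((\<lambda>h. \<bar>h\<bar> * K) \<longlongrightarrow> 0) (at 0)" by (auto intro!: tendsto_eq_intros)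
  have "\<forall>\<^sub>F h in at 0. dist h 0 < 1 \<and> h \<noteq> (0::real)"
    unfolding eventually_at by (intro exI[of _ 1]) auto
  then show "\<forall>\<^sub>F h in at 0. norm ((emom k (t + h) - emom k t) / h - emom (Suc k) t) \<le> \<bar>h\<bar> * K"
  proof (rule eventually_mono)
    fix h :: real assume h: "dist h 0 < 1 \<and> h \<noteq> 0"
    then have h1: "\<bar>h\<bar> \<le> 1" "h \<noteq> 0" by auto
    define r where "r = (\<lambda>x. x ^ k * (exp ((t + h) * x) * p x) - x ^ k * (exp (t * x) * p x) - h * (x ^ Suc k * (exp (t * x) * p x)))"
    have ri: "integrable lborel r" unfolding r_def
      by (intro Bochner_Integration.integrable_diff integrable_mult_right emom_integrable)
    have rv: "integral\<^sup>L lborel r = emom k (t + h) - emom k t - h * emom (Suc k) t"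
      unfolding r_def emom_def
      by (simp only: Bochner_Integration.integral_diff Bochner_Integration.integrable_diff emom_integrable
          integrable_mult_right integral_mult_right_zero)
    have "\<bar>integral\<^sup>L lborel r\<bar> \<le> (LINT x|lborel. \<bar>r x\<bar>)" by (rule integral_abs_bound)
    also have "\<dots> \<le> (LINT x|lborel. h\<^sup>2 * (x ^ (k + 2) * (exp ((t + 1) * x) * p x)))"
    proof (rule integral_mono')
      show "integrable lborel (\<lambda>x. h\<^sup>2 * (x ^ (k + 2) * (exp ((t + 1) * x) * p x)))"
        by (intro integrable_mult_right emom_integrable)
      fix x :: real
      show "\<bar>r x\<bar> \<le> h\<^sup>2 * (x ^ (k + 2) * (exp ((t + 1) * x) * p x))"
      proof (cases "x < 0")
        case False
        then have x: "x \<ge> 0" by simp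
        have hx: "\<bar>h * x\<bar> \<le> x" using h1 x by (simp add: abs_mult mult_left_le_one_le)
        have "cmod (exp (complex_of_real (h * x)) - (\<Sum>i\<le>1. complex_of_real (h * x) ^ i / fact i))
           \<le> exp \<bar>Re (complex_of_real (h * x))\<bar> * cmod (complex_of_real (h * x)) ^ Suc 1 / fact 1"
          by (rule Taylor_exp)
        then have "cmod (complex_of_real (exp (h * x) - 1 - h * x)) \<le> exp \<bar>h * x\<bar> * \<bar>h * x\<bar>\<^sup>2"
          by (simp add: exp_of_real[symmetric] numeral_2_eq_2 algebra_simps norm_mult abs_mult del: exp_of_real)
        then have e: "\<bar>exp (h * x) - 1 - h * x\<bar> \<le> exp \<bar>h * x\<bar> * \<bar>h * x\<bar>\<^sup>2"
          unfolding norm_of_real by simp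
        also have "\<dots> \<le> exp x * \<bar>h * x\<bar>\<^sup>2" using hx by (intro mult_right_mono) auto
        finally have e: "\<bar>exp (h * x) - 1 - h * x\<bar> \<le> exp x * \<bar>h * x\<bar>\<^sup>2" .
        have "r x = x ^ k * (exp (t * x) * p x) * (exp (h * x) - 1 - h * x)"
          by (simp add: r_def algebra_simps exp_add)
        then have "\<bar>r x\<bar> = x ^ k * (exp (t * x) * p x) * \<bar>exp (h * x) - 1 - h * x\<bar>"
          using x p_nonneg[of x] by (simp add: abs_mult)
        also have "\<dots> \<le> x ^ k * (exp (t * x) * p x) * (exp x * \<bar>h * x\<bar>\<^sup>2)"
          using x p_nonneg[of x] e by (intro mult_left_mono) auto
        also have "\<dots> = h\<^sup>2 * (x ^ (k + 2) * (exp ((t + 1) * x) * p x))"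
          by (simp add: power_mult_distrib power_add exp_add distrib_right power2_eq_square)
        finally show ?thesis .
      qed (simp add: r_def p_neg)
      show "0 \<le> h\<^sup>2 * (x ^ (k + 2) * (exp ((t + 1) * x) * p x))"
        using p_nonneg[of x] p_neg[of x] by (cases "x < 0") auto
    qed
    also have "\<dots> = h\<^sup>2 * K" unfolding K_def emom_def by (rule integral_mult_right_zero)
    finally have "\<bar>emom k (t + h) - emom k t - h * emom (Suc k) t\<bar> \<le> h\<^sup>2 * K" unfolding rv .
    then have "\<bar>emom k (t + h) - emom k t - h * emom (Suc k) t\<bar> / \<bar>h\<bar> \<le> h\<^sup>2 * K / \<bar>h\<bar>"
      by (intro divide_right_mono) auto
    also have "h\<^sup>2 * K / \<bar>h\<bar> = \<bar>h\<bar> * K"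
      using h1(2) by (cases "h \<ge> 0") (simp_all add: power2_eq_square)
    also have "\<bar>emom k (t + h) - emom k t - h * emom (Suc k) t\<bar> / \<bar>h\<bar> = \<bar>(emom k (t + h) - emom k t) / h - emom (Suc k) t\<bar>"
      unfolding abs_divide[symmetric] using h1(2) by (simp add: diff_divide_distrib)
    finally show "norm ((emom k (t + h) - emom k t) / h - emom (Suc k) t) \<le> \<bar>h\<bar> * K" by simp
  qed
qed

lemma emom0_pos: "emom 0 t > 0"
proof -
  have "emom 0 t \<noteq> 0"
  proof
    assume "emom 0 t = 0"
    then have "AE x in lborel. exp (t * x) * p x = 0"
      using integral_nonneg_eq_0_iff_AE[OF exp_int[of t]] p_nonneg by (simp add: emom_def)
    then have "AE x in lborel. x \<notin> {0..1::real}"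
      by eventually_elim (use p_pos in \<open>auto simp: less_le\<close>)
    then have "emeasure lborel {0..1::real} = 0"
      by (subst (asm) AE_iff_measurable[of "{0..1::real}"]) auto
    then show False by simp
  qed
  moreover have "emom 0 t \<ge> 0" unfolding emom_def using p_nonneg by (intro integral_nonneg_AE) auto
  ultimately show ?thesis by simp
qed

lemma mgf_eq: "mgf p t = emom 0 t"
  unfolding mgf_def emom_def set_lebesgue_integral_def
  by (intro Bochner_Integration.integral_cong refl) (auto simp: indicator_def p_neg)

lemma ln_mgf_deriv: "((\<lambda>u. ln (mgf p u)) has_real_derivative emom 1 t / emom 0 t) (at t)"
  unfolding mgf_eq[abs_def] using emom_deriv[of 0 t] emom0_pos[of t]
  by (auto intro!: derivative_eq_intros simp: divide_inverse)

lemma tilt_mean_eq: "tilt_mean p t = emom 1 t / emom 0 t"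
  unfolding tilt_mean_def by (rule DERIV_imp_deriv[OF ln_mgf_deriv])

section \<open>Normalisation and central moments\<close>

definition tilt_dens :: "real \<Rightarrow> real \<Rightarrow> real" where
  "tilt_dens t x = exp (t * x) * p x / emom 0 t"

lemma tilt_dens_meas [measurable]: "tilt_dens t \<in> borel_measurable borel"
  unfolding tilt_dens_def by measurable

lemma tilt_dens_nonneg: "tilt_dens t x \<ge> 0"
  unfolding tilt_dens_def using p_nonneg emom0_pos[of t] by auto

lemma tilt_dens_moment: "has_bochner_integral lborel (\<lambda>x. tilt_dens t x * x ^ k) (emom k t / emom 0 t)"
proof -
  have "has_bochner_integral lborel (\<lambda>x. x ^ k * (exp (t * x) * p x) / emom 0 t) (emom k t / emom 0 t)"
    using emom_integrable[of k t] by (simp add: has_bochner_integral_iff emom_def)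
  then show ?thesis by (simp add: tilt_dens_def mult_ac)
qed

definition tilt_var :: "real \<Rightarrow> real" where
  "tilt_var t = emom 2 t / emom 0 t - (tilt_mean p t)\<^sup>2"

text \<open>The third central moment expanded in raw moments, the form in which it arises as the
  derivative of \<open>tilt_var\<close>; \<open>tilt_central3\<close> identifies it as an
  integral.\<close>

definition tilt_third :: "real \<Rightarrow> real" where
  "tilt_third t = emom 3 t / emom 0 t - 3 * tilt_mean p t * (emom 2 t / emom 0 t) + 2 * (tilt_mean p t) ^ 3"

lemma tilt_central1: "has_bochner_integral lborel (\<lambda>x. tilt_dens t x * (x - tilt_mean p t)) 0"
  and tilt_central2: "has_bochner_integral lborel (\<lambda>x. tilt_dens t x * (x - tilt_mean p t)\<^sup>2) (tilt_var t)"
  and tilt_central3: "has_bochner_integral lborel (\<lambda>x. tilt_dens t x * (x - tilt_mean p t) ^ 3) (tilt_third t)"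
proof -
  define m where "m = tilt_mean p t"
  define \<mu> where "\<mu> = (\<lambda>k. emom k t / emom 0 t)"
  have mo: "has_bochner_integral lborel (\<lambda>x. tilt_dens t x * x ^ k) (\<mu> k)" for k
    unfolding \<mu>_def by (rule tilt_dens_moment)
  have \<mu>: "\<mu> 0 = 1" "\<mu> 1 = m" using emom0_pos[of t] by (auto simp: \<mu>_def m_def tilt_mean_eq)
  have "has_bochner_integral lborel (\<lambda>x. tilt_dens t x * x ^ 1 - m * (tilt_dens t x * x ^ 0)) (\<mu> 1 - m * \<mu> 0)"
    by (intro has_bochner_integral_diff has_bochner_integral_mult_right mo)
  then show "has_bochner_integral lborel (\<lambda>x. tilt_dens t x * (x - tilt_mean p t)) 0"
    unfolding \<mu> m_def[symmetric] by (simp add: algebra_simps)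
  have "has_bochner_integral lborel (\<lambda>x. tilt_dens t x * x ^ 2 - 2 * m * (tilt_dens t x * x ^ 1) + m\<^sup>2 * (tilt_dens t x * x ^ 0))
     (\<mu> 2 - 2 * m * \<mu> 1 + m\<^sup>2 * \<mu> 0)"
    by (intro has_bochner_integral_diff has_bochner_integral_add has_bochner_integral_mult_right mo)
  moreover have "\<mu> 2 - 2 * m * \<mu> 1 + m\<^sup>2 * \<mu> 0 = tilt_var t"
    unfolding \<mu> tilt_var_def m_def by (simp add: \<mu>_def power2_eq_square)
  moreover have "(\<lambda>x. tilt_dens t x * x ^ 2 - 2 * m * (tilt_dens t x * x ^ 1) + m\<^sup>2 * (tilt_dens t x * x ^ 0))
     = (\<lambda>x. tilt_dens t x * (x - m)\<^sup>2)" by (simp add: algebra_simps power2_eq_square)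
  ultimately show "has_bochner_integral lborel (\<lambda>x. tilt_dens t x * (x - tilt_mean p t)\<^sup>2) (tilt_var t)"
    unfolding m_def by simp
  have "has_bochner_integral lborel (\<lambda>x. tilt_dens t x * x ^ 3 - 3 * m * (tilt_dens t x * x ^ 2)
       + 3 * m\<^sup>2 * (tilt_dens t x * x ^ 1) - m ^ 3 * (tilt_dens t x * x ^ 0))
     (\<mu> 3 - 3 * m * \<mu> 2 + 3 * m\<^sup>2 * \<mu> 1 - m ^ 3 * \<mu> 0)"
    by (intro has_bochner_integral_diff has_bochner_integral_add has_bochner_integral_mult_right mo)
  moreover have "\<mu> 3 - 3 * m * \<mu> 2 + 3 * m\<^sup>2 * \<mu> 1 - m ^ 3 * \<mu> 0 = tilt_third t"
    unfolding \<mu> tilt_third_def m_def by (simp add: \<mu>_def power2_eq_square power3_eq_cube)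
  moreover have "(\<lambda>x. tilt_dens t x * x ^ 3 - 3 * m * (tilt_dens t x * x ^ 2)
       + 3 * m\<^sup>2 * (tilt_dens t x * x ^ 1) - m ^ 3 * (tilt_dens t x * x ^ 0))
     = (\<lambda>x. tilt_dens t x * (x - m) ^ 3)" by (simp add: algebra_simps power2_eq_square power3_eq_cube)
  ultimately show "has_bochner_integral lborel (\<lambda>x. tilt_dens t x * (x - tilt_mean p t) ^ 3) (tilt_third t)"
    unfolding m_def by simp
qed

lemma tilt_var_pos: "tilt_var t > 0"
proof -
  have i: "integrable lborel (\<lambda>x. tilt_dens t x * (x - tilt_mean p t)\<^sup>2)"
    and v: "(LINT x|lborel. tilt_dens t x * (x - tilt_mean p t)\<^sup>2) = tilt_var t"
    using tilt_central2[of t] by (auto simp: has_bochner_integral_iff)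
  have "tilt_var t \<noteq> 0"
  proof
    assume "tilt_var t = 0"
    then have "AE x in lborel. tilt_dens t x * (x - tilt_mean p t)\<^sup>2 = 0"
      using integral_nonneg_eq_0_iff_AE[OF i] v tilt_dens_nonneg by simp
    then have "AE x in lborel. x \<notin> {0..1::real}"
      using AE_lborel_singleton[of "tilt_mean p t"]
      by eventually_elim (use p_pos emom0_pos[of t] in \<open>auto simp: tilt_dens_def less_le\<close>)
    then have "emeasure lborel {0..1::real} = 0"
      by (subst (asm) AE_iff_measurable[of "{0..1::real}"]) auto
    then show False by simp
  qed
  moreover have "tilt_var t \<ge> 0"
    unfolding v[symmetric] using tilt_dens_nonneg by (intro integral_nonneg_AE) auto
  ultimately show ?thesis by simp
qed

lemma tilt_mean_deriv: "(tilt_mean p has_real_derivative tilt_var t) (at t)"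
proof -
  have "((\<lambda>t. emom 1 t / emom 0 t) has_real_derivative
     (emom 2 t * emom 0 t - emom 1 t * emom 1 t) / (emom 0 t * emom 0 t)) (at t)"
    using emom_deriv[of 1 t] emom_deriv[of 0 t] emom0_pos[of t]
    by (intro DERIV_divide) (auto simp: numeral_2_eq_2)
  moreover have "(emom 2 t * emom 0 t - emom 1 t * emom 1 t) / (emom 0 t * emom 0 t) = tilt_var t"
    using emom0_pos[of t] by (simp add: tilt_var_def tilt_mean_eq field_simps power2_eq_square)
  ultimately show ?thesis by (simp add: tilt_mean_eq[abs_def])
qed

lemma tilt_sd_eq: "tilt_sd p t = sqrt (tilt_var t)"
  unfolding tilt_sd_def by (simp add: DERIV_imp_deriv[OF tilt_mean_deriv])

lemma tilt_sd_pos: "tilt_sd p t > 0"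
  using tilt_var_pos by (simp add: tilt_sd_eq)

lemma tilt_sd_square: "(tilt_sd p t)\<^sup>2 = tilt_var t"
  using tilt_var_pos[of t] by (simp add: tilt_sd_eq)

lemma tilt_var_deriv: "(tilt_var has_real_derivative tilt_third t) (at t)"
proof -
  have "((\<lambda>t. emom 2 t / emom 0 t - (tilt_mean p t)\<^sup>2) has_real_derivative
     (emom 3 t * emom 0 t - emom 2 t * emom 1 t) / (emom 0 t * emom 0 t) - 2 * tilt_mean p t * tilt_var t) (at t)"
    using emom_deriv[of 2 t] emom_deriv[of 0 t] emom0_pos[of t]
    by (auto intro!: derivative_eq_intros tilt_mean_deriv simp: numeral_3_eq_3 numeral_2_eq_2)
  moreover have "(emom 3 t * emom 0 t - emom 2 t * emom 1 t) / (emom 0 t * emom 0 t) - 2 * tilt_mean p t * tilt_var t = tilt_third t"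
    using emom0_pos[of t]
    by (simp add: tilt_third_def tilt_var_def tilt_mean_eq field_simps power2_eq_square power3_eq_cube)
  ultimately show ?thesis by (simp add: tilt_var_def[abs_def])
qed

lemma tilt_mean_strict_mono: "s < t \<Longrightarrow> tilt_mean p s < tilt_mean p t"
  by (rule DERIV_pos_imp_increasing) (use tilt_mean_deriv tilt_var_pos in blast)+

lemma tilt_mean_less_iff: "tilt_mean p s < tilt_mean p t \<longleftrightarrow> s < t"
  using tilt_mean_strict_mono by (metis less_asym linorder_neqE_linordered_idom)

lemma tilt_param_tilt_mean [simp]: "tilt_param p (tilt_mean p t) = t"
  unfolding tilt_param_def
proof (rule the_equality)
  fix s assume "tilt_mean p s = tilt_mean p t"
  then show "s = t" using tilt_mean_strict_mono by (metis less_irrefl linorder_neqE_linordered_idom)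
qed simp

lemma abs_third_integrable: "integrable lborel (\<lambda>x. tilt_dens t x * \<bar>x - tilt_mean p t\<bar> ^ 3)"
proof -
  have "integrable lborel (\<lambda>x. \<bar>tilt_dens t x * (x - tilt_mean p t) ^ 3\<bar>)"
    using tilt_central3[of t] by (auto simp: has_bochner_integral_iff)
  then show ?thesis by (simp add: abs_mult tilt_dens_nonneg power_abs)
qed

lemma abs_tilt_third_le: "\<bar>tilt_third t\<bar> \<le> (LINT x|lborel. tilt_dens t x * \<bar>x - tilt_mean p t\<bar> ^ 3)"
proof -
  have "\<bar>tilt_third t\<bar> \<le> (LINT x|lborel. \<bar>tilt_dens t x * (x - tilt_mean p t) ^ 3\<bar>)"
    using tilt_central3[of t] integral_abs_bound by (metis has_bochner_integral_integral_eq)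
  then show ?thesis by (simp add: abs_mult tilt_dens_nonneg power_abs)
qed

end

section \<open>Laplace estimates\<close>

lemma regular_rate_mono:
  assumes "regular_rate h h' X C" "X \<le> x" "x \<le> y"
  shows "h x \<le> h y"
  using regular_rate_strict_mono[OF assms(1,2), of y] assms(3) by (cases "x = y") auto

text \<open>At \<open>x = gen_inverse h t\<close> the quotient \<open>(h x)\<^sup>2 / h' x\<close>
  is the square of \<open>t\<close> times the width \<open>1 / sqrt (h' x)\<close>; the last clause
  of \<open>regular_rate\<close> therefore says that this product tends to infinity.\<close>

lemma regular_rate_width:
  assumes R: "regular_rate h h' X C"
  shows "\<exists>T. T > h X \<and> (\<forall>t\<ge>T. N \<le> t * (1 / sqrt (h' (gen_inverse h t))))"
proof -
  have "\<forall>\<^sub>F x in at_top. (max N 0)\<^sup>2 \<le> (h x)\<^sup>2 / h' x"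
    using R unfolding regular_rate_def filterlim_at_top by blast
  then obtain x1 where x1: "\<And>x. x \<ge> x1 \<Longrightarrow> (max N 0)\<^sup>2 \<le> (h x)\<^sup>2 / h' x"
    unfolding eventually_at_top_linorder by blast
  define x2 where "x2 = max x1 X"
  have X: "h X > 0" using R unfolding regular_rate_def by auto
  show ?thesis
  proof (intro exI[of _ "h x2 + 1"] conjI allI impI)
    have "h X \<le> h x2" by (rule regular_rate_mono[OF R]) (auto simp: x2_def)
    then show "h X < h x2 + 1" by simp
    fix t assume t: "h x2 + 1 \<le> t"
    then have tX: "h X < t" using \<open>h X \<le> h x2\<close> by simp
    define \<psi> where "\<psi> = gen_inverse h t"
    have \<psi>: "X < \<psi>" "h \<psi> = t" using regular_rate_inverse[OF R tX] by (auto simp: \<psi>_def)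
    have h'p: "h' \<psi> > 0" using R \<psi> unfolding regular_rate_def by auto
    have "\<psi> \<ge> x2"
    proof (rule ccontr)
      assume "\<not> x2 \<le> \<psi>"
      then have "h \<psi> < h x2" using \<psi> by (intro regular_rate_strict_mono[OF R]) auto
      then show False using \<psi> t by simp
    qed
    then have "(max N 0)\<^sup>2 \<le> t\<^sup>2 / h' \<psi>" using x1[of \<psi>] \<psi> by (simp add: x2_def)
    also have "\<dots> = (t * (1 / sqrt (h' \<psi>)))\<^sup>2" using h'p by (simp add: power_mult_distrib power_divide)
    finally have "max N 0 \<le> t * (1 / sqrt (h' \<psi>))"
      by (rule power2_le_imp_le) (use tX X h'p in simp)
    then show "N \<le> t * (1 / sqrt (h' (gen_inverse h t)))" by (simp add: \<psi>_def)
  qed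
qed

text \<open>Between the points where \<open>h\<close> equals \<open>t / 2\<close>, \<open>t\<close>
  and \<open>2 * t\<close> the derivative is at most \<open>C * h' \<psi>\<close>, so by the mean
  value theorem each of these points is at least \<open>t / (2 * C * h' \<psi>)\<close> away from
  \<psi>. This exceeds \<open>r\<close> widths as soon as \<open>t\<close> times the width is at
  least \<open>2 * C * r\<close>. Starting from the values of \<open>h\<close> avoids a circle: the
  comparison of derivatives presupposes that \<open>h\<close> stays between \<open>t / 2\<close> and
  \<open>2 * t\<close>.\<close>

lemma regular_rate_window:
  assumes R: "regular_rate h h' X C" and r: "r \<ge> 0"
  shows "\<exists>T. T > h X \<and> (\<forall>t\<ge>T. \<forall>x. \<bar>x - gen_inverse h t\<bar> \<le> r * (1 / sqrt (h' (gen_inverse h t))) \<longrightarrow>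
     X \<le> x \<and> t / 2 \<le> h x \<and> h x \<le> 2 * t)"
proof -
  have C: "C \<ge> 1" and X: "h X > 0" and comp: "\<And>x x'. x \<ge> X \<Longrightarrow> x' \<ge> X \<Longrightarrow> h x / 2 \<le> h x' \<Longrightarrow> h x' \<le> 2 * h x \<Longrightarrow> h' x' \<le> C * h' x"
    and hd: "\<And>x. x \<ge> X \<Longrightarrow> (h has_real_derivative h' x) (at x)" and h'p: "\<And>x. x \<ge> X \<Longrightarrow> 0 < h' x"
    using R unfolding regular_rate_def by blast+
  obtain T0 where T0: "T0 > h X" "\<And>t. t \<ge> T0 \<Longrightarrow> 2 * C * r \<le> t * (1 / sqrt (h' (gen_inverse h t)))"
    using regular_rate_width[OF R] by blast
  show ?thesis
  proof (intro exI[of _ "max T0 (2 * h X + 1)"] conjI allI impI)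
    show "h X < max T0 (2 * h X + 1)" using T0 by simp
    fix t x assume t: "max T0 (2 * h X + 1) \<le> t"
      and x: "\<bar>x - gen_inverse h t\<bar> \<le> r * (1 / sqrt (h' (gen_inverse h t)))"
    have tX: "h X < t" "h X < t / 2" "h X < 2 * t" "t > 0" using t X by auto
    define \<psi> where "\<psi> = gen_inverse h t"
    define a where "a = gen_inverse h (t / 2)"
    define b where "b = gen_inverse h (2 * t)"
    define \<sigma> where "\<sigma> = 1 / sqrt (h' \<psi>)"
    have \<psi>: "X < \<psi>" "h \<psi> = t" using regular_rate_inverse[OF R tX(1)] by (auto simp: \<psi>_def)
    have a: "X < a" "h a = t / 2" using regular_rate_inverse[OF R tX(2)] by (auto simp: a_def)
    have b: "X < b" "h b = 2 * t" using regular_rate_inverse[OF R tX(3)] by (auto simp: b_def)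
    have \<sigma>: "\<sigma> > 0" "h' \<psi> = 1 / \<sigma>\<^sup>2" using h'p[of \<psi>] \<psi> by (auto simp: \<sigma>_def power_divide)
    have N: "2 * C * r \<le> t * \<sigma>" using T0(2)[of t] t by (simp add: \<sigma>_def \<psi>_def)
    have less: "u < v" if "X < u" "X < v" "h u < h v" for u v
      using regular_rate_mono[OF R, of v u] that by fastforce
    have ab: "a < \<psi>" "\<psi> < b" using less[of a \<psi>] less[of \<psi> b] a b \<psi> tX(4) by simp_all
    have gap: "r * \<sigma> \<le> v - u" if uv: "X < u" "u < v" "t / 2 \<le> h u" "h v \<le> 2 * t" "h v - h u \<ge> t / 2" for u v
    proof -
      obtain z where z: "u < z" "z < v" "h v - h u = (v - u) * h' z"
      proof -
        have "\<exists>z. u < z \<and> z < v \<and> h v - h u = (v - u) * h' z"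
          by (rule MVT2) (use hd uv in simp_all)
        then show ?thesis using that by blast
      qed
      have "t / 2 \<le> h z" using regular_rate_mono[OF R, of u z] uv z by simp
      moreover have "h z \<le> 2 * t" using regular_rate_mono[OF R, of z v] uv z by simp
      ultimately have "h' z \<le> C * h' \<psi>" using comp[of \<psi> z] \<psi> z uv by simp
      then have "(v - u) * h' z \<le> (v - u) * (C * h' \<psi>)" using z by (intro mult_left_mono) auto
      moreover have "t / 2 \<le> (v - u) * h' z" using z(3) uv(5) by simp
      ultimately have "t / 2 \<le> (v - u) * (C * h' \<psi>)" by (rule order_trans[rotated])
      then have "t / 2 \<le> (v - u) * (C / \<sigma>\<^sup>2)" using \<sigma>(2) by simp
      then have "t / 2 * \<sigma>\<^sup>2 \<le> (v - u) * C" using \<sigma>(1) by (simp add: field_simps)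
      moreover have "2 * C * r * \<sigma> \<le> t * \<sigma> * \<sigma>" using N \<sigma> by (intro mult_right_mono) auto
      ultimately have "C * (r * \<sigma>) \<le> C * (v - u)" by (simp add: power2_eq_square field_simps)
      then show ?thesis using C by simp
    qed
    have "r * \<sigma> \<le> b - \<psi>" using ab b \<psi> tX(4) by (intro gap) auto
    moreover have "r * \<sigma> \<le> \<psi> - a" using ab a \<psi> tX(4) by (intro gap) auto
    moreover have "\<bar>x - \<psi>\<bar> \<le> r * \<sigma>" using x by (simp add: \<psi>_def \<sigma>_def)
    ultimately have "a \<le> x" "x \<le> b" by (simp_all add: abs_le_iff)
    moreover have "X \<le> x" "X \<le> a" using calculation a(1) by simp_all
    ultimately show "X \<le> x" "t / 2 \<le> h x" "h x \<le> 2 * t"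
      using a b regular_rate_mono[OF R, of a x] regular_rate_mono[OF R, of x b] by simp_all
  qed
qed

text \<open>Beyond \<open>X\<close> the exponent is concave with its maximum at \<psi>, and in the
  window its second derivative \<open>- h'\<close> is between \<open>- C / \<sigma>\<^sup>2\<close>
  and \<open>- 1 / (C * \<sigma>\<^sup>2)\<close>. Hence it drops by at most \<open>C\<close> inside
  the window, while beyond half the window its slope has become at least
  \<open>1 / (2 * C * \<sigma>)\<close> in modulus, and concavity preserves that slope further
  out.\<close>

lemma laplace_exponent_bounds:
  fixes g h h' :: "real \<Rightarrow> real"
  assumes R: "regular_rate h h' X C" and gd: "\<And>x. x \<ge> X \<Longrightarrow> (g has_real_derivative h x) (at x)"
    and \<psi>: "X < \<psi>" "h \<psi> = t" and \<sigma>: "\<sigma> > 0" "h' \<psi> = 1 / \<sigma>\<^sup>2"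
    and win: "\<And>x. \<bar>x - \<psi>\<bar> \<le> \<sigma> \<Longrightarrow> X \<le> x \<and> t / 2 \<le> h x \<and> h x \<le> 2 * t"
  shows "\<bar>x - \<psi>\<bar> \<le> \<sigma> \<Longrightarrow> t * \<psi> - g \<psi> - C \<le> t * x - g x"
    and "X \<le> x \<Longrightarrow> t * x - g x \<le> t * \<psi> - g \<psi> + 1 - \<bar>x - \<psi>\<bar> / (2 * C * \<sigma>)"
proof -
  have C: "C \<ge> 1" and comp: "\<And>x x'. x \<ge> X \<Longrightarrow> x' \<ge> X \<Longrightarrow> h x / 2 \<le> h x' \<Longrightarrow> h x' \<le> 2 * h x \<Longrightarrow> h' x' \<le> C * h' x"
    and hd: "\<And>x. x \<ge> X \<Longrightarrow> (h has_real_derivative h' x) (at x)" and h'p: "\<And>x. x \<ge> X \<Longrightarrow> 0 < h' x"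
    using R unfolding regular_rate_def by blast+
  have Xs: "X \<le> \<psi> - \<sigma>" using win[of "\<psi> - \<sigma>"] \<sigma> by simp
  have h'b: "h' w \<le> C / \<sigma>\<^sup>2" "1 / (C * \<sigma>\<^sup>2) \<le> h' w" if "\<bar>w - \<psi>\<bar> \<le> \<sigma>" for w
  proof -
    have w: "X \<le> w" "t / 2 \<le> h w" "h w \<le> 2 * t" using win[OF that] by auto
    show "h' w \<le> C / \<sigma>\<^sup>2" using comp[of \<psi> w] w \<psi> \<sigma> by simp
    have "h' \<psi> \<le> C * h' w" using comp[of w \<psi>] w \<psi> by simp
    then show "1 / (C * \<sigma>\<^sup>2) \<le> h' w" using \<sigma> C by (simp add: field_simps)
  qed
  have hmvt: "\<exists>z. u < z \<and> z < v \<and> h v - h u = (v - u) * h' z" if "X \<le> u" "u < v" for u v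
    by (rule MVT2) (use hd that in auto)
  define K where "K = (\<lambda>x. t * x - g x)"
  have Kmvt: "\<exists>z. u < z \<and> z < v \<and> K v - K u = (v - u) * (t - h z)" if "X \<le> u" "u < v" for u v
    unfolding K_def by (rule MVT2) (use gd that in \<open>auto intro!: derivative_eq_intros\<close>)
  have hlip: "\<bar>h z - t\<bar> \<le> C / \<sigma>" if hz: "\<bar>z - \<psi>\<bar> \<le> \<sigma>" for z
  proof -
    have *: "d * e \<le> C / \<sigma>" "0 \<le> d * e" if "0 \<le> d" "d \<le> \<sigma>" "0 < e" "e \<le> C / \<sigma>\<^sup>2" for d e
    proof -
      have "d * e \<le> \<sigma> * (C / \<sigma>\<^sup>2)" using that by (intro mult_mono) auto
      then show "d * e \<le> C / \<sigma>" using \<sigma> by (simp add: power2_eq_square)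
      show "0 \<le> d * e" using that by simp
    qed
    consider "z = \<psi>" | "z < \<psi>" | "z > \<psi>" by linarith
    then show ?thesis
    proof cases
      case 1 then show ?thesis using \<psi> C \<sigma> by simp
    next
      case 2
      then obtain w where w: "z < w" "w < \<psi>" "h \<psi> - h z = (\<psi> - z) * h' w" using hmvt[of z \<psi>] win[OF hz] by blast
      have wb: "\<bar>w - \<psi>\<bar> \<le> \<sigma>" using w hz by arith
      have "(\<psi> - z) * h' w \<le> C / \<sigma>" "0 \<le> (\<psi> - z) * h' w"
        using *[of "\<psi> - z" "h' w"] h'b(1)[OF wb] h'p[of w] win[OF wb] 2 hz by auto
      then show ?thesis using w(3) \<psi>(2) by simp
    next
      case 3
      then obtain w where w: "\<psi> < w" "w < z" "h z - h \<psi> = (z - \<psi>) * h' w" using hmvt[of \<psi> z] \<psi>(1) less_imp_le by blast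
      have wb: "\<bar>w - \<psi>\<bar> \<le> \<sigma>" using w hz by arith
      have "(z - \<psi>) * h' w \<le> C / \<sigma>" "0 \<le> (z - \<psi>) * h' w"
        using *[of "z - \<psi>" "h' w"] h'b(1)[OF wb] h'p[of w] win[OF wb] 3 hz by auto
      then show ?thesis using w(3) \<psi>(2) by simp
    qed
  qed
  have Klip: "\<bar>K v - K u\<bar> \<le> C" if "X \<le> u" "u < v" "\<bar>u - \<psi>\<bar> \<le> \<sigma>" "\<bar>v - \<psi>\<bar> \<le> \<sigma>" "v - u \<le> \<sigma>" for u v
  proof -
    obtain z where z: "u < z" "z < v" "K v - K u = (v - u) * (t - h z)" using Kmvt \<open>X \<le> u\<close> \<open>u < v\<close> by blast
    have "\<bar>z - \<psi>\<bar> \<le> \<sigma>" using z that by (auto simp: abs_le_iff)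
    then have "\<bar>v - u\<bar> * \<bar>t - h z\<bar> \<le> \<sigma> * (C / \<sigma>)"
      using hlip[of z] that \<sigma> by (intro mult_mono) (auto simp: abs_minus_commute)
    then show ?thesis using z \<sigma> by (simp add: abs_mult)
  qed
  show "t * \<psi> - g \<psi> - C \<le> t * x - g x" if x: "\<bar>x - \<psi>\<bar> \<le> \<sigma>"
  proof -
    have "\<bar>K x - K \<psi>\<bar> \<le> C"
    proof (cases x \<psi> rule: linorder_cases)
      case less
      then show ?thesis using Klip[of x \<psi>] win[OF x] x \<sigma> by (simp add: abs_minus_commute abs_le_iff)
    next
      case greater
      then show ?thesis using Klip[of \<psi> x] \<psi> x \<sigma> by (simp add: abs_le_iff)
    qed (use C in simp)
    then show ?thesis unfolding K_def by (simp add: abs_le_iff)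
  qed
  \<comment> \<open>The slope gained over a distance \<open>\<sigma> / 2\<close> when
    \<open>h'\<close> is at least \<open>1 / (C * \<sigma>\<^sup>2)\<close>. Since
    \<open>e * \<sigma> <= 1 / 2\<close>, the linear bound loses less than 1 before this slope is
    reached.\<close>
  define e where "e = 1 / (2 * C * \<sigma>)"
  have e: "e > 0" "e * \<sigma> \<le> 1 / 2" using C \<sigma> by (auto simp: e_def field_simps)
  have half: "(\<sigma> / 2) * (1 / (C * \<sigma>\<^sup>2)) = e" using \<sigma> C by (simp add: e_def power2_eq_square field_simps)
  have hright: "t + e \<le> h z" if "z \<ge> \<psi> + \<sigma> / 2" for z
  proof -
    obtain w where w: "\<psi> < w" "w < \<psi> + \<sigma> / 2" "h (\<psi> + \<sigma> / 2) - h \<psi> = (\<sigma> / 2) * h' w"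
      using hmvt[of \<psi> "\<psi> + \<sigma> / 2"] \<psi> \<sigma> by auto
    have "(\<sigma> / 2) * (1 / (C * \<sigma>\<^sup>2)) \<le> (\<sigma> / 2) * h' w"
      using w \<sigma> by (intro mult_left_mono h'b) (auto simp: abs_le_iff)
    then have "t + e \<le> h (\<psi> + \<sigma> / 2)" using w \<psi> half by simp
    also have "\<dots> \<le> h z" using that \<psi> \<sigma> by (intro regular_rate_mono[OF R]) auto
    finally show ?thesis .
  qed
  have hleft: "h z \<le> t - e" if "X \<le> z" "z \<le> \<psi> - \<sigma> / 2" for z
  proof -
    obtain w where w: "\<psi> - \<sigma> / 2 < w" "w < \<psi>" "h \<psi> - h (\<psi> - \<sigma> / 2) = (\<sigma> / 2) * h' w"
      using hmvt[of "\<psi> - \<sigma> / 2" \<psi>] Xs \<sigma> by auto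
    have "(\<sigma> / 2) * (1 / (C * \<sigma>\<^sup>2)) \<le> (\<sigma> / 2) * h' w"
      using w \<sigma> by (intro mult_left_mono h'b) (auto simp: abs_le_iff)
    then have "h (\<psi> - \<sigma> / 2) \<le> t - e" using w \<psi> half by simp
    moreover have "h z \<le> h (\<psi> - \<sigma> / 2)" using that by (intro regular_rate_mono[OF R]) auto
    ultimately show ?thesis by simp
  qed
  have dec: "K v \<le> K u" if uv: "\<psi> \<le> u" "u \<le> v" for u v
  proof (cases "u = v")
    case False
    then obtain z where z: "u < z" "z < v" "K v - K u = (v - u) * (t - h z)" using Kmvt[of u v] uv \<psi>(1) by force
    have "t \<le> h z" using regular_rate_mono[OF R, of \<psi> z] z that \<psi> by simp
    then have "(v - u) * (t - h z) \<le> 0" using z by (intro mult_nonneg_nonpos) auto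
    then show ?thesis using z by simp
  qed simp
  have inc: "K u \<le> K v" if uv: "X \<le> u" "u \<le> v" "v \<le> \<psi>" for u v
  proof (cases "u = v")
    case False
    then obtain z where z: "u < z" "z < v" "K v - K u = (v - u) * (t - h z)" using Kmvt[of u v] uv by force
    have "h z \<le> t" using regular_rate_mono[OF R, of z \<psi>] z that \<psi> by simp
    then have "0 \<le> (v - u) * (t - h z)" using z by (intro mult_nonneg_nonneg) auto
    then show ?thesis using z by simp
  qed simp
  show "t * x - g x \<le> t * \<psi> - g \<psi> + 1 - \<bar>x - \<psi>\<bar> / (2 * C * \<sigma>)" if x: "X \<le> x"
  proof -
    have near: "K x \<le> K \<psi>" using dec[of \<psi> x] inc[of x \<psi>] x by (cases "\<psi> \<le> x") auto
    have "K x \<le> K \<psi> + 1 - e * \<bar>x - \<psi>\<bar>"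
    proof -
      consider "\<bar>x - \<psi>\<bar> \<le> \<sigma> / 2" | "x > \<psi> + \<sigma> / 2" | "x < \<psi> - \<sigma> / 2" by linarith
      then show ?thesis
      proof cases
        case 1
        then have "e * \<bar>x - \<psi>\<bar> \<le> e * (\<sigma> / 2)" using e by (intro mult_left_mono) auto
        moreover have "e * (\<sigma> / 2) \<le> 1" using e by simp
        ultimately show ?thesis using near by linarith
      next
        case 2
        obtain z where z: "\<psi> + \<sigma> / 2 < z" "z < x" "K x - K (\<psi> + \<sigma> / 2) = (x - (\<psi> + \<sigma> / 2)) * (t - h z)"
          using Kmvt[of "\<psi> + \<sigma> / 2" x] 2 \<psi> \<sigma> by auto
        have "(x - (\<psi> + \<sigma> / 2)) * (t - h z) \<le> (x - (\<psi> + \<sigma> / 2)) * (- e)"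
          using hright[of z] z by (intro mult_left_mono) auto
        moreover have "K (\<psi> + \<sigma> / 2) \<le> K \<psi>" using \<sigma> by (intro dec) auto
        moreover have "(x - (\<psi> + \<sigma> / 2)) * (- e) = - (e * (x - \<psi>)) + e * \<sigma> / 2" by (simp add: algebra_simps)
        ultimately have "K x \<le> K \<psi> - e * (x - \<psi>) + e * \<sigma> / 2" using z by linarith
        then show ?thesis using e 2 \<sigma> by simp
      next
        case 3
        obtain z where z: "x < z" "z < \<psi> - \<sigma> / 2" "K (\<psi> - \<sigma> / 2) - K x = ((\<psi> - \<sigma> / 2) - x) * (t - h z)"
          using Kmvt[of x "\<psi> - \<sigma> / 2"] 3 x by auto
        have "((\<psi> - \<sigma> / 2) - x) * e \<le> ((\<psi> - \<sigma> / 2) - x) * (t - h z)"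
          using hleft[of z] z x by (intro mult_left_mono) auto
        moreover have "K (\<psi> - \<sigma> / 2) \<le> K \<psi>" using \<sigma> Xs by (intro inc) auto
        moreover have "((\<psi> - \<sigma> / 2) - x) * e = e * (\<psi> - x) - e * \<sigma> / 2" by (simp add: algebra_simps)
        ultimately have "K x \<le> K \<psi> - e * (\<psi> - x) + e * \<sigma> / 2" using z by linarith
        then show ?thesis using e 3 \<sigma> by simp
      qed
    qed
    then show ?thesis unfolding K_def e_def by simp
  qed
qed

section \<open>From the exponent to the moments\<close>

lemma integrable_abs_power_exp: "integrable lborel (\<lambda>z::real. \<bar>z\<bar> ^ k * exp (- \<bar>z\<bar>))"
proof -
  define F where "F = (\<lambda>v::real. exponential_density 1 v * v ^ k)"
  have F: "integrable lborel F" unfolding F_def by (rule integrable_exponential_moment) simp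
  have F2: "integrable lborel (\<lambda>v. F (0 + - 1 * v))" by (rule lborel_integrable_real_affine[OF F]) simp
  show ?thesis
  proof (rule Bochner_Integration.integrable_bound[OF Bochner_Integration.integrable_add[OF F F2]])
    have nn: "F v \<ge> 0" for v by (auto simp: F_def exponential_density_def)
    show "AE z in lborel. norm (\<bar>z\<bar> ^ k * exp (- \<bar>z\<bar>)) \<le> norm (F z + F (0 + - 1 * z))"
    proof (rule AE_I2)
      fix z :: real
      have "\<bar>z\<bar> ^ k * exp (- \<bar>z\<bar>) = F \<bar>z\<bar>" by (simp add: F_def exponential_density_def)
      also have "F \<bar>z\<bar> \<le> F z + F (- z)" using nn[of z] nn[of "- z"] by (cases "z \<ge> 0") auto
      finally show "norm (\<bar>z\<bar> ^ k * exp (- \<bar>z\<bar>)) \<le> norm (F z + F (0 + - 1 * z))"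
        using nn[of z] nn[of "- z"] by simp
    qed
  qed simp
qed

lemma laplace_moment:
  fixes \<psi> b :: real
  assumes b: "b > 0"
  shows "has_bochner_integral lborel (\<lambda>x. \<bar>x - \<psi>\<bar> ^ k * exp (- \<bar>x - \<psi>\<bar> / b))
     (b ^ (k + 1) * (LINT z|lborel. \<bar>z\<bar> ^ k * exp (- \<bar>z\<bar>)))"
proof -
  let ?f = "\<lambda>z::real. \<bar>z\<bar> ^ k * exp (- \<bar>z\<bar>)"
  have eq: "\<bar>x - \<psi>\<bar> ^ k * exp (- \<bar>x - \<psi>\<bar> / b) = b ^ k * ?f (- \<psi> / b + 1 / b * x)" for x
  proof -
    have "- \<psi> / b + 1 / b * x = (x - \<psi>) / b" by (simp add: diff_divide_distrib)
    then show ?thesis using b by (simp add: power_divide abs_divide)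
  qed
  have "integrable lborel (\<lambda>x. ?f (- \<psi> / b + 1 / b * x))"
    by (rule lborel_integrable_real_affine[OF integrable_abs_power_exp]) (use b in simp)
  moreover have "(LINT z|lborel. ?f z) = 1 / b * (LINT x|lborel. ?f (- \<psi> / b + 1 / b * x))"
    using b by (subst lborel_integral_real_affine[of "1 / b" _ "- \<psi> / b"]) auto
  ultimately show ?thesis unfolding eq using b by (simp add: has_bochner_integral_iff)
qed

context exp_density begin

text \<open>The peak height \<open>E\<close> is common to both bounds of the unnormalised density.
  The normalising integral is comparable to \<open>E * \<sigma>\<close>, so \<open>E\<close> cancels
  and only the width is left.\<close>

lemma tilt_dens_sandwich:
  assumes A: "A > 0" and a0: "a0 > 0" and E: "E > 0" and \<sigma>: "\<sigma> > 0"
    and up: "\<And>x. x \<ge> 0 \<Longrightarrow> exp (t * x) * p x \<le> A * E * exp (- \<bar>x - \<psi>\<bar> / (A * \<sigma>))"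
    and lo: "\<And>x. \<bar>x - \<psi>\<bar> \<le> \<sigma> \<Longrightarrow> a0 * E \<le> exp (t * x) * p x"
  shows "tilt_dens t x \<le> A / (2 * a0) / \<sigma> * exp (- \<bar>x - \<psi>\<bar> / (A * \<sigma>))"
    and "\<bar>x - \<psi>\<bar> \<le> \<sigma> \<Longrightarrow> a0 / (A\<^sup>2 * (1 + (LINT z|lborel. \<bar>z\<bar> ^ 0 * exp (- \<bar>z::real\<bar>)))) / \<sigma> \<le> tilt_dens t x"
proof -
  define L where "L = (LINT z|lborel. \<bar>z\<bar> ^ 0 * exp (- \<bar>z::real\<bar>))"
  have L: "L \<ge> 0" unfolding L_def by (intro integral_nonneg_AE) auto
  have up': "exp (t * x) * p x \<le> A * E * exp (- \<bar>x - \<psi>\<bar> / (A * \<sigma>))" for x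
    using up[of x] A E by (cases "x \<ge> 0") (auto simp: p_neg)
  have low: "2 * \<sigma> * (a0 * E) \<le> emom 0 t"
  proof -
    have "2 * \<sigma> * (a0 * E) = (LINT x|lborel. a0 * E * indicator {\<psi> - \<sigma>..\<psi> + \<sigma>} x)" using \<sigma> by simp
    also have "\<dots> \<le> (LINT x|lborel. exp (t * x) * p x)"
    proof (rule integral_mono[OF _ exp_int])
      show "a0 * E * indicator {\<psi> - \<sigma>..\<psi> + \<sigma>} x \<le> exp (t * x) * p x" for x
        using lo[of x] p_nonneg[of x] by (auto simp: indicator_def abs_le_iff)
    qed (use \<sigma> in simp)
    finally show ?thesis by (simp add: emom_def)
  qed
  have high: "emom 0 t \<le> A * E * (A * \<sigma> * L)"
  proof -
    have mo: "has_bochner_integral lborel (\<lambda>x. \<bar>x - \<psi>\<bar> ^ 0 * exp (- \<bar>x - \<psi>\<bar> / (A * \<sigma>))) ((A * \<sigma>) ^ (0 + 1) * L)"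
      unfolding L_def by (rule laplace_moment) (use A \<sigma> in simp)
    have "emom 0 t \<le> (LINT x|lborel. A * E * exp (- \<bar>x - \<psi>\<bar> / (A * \<sigma>)))"
      unfolding emom_def using mo up' exp_int[of t] by (intro integral_mono) (auto simp: has_bochner_integral_iff)
    also have "\<dots> = A * E * (A * \<sigma> * L)" using mo by (simp add: has_bochner_integral_iff)
    finally show ?thesis .
  qed
  have "tilt_dens t x \<le> A * E * exp (- \<bar>x - \<psi>\<bar> / (A * \<sigma>)) / (2 * \<sigma> * (a0 * E))"
    unfolding tilt_dens_def using up' low A E \<sigma> a0 p_nonneg by (intro frac_le) auto
  also have "\<dots> = A / (2 * a0) / \<sigma> * exp (- \<bar>x - \<psi>\<bar> / (A * \<sigma>))"
    using E a0 \<sigma> by (simp add: field_simps)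
  finally show "tilt_dens t x \<le> A / (2 * a0) / \<sigma> * exp (- \<bar>x - \<psi>\<bar> / (A * \<sigma>))" .
  show "a0 / (A\<^sup>2 * (1 + L)) / \<sigma> \<le> tilt_dens t x" if "\<bar>x - \<psi>\<bar> \<le> \<sigma>"
  proof -
    have "a0 / (A\<^sup>2 * (1 + L)) / \<sigma> = a0 * E / (A * E * (A * \<sigma> * (1 + L)))"
    proof -
      define L1 where "L1 = 1 + L"
      have "L1 > 0" using L by (simp add: L1_def)
      then show ?thesis unfolding L1_def[symmetric] using A E \<sigma> by (simp add: field_simps power2_eq_square)
    qed
    also have "\<dots> \<le> exp (t * x) * p x / emom 0 t"
    proof (rule frac_le)
      have "A * E * (A * \<sigma> * L) \<le> A * E * (A * \<sigma> * (1 + L))"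
        using A E \<sigma> by (intro mult_left_mono) auto
      then show "emom 0 t \<le> A * E * (A * \<sigma> * (1 + L))" using high by linarith
    qed (use lo[OF that] emom0_pos p_nonneg in auto)
    finally show ?thesis by (simp add: tilt_dens_def)
  qed
qed

text \<open>The exponential majorant bounds all absolute moments about \<psi>, hence the
  displacement of the mean, and then the central moments. Only the lower bound of the variance uses
  the minorant. Nothing but \<open>K\<close> enters, so \<open>D\<close> is uniform in
  \<open>t\<close>.\<close>

lemma tilt_moments_bounded:
  assumes K: "K \<ge> 1"
  shows "\<exists>D\<ge>1. \<forall>t \<psi> \<sigma>. \<sigma> > 0 \<longrightarrow> (\<forall>x. tilt_dens t x \<le> K / \<sigma> * exp (- \<bar>x - \<psi>\<bar> / (K * \<sigma>))) \<longrightarrow>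
     (\<forall>x. \<bar>x - \<psi>\<bar> \<le> \<sigma> \<longrightarrow> 1 / (K * \<sigma>) \<le> tilt_dens t x) \<longrightarrow>
     \<bar>tilt_mean p t - \<psi>\<bar> \<le> D * \<sigma> \<and> \<sigma>\<^sup>2 \<le> D * tilt_var t \<and> tilt_var t \<le> D * \<sigma>\<^sup>2 \<and>
     (LINT x|lborel. tilt_dens t x * \<bar>x - tilt_mean p t\<bar> ^ 3) \<le> D * \<sigma> ^ 3"
proof -
  define L where "L = (\<lambda>k. LINT z|lborel. \<bar>z\<bar> ^ k * exp (- \<bar>z::real\<bar>))"
  have L: "L k \<ge> 0" for k unfolding L_def by (intro integral_nonneg_AE) auto
  define c where "c = (\<lambda>k. K ^ (k + 2) * L k)"
  have c: "c k \<ge> 0" for k unfolding c_def using K L by simp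
  define D where "D = c 1 + 2 * c 2 + 2 * (c 1)\<^sup>2 + 4 * c 3 + 4 * (c 1) ^ 3 + 8 * K + 1"
  have nn: "0 \<le> c 1" "0 \<le> c 2" "0 \<le> c 3" "0 \<le> (c 1)\<^sup>2" "0 \<le> (c 1) ^ 3" using c by auto
  show ?thesis
  proof (intro exI[of _ D] conjI[of "1 \<le> D"] allI impI)
    show "1 \<le> D" using nn K by (simp add: D_def)
    fix t \<psi> \<sigma> :: real
    assume \<sigma>: "\<sigma> > 0" and up: "\<forall>x. tilt_dens t x \<le> K / \<sigma> * exp (- \<bar>x - \<psi>\<bar> / (K * \<sigma>))"
      and lo: "\<forall>x. \<bar>x - \<psi>\<bar> \<le> \<sigma> \<longrightarrow> 1 / (K * \<sigma>) \<le> tilt_dens t x"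
    define m where "m = tilt_mean p t"
    define w where "w = tilt_dens t"
    have wm[measurable]: "w \<in> borel_measurable borel" unfolding w_def by measurable
    have w0: "w x \<ge> 0" for x unfolding w_def by (rule tilt_dens_nonneg)
    have mom: "integrable lborel (\<lambda>x. w x * \<bar>x - \<psi>\<bar> ^ k)" "(LINT x|lborel. w x * \<bar>x - \<psi>\<bar> ^ k) \<le> c k * \<sigma> ^ k" for k
    proof -
      have "has_bochner_integral lborel (\<lambda>x. \<bar>x - \<psi>\<bar> ^ k * exp (- \<bar>x - \<psi>\<bar> / (K * \<sigma>))) ((K * \<sigma>) ^ (k + 1) * L k)"
        unfolding L_def by (rule laplace_moment) (use K \<sigma> in simp)
      then have mo: "has_bochner_integral lborel (\<lambda>x. K / \<sigma> * (\<bar>x - \<psi>\<bar> ^ k * exp (- \<bar>x - \<psi>\<bar> / (K * \<sigma>))))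
         (K / \<sigma> * ((K * \<sigma>) ^ (k + 1) * L k))"
        by (rule has_bochner_integral_mult_right)
      have le: "w x * \<bar>x - \<psi>\<bar> ^ k \<le> K / \<sigma> * (\<bar>x - \<psi>\<bar> ^ k * exp (- \<bar>x - \<psi>\<bar> / (K * \<sigma>)))" for x
        using mult_right_mono[OF up[rule_format, of x], of "\<bar>x - \<psi>\<bar> ^ k"] by (simp add: w_def mult_ac)
      show i: "integrable lborel (\<lambda>x. w x * \<bar>x - \<psi>\<bar> ^ k)"
      proof (rule Bochner_Integration.integrable_bound)
        show "integrable lborel (\<lambda>x. K / \<sigma> * (\<bar>x - \<psi>\<bar> ^ k * exp (- \<bar>x - \<psi>\<bar> / (K * \<sigma>))))"
          using mo by (simp add: has_bochner_integral_iff)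
        show "AE x in lborel. norm (w x * \<bar>x - \<psi>\<bar> ^ k) \<le> norm (K / \<sigma> * (\<bar>x - \<psi>\<bar> ^ k * exp (- \<bar>x - \<psi>\<bar> / (K * \<sigma>))))"
        proof (rule AE_I2)
          fix x
          show "norm (w x * \<bar>x - \<psi>\<bar> ^ k) \<le> norm (K / \<sigma> * (\<bar>x - \<psi>\<bar> ^ k * exp (- \<bar>x - \<psi>\<bar> / (K * \<sigma>))))"
            using order_trans[OF le[of x] abs_ge_self] w0[of x] by (simp add: abs_mult)
        qed
      qed simp
      have "(LINT x|lborel. w x * \<bar>x - \<psi>\<bar> ^ k) \<le> (LINT x|lborel. K / \<sigma> * (\<bar>x - \<psi>\<bar> ^ k * exp (- \<bar>x - \<psi>\<bar> / (K * \<sigma>))))"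
        using i mo le by (intro integral_mono) (auto simp: has_bochner_integral_iff)
      also have "\<dots> = K / \<sigma> * ((K * \<sigma>) ^ (k + 1) * L k)"
        using mo by (rule has_bochner_integral_integral_eq)
      also have "\<dots> = c k * \<sigma> ^ k" using \<sigma> by (simp add: c_def power_mult_distrib)
      finally show "(LINT x|lborel. w x * \<bar>x - \<psi>\<bar> ^ k) \<le> c k * \<sigma> ^ k" .
    qed
    have w1: "has_bochner_integral lborel w 1"
      using tilt_dens_moment[of t 0] emom0_pos[of t] by (simp add: w_def)
    have mean: "\<bar>m - \<psi>\<bar> \<le> c 1 * \<sigma>"
    proof -
      have "has_bochner_integral lborel (\<lambda>x. w x * (x - m) + (m - \<psi>) * w x) (0 + (m - \<psi>) * 1)"
        using tilt_central1[of t] w1 by (intro has_bochner_integral_add has_bochner_integral_mult_right) (auto simp: w_def m_def)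
      then have "m - \<psi> = (LINT x|lborel. w x * (x - \<psi>))"
        by (simp add: has_bochner_integral_iff algebra_simps)
      also have "\<bar>\<dots>\<bar> \<le> (LINT x|lborel. \<bar>w x * (x - \<psi>)\<bar>)" by (rule integral_abs_bound)
      also have "\<dots> = (LINT x|lborel. w x * \<bar>x - \<psi>\<bar> ^ 1)" using w0 by (simp add: abs_mult)
      also have "\<dots> \<le> c 1 * \<sigma> ^ 1" by (rule mom)
      finally show ?thesis by simp
    qed
    have var_int: "has_bochner_integral lborel (\<lambda>x. w x * (x - m)\<^sup>2) (tilt_var t)"
      unfolding w_def m_def by (rule tilt_central2)
    have var_up: "tilt_var t \<le> (2 * c 2 + 2 * (c 1)\<^sup>2) * \<sigma>\<^sup>2"
    proof -
      have i: "has_bochner_integral lborel (\<lambda>x. 2 * (w x * \<bar>x - \<psi>\<bar> ^ 2) + 2 * (c 1 * \<sigma>)\<^sup>2 * w x)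
         (2 * (LINT x|lborel. w x * \<bar>x - \<psi>\<bar> ^ 2) + 2 * (c 1 * \<sigma>)\<^sup>2 * 1)"
        by (intro has_bochner_integral_add has_bochner_integral_mult_right has_bochner_integral_integrable mom w1)
      have "w x * (x - m)\<^sup>2 \<le> 2 * (w x * \<bar>x - \<psi>\<bar> ^ 2) + 2 * (c 1 * \<sigma>)\<^sup>2 * w x" for x
      proof -
        have "(x - m)\<^sup>2 \<le> 2 * (x - \<psi>)\<^sup>2 + 2 * (m - \<psi>)\<^sup>2"
          using zero_le_power2[of "(x - \<psi>) + (m - \<psi>)"] by (simp add: power2_eq_square algebra_simps)
        also have "(m - \<psi>)\<^sup>2 \<le> (c 1 * \<sigma>)\<^sup>2" using mean c[of 1] \<sigma> by (intro power2_le_iff_abs_le[THEN iffD2]) auto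
        finally have "w x * (x - m)\<^sup>2 \<le> w x * (2 * (x - \<psi>)\<^sup>2 + 2 * (c 1 * \<sigma>)\<^sup>2)"
          using w0 by (intro mult_left_mono) auto
        then show ?thesis by (simp add: algebra_simps)
      qed
      then have "tilt_var t \<le> 2 * (LINT x|lborel. w x * \<bar>x - \<psi>\<bar> ^ 2) + 2 * (c 1 * \<sigma>)\<^sup>2 * 1"
        using has_bochner_integral_integral_eq[OF var_int] has_bochner_integral_integral_eq[OF i]
          integral_mono[of lborel "\<lambda>x. w x * (x - m)\<^sup>2" "\<lambda>x. 2 * (w x * \<bar>x - \<psi>\<bar> ^ 2) + 2 * (c 1 * \<sigma>)\<^sup>2 * w x"]
          var_int i unfolding has_bochner_integral_iff by metis
      also have "\<dots> \<le> 2 * (c 2 * \<sigma> ^ 2) + 2 * (c 1 * \<sigma>)\<^sup>2 * 1" using mom(2)[of 2] by simp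
      finally show ?thesis by (simp add: algebra_simps power_mult_distrib)
    qed
    have third: "(LINT x|lborel. w x * \<bar>x - m\<bar> ^ 3) \<le> (4 * c 3 + 4 * (c 1) ^ 3) * \<sigma> ^ 3"
    proof -
      have i: "has_bochner_integral lborel (\<lambda>x. 4 * (w x * \<bar>x - \<psi>\<bar> ^ 3) + 4 * (c 1 * \<sigma>) ^ 3 * w x)
         (4 * (LINT x|lborel. w x * \<bar>x - \<psi>\<bar> ^ 3) + 4 * (c 1 * \<sigma>) ^ 3 * 1)"
        by (intro has_bochner_integral_add has_bochner_integral_mult_right has_bochner_integral_integrable mom w1)
      have cube: "(u + v) ^ 3 \<le> 4 * u ^ 3 + 4 * v ^ 3" if "u \<ge> 0" "v \<ge> 0" for u v :: real
      proof -
        have "4 * u ^ 3 + 4 * v ^ 3 - (u + v) ^ 3 = 3 * (u + v) * (u - v)\<^sup>2"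
          by (simp add: power3_eq_cube power2_eq_square algebra_simps)
        also have "\<dots> \<ge> 0" using that by simp
        finally show ?thesis by simp
      qed
      have pt: "w x * \<bar>x - m\<bar> ^ 3 \<le> 4 * (w x * \<bar>x - \<psi>\<bar> ^ 3) + 4 * (c 1 * \<sigma>) ^ 3 * w x" for x
      proof -
        have "\<bar>x - m\<bar> \<le> \<bar>x - \<psi>\<bar> + c 1 * \<sigma>" using mean by linarith
        then have "\<bar>x - m\<bar> ^ 3 \<le> (\<bar>x - \<psi>\<bar> + c 1 * \<sigma>) ^ 3" by (intro power_mono) auto
        also have "\<dots> \<le> 4 * \<bar>x - \<psi>\<bar> ^ 3 + 4 * (c 1 * \<sigma>) ^ 3" using c[of 1] \<sigma> by (intro cube) auto
        finally have "w x * \<bar>x - m\<bar> ^ 3 \<le> w x * (4 * \<bar>x - \<psi>\<bar> ^ 3 + 4 * (c 1 * \<sigma>) ^ 3)"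
          using w0 by (intro mult_left_mono) auto
        then show ?thesis by (simp add: algebra_simps)
      qed
      have "(LINT x|lborel. w x * \<bar>x - m\<bar> ^ 3) \<le> (LINT x|lborel. 4 * (w x * \<bar>x - \<psi>\<bar> ^ 3) + 4 * (c 1 * \<sigma>) ^ 3 * w x)"
      proof (rule integral_mono)
        show "integrable lborel (\<lambda>x. w x * \<bar>x - m\<bar> ^ 3)" unfolding w_def m_def by (rule abs_third_integrable)
        show "integrable lborel (\<lambda>x. 4 * (w x * \<bar>x - \<psi>\<bar> ^ 3) + 4 * (c 1 * \<sigma>) ^ 3 * w x)"
          using i unfolding has_bochner_integral_iff by blast
      qed (rule pt)
      also have "\<dots> = 4 * (LINT x|lborel. w x * \<bar>x - \<psi>\<bar> ^ 3) + 4 * (c 1 * \<sigma>) ^ 3 * 1"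
        using i by (rule has_bochner_integral_integral_eq)
      also have "\<dots> \<le> 4 * (c 3 * \<sigma> ^ 3) + 4 * (c 1 * \<sigma>) ^ 3 * 1" using mom(2)[of 3] by simp
      finally show ?thesis by (simp add: algebra_simps power_mult_distrib)
    qed
    have var_lo: "\<sigma>\<^sup>2 \<le> 8 * K * tilt_var t"
    proof -
      \<comment> \<open>The outer half of the window on the side of \<psi> opposite to the mean
        keeps a distance of at least \<open>\<sigma> / 2\<close> from the mean. Its share of the
        variance is at least
        \<open>(\<sigma> / 2)\<^sup>2 * (\<sigma> / 2) / (K * \<sigma>)\<close>, which explains the
        constant \<open>8 * K\<close>.\<close>
      obtain u v where uv: "v - u = \<sigma> / 2" "\<And>x. u \<le> x \<Longrightarrow> x \<le> v \<Longrightarrow> \<bar>x - \<psi>\<bar> \<le> \<sigma> \<and> \<sigma> / 2 \<le> \<bar>x - m\<bar>"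
      proof (cases "m \<le> \<psi>")
        case True
        show ?thesis
          by (rule that[of "\<psi> + \<sigma>" "\<psi> + \<sigma> / 2"]) (use True \<sigma> in \<open>auto simp: abs_if\<close>)
      next
        case False
        show ?thesis
          by (rule that[of "\<psi> - \<sigma> / 2" "\<psi> - \<sigma>"]) (use False \<sigma> in \<open>auto simp: abs_if\<close>)
      qed
      have "1 / (K * \<sigma>) * (\<sigma> / 2)\<^sup>2 * (\<sigma> / 2) = (LINT x|lborel. 1 / (K * \<sigma>) * (\<sigma> / 2)\<^sup>2 * indicator {u..v} x)"
      proof -
        have "u \<le> v" using uv(1) \<sigma> by linarith
        then have "(LINT x|lborel. 1 / (K * \<sigma>) * (\<sigma> / 2)\<^sup>2 * indicator {u..v} x) = 1 / (K * \<sigma>) * (\<sigma> / 2)\<^sup>2 * (v - u)"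
          by simp
        then show ?thesis unfolding uv(1) by simp
      qed
      also have "\<dots> \<le> (LINT x|lborel. w x * (x - m)\<^sup>2)"
      proof (rule integral_mono)
        show "integrable lborel (\<lambda>x. w x * (x - m)\<^sup>2)" using var_int by (simp add: has_bochner_integral_iff)
        fix x
        show "1 / (K * \<sigma>) * (\<sigma> / 2)\<^sup>2 * indicator {u..v} x \<le> w x * (x - m)\<^sup>2"
        proof (cases "x \<in> {u..v}")
          case True
          have "(\<sigma> / 2)\<^sup>2 \<le> (x - m)\<^sup>2" using uv(2)[of x] True \<sigma> by (intro abs_le_square_iff[THEN iffD1]) auto
          moreover have "1 / (K * \<sigma>) \<le> w x" using lo uv(2)[of x] True by (auto simp: w_def)
          ultimately have "1 / (K * \<sigma>) * (\<sigma> / 2)\<^sup>2 \<le> w x * (x - m)\<^sup>2" using w0 by (intro mult_mono) auto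
          then show ?thesis using True by simp
        qed (use w0 in simp)
        show "integrable lborel (\<lambda>x. 1 / (K * \<sigma>) * (\<sigma> / 2)\<^sup>2 * indicator {u..v} x)"
          by (intro integrable_mult_right integrable_real_indicator) (auto simp: emeasure_lborel_Icc_eq)
      qed
      also have "\<dots> = tilt_var t" using var_int by (rule has_bochner_integral_integral_eq)
      finally have "\<sigma>\<^sup>2 / (8 * K) \<le> tilt_var t" using \<sigma> by (simp add: power2_eq_square)
      then show ?thesis using K by (simp add: divide_le_eq mult_ac)
    qed
    have mm: "a * x \<le> D * x" if "a \<le> D" "x \<ge> 0" for a x using that by (intro mult_right_mono) auto
    have dle: "c 1 \<le> D" "8 * K \<le> D" "2 * c 2 + 2 * (c 1)\<^sup>2 \<le> D" "4 * c 3 + 4 * (c 1) ^ 3 \<le> D"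
      using nn K unfolding D_def by linarith+
    have "\<bar>tilt_mean p t - \<psi>\<bar> \<le> D * \<sigma>"
      using order_trans[OF mean mm[OF dle(1)]] \<sigma> by (simp add: m_def)
    moreover have "\<sigma>\<^sup>2 \<le> D * tilt_var t"
      using order_trans[OF var_lo mm[OF dle(2)]] tilt_var_pos[of t] by simp
    moreover have "tilt_var t \<le> D * \<sigma>\<^sup>2"
      using order_trans[OF var_up mm[OF dle(3)]] by simp
    moreover have "(LINT x|lborel. tilt_dens t x * \<bar>x - tilt_mean p t\<bar> ^ 3) \<le> D * \<sigma> ^ 3"
      using order_trans[OF third mm[OF dle(4)]] \<sigma> by (simp add: w_def m_def)
    ultimately show "\<bar>tilt_mean p t - \<psi>\<bar> \<le> D * \<sigma> \<and> \<sigma>\<^sup>2 \<le> D * tilt_var t \<and> tilt_var t \<le> D * \<sigma>\<^sup>2 \<and>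
     (LINT x|lborel. tilt_dens t x * \<bar>x - tilt_mean p t\<bar> ^ 3) \<le> D * \<sigma> ^ 3" by blast
  qed
qed



text \<open>The interface to the probabilistic part. Membership in \<open>std_density\<close> and
  the bound on the third moment make the constants uniform. The bound
  \<open>h (tilt_mean p t) \<le> 2 * t\<close> serves the hypothesis on \<eta>; the comparisons of
  the mean with \<open>\<psi>(t)\<close> and of \<open>\<psi>'(t)\<close> with the variance
  translate the growth hypothesis into one on \<open>a\<^sup>2 / s\<^sup>2\<close>.\<close>

lemma uniform_tilt_estimates:
  fixes g h h' q :: "real \<Rightarrow> real"
  assumes R0: "regular_rate h h' X0 C" and gd: "\<And>x. x > 0 \<Longrightarrow> (g has_real_derivative h x) (at x)"
    and c: "c > 0" and p_eq: "\<And>x. x \<ge> 0 \<Longrightarrow> p x = c * exp (- (g x - q x))"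
    and Bp: "\<And>x. p x \<le> Bp" and q: "\<forall>\<^sub>F x in at_top. \<bar>q x\<bar> \<le> 1"
  shows "\<exists>D\<ge>1. \<exists>B>0. \<exists>c'>0. \<exists>r>0. \<exists>T. \<forall>t\<ge>T.
     std_density D B c' r (\<lambda>z. tilt_sd p t * tilt_dens t (tilt_mean p t + tilt_sd p t * z)) \<and>
     \<bar>tilt_third t\<bar> \<le> D * tilt_sd p t ^ 3 \<and> h (tilt_mean p t) \<le> 2 * t \<and>
     tilt_mean p t \<le> D * gen_inverse h t \<and> 0 < deriv (gen_inverse h) t \<and> deriv (gen_inverse h) t \<le> D * tilt_var t"
    and "\<exists>T. \<forall>t\<ge>T. N \<le> t * tilt_sd p t"
proof -
  obtain Xq where Xq: "\<And>x. x \<ge> Xq \<Longrightarrow> \<bar>q x\<bar> \<le> 1" using q unfolding eventually_at_top_linorder by blast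
  define X where "X = max X0 Xq"
  have R: "regular_rate h h' X C"
    using R0 unfolding regular_rate_def X_def by auto
  have X: "X > 0" and C: "C \<ge> 1" and h'p: "\<And>x. x \<ge> X \<Longrightarrow> 0 < h' x" and hX: "h X > 0"
    using R unfolding regular_rate_def by blast+
  have qX: "\<And>x. x \<ge> X \<Longrightarrow> \<bar>q x\<bar> \<le> 1" using Xq by (simp add: X_def)
  have gdX: "\<And>x. x \<ge> X \<Longrightarrow> (g has_real_derivative h x) (at x)" using gd X by force
  have Bp0: "Bp > 0" using Bp[of 0] p_pos[of 0] by simp
  define L where "L = 1 + (LINT z|lborel. \<bar>z\<bar> ^ 0 * exp (- \<bar>z::real\<bar>))"
  have "0 \<le> (LINT z|lborel. \<bar>z\<bar> ^ 0 * exp (- \<bar>z::real\<bar>))" by (intro integral_nonneg_AE) auto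
  then have L: "L \<ge> 1" by (simp only: L_def)
  \<comment> \<open>The first summand serves arguments below \<open>X\<close>, the second those
    beyond, where \<open>q <= 1\<close>. The third widens the bump enough for its decay at
    \<open>X\<close> to serve all arguments in \<open>[0, X)\<close> too.\<close>
  define A where "A = Bp * exp (g X + 1) + c * exp 2 + 4 * C"
  define a0 where "a0 = c * exp (- 1 - C)"
  have A: "A > 0" "Bp * exp (g X + 1) \<le> A" "c * exp 2 \<le> A" "4 * C \<le> A"
  proof -
    have "0 < Bp * exp (g X + 1)" "0 < c * exp 2" using Bp0 c by simp_all
    then show "A > 0" "Bp * exp (g X + 1) \<le> A" "c * exp 2 \<le> A" "4 * C \<le> A"
      using C unfolding A_def by linarith+
  qed
  have a0: "a0 > 0" using c by (simp add: a0_def)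
  define K where "K = A + A / (2 * a0) + A\<^sup>2 * L / a0 + 1"
  have K: "K \<ge> 1" "A \<le> K" "A / (2 * a0) \<le> K" "A\<^sup>2 * L / a0 \<le> K"
  proof -
    have "0 \<le> A / (2 * a0)" "0 \<le> A\<^sup>2 * L / a0" using A(1) a0 L by simp_all
    then show "K \<ge> 1" "A \<le> K" "A / (2 * a0) \<le> K" "A\<^sup>2 * L / a0 \<le> K"
      using A(1) unfolding K_def by linarith+
  qed
  obtain D where D: "D \<ge> 1" and mom: "\<And>t \<psi> \<sigma>. \<sigma> > 0 \<Longrightarrow> (\<forall>x. tilt_dens t x \<le> K / \<sigma> * exp (- \<bar>x - \<psi>\<bar> / (K * \<sigma>))) \<Longrightarrow>
     (\<forall>x. \<bar>x - \<psi>\<bar> \<le> \<sigma> \<longrightarrow> 1 / (K * \<sigma>) \<le> tilt_dens t x) \<Longrightarrow>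
     \<bar>tilt_mean p t - \<psi>\<bar> \<le> D * \<sigma> \<and> \<sigma>\<^sup>2 \<le> D * tilt_var t \<and> tilt_var t \<le> D * \<sigma>\<^sup>2 \<and>
     (LINT x|lborel. tilt_dens t x * \<bar>x - tilt_mean p t\<bar> ^ 3) \<le> D * \<sigma> ^ 3"
    using tilt_moments_bounded[OF K(1)] by blast
  \<comment> \<open>A window of \<open>D\<close> widths contains the mean, so that \<open>h\<close>
    at the mean is compared with \<open>t\<close>; as \<open>D >= 1\<close> it contains the window
    of one width as well.\<close>
  obtain T1 where T1: "T1 > h X" "\<And>t x. t \<ge> T1 \<Longrightarrow> \<bar>x - gen_inverse h t\<bar> \<le> D * (1 / sqrt (h' (gen_inverse h t))) \<Longrightarrow>
     X \<le> x \<and> t / 2 \<le> h x \<and> h x \<le> 2 * t"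
    using regular_rate_window[OF R, of D] D by auto
  define T where "T = max T1 (h (2 * X) + 1)"
  define \<psi> where "\<psi> = (\<lambda>t. gen_inverse h t)"
  define \<sigma> where "\<sigma> = (\<lambda>t. 1 / sqrt (h' (\<psi> t)))"
  have basic: "X < \<psi> t" "2 * X \<le> \<psi> t" "h (\<psi> t) = t" "\<sigma> t > 0" "h' (\<psi> t) = 1 / (\<sigma> t)\<^sup>2"
    "deriv (gen_inverse h) t = (\<sigma> t)\<^sup>2" "\<sigma> t \<le> \<psi> t"
    and win: "\<And>x. \<bar>x - \<psi> t\<bar> \<le> D * \<sigma> t \<Longrightarrow> X \<le> x \<and> t / 2 \<le> h x \<and> h x \<le> 2 * t"
    and win1: "\<And>x. \<bar>x - \<psi> t\<bar> \<le> \<sigma> t \<Longrightarrow> X \<le> x \<and> t / 2 \<le> h x \<and> h x \<le> 2 * t" if t: "t \<ge> T" for t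
  proof -
    have tX: "h X < t" using t T1 by (simp add: T_def)
    note inv = regular_rate_inverse[OF R tX, folded \<psi>_def]
    show \<psi>: "X < \<psi> t" "h (\<psi> t) = t" using inv by (auto simp: \<psi>_def)
    show \<sigma>: "\<sigma> t > 0" "h' (\<psi> t) = 1 / (\<sigma> t)\<^sup>2" using h'p[of "\<psi> t"] \<psi> by (auto simp: \<sigma>_def power_divide)
    show "deriv (gen_inverse h) t = (\<sigma> t)\<^sup>2" using inv(3) \<sigma> by (simp add: \<psi>_def)
    show "2 * X \<le> \<psi> t"
    proof (rule ccontr)
      assume "\<not> 2 * X \<le> \<psi> t"
      then have "h (\<psi> t) \<le> h (2 * X)" using \<psi> by (intro regular_rate_mono[OF R]) auto
      then show False using t \<psi> by (simp add: T_def)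
    qed
    show w: "X \<le> x \<and> t / 2 \<le> h x \<and> h x \<le> 2 * t" if "\<bar>x - \<psi> t\<bar> \<le> D * \<sigma> t" for x
      using T1(2)[of t x] t that by (simp add: T_def \<sigma>_def \<psi>_def)
    have D\<sigma>: "\<sigma> t \<le> D * \<sigma> t" using D \<sigma> by simp
    show w1: "X \<le> x \<and> t / 2 \<le> h x \<and> h x \<le> 2 * t" if "\<bar>x - \<psi> t\<bar> \<le> \<sigma> t" for x
      using w[of x] that D\<sigma> by simp
    \<comment> \<open>The left end of the window is still beyond \<open>X\<close>, hence positive.
      This turns bounds by the width into bounds by \<open>\<psi>\<close>.\<close>
    show "\<sigma> t \<le> \<psi> t" using w1[of "\<psi> t - \<sigma> t"] \<sigma> X by simp
  qed
  have sand: "(\<forall>x. tilt_dens t x \<le> K / \<sigma> t * exp (- \<bar>x - \<psi> t\<bar> / (K * \<sigma> t)))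
      \<and> (\<forall>x. \<bar>x - \<psi> t\<bar> \<le> \<sigma> t \<longrightarrow> 1 / (K * \<sigma> t) \<le> tilt_dens t x)" if t: "t \<ge> T" for t
  proof -
    define y where "y = \<psi> t"
    define s where "s = \<sigma> t"
    note b = basic[OF t, folded y_def s_def]
    have w1: "\<And>x. \<bar>x - y\<bar> \<le> s \<Longrightarrow> X \<le> x \<and> t / 2 \<le> h x \<and> h x \<le> 2 * t"
      using win1[OF t] by (simp add: y_def s_def)
    have lap1: "t * y - g y - C \<le> t * x - g x" if "\<bar>x - y\<bar> \<le> s" for x
      using gdX w1 that by (rule laplace_exponent_bounds(1)[OF R _ b(1,3,4,5)])
    have lap2: "t * x - g x \<le> t * y - g y + 1 - \<bar>x - y\<bar> / (2 * C * s)" if "X \<le> x" for x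
      using gdX w1 that by (rule laplace_exponent_bounds(2)[OF R _ b(1,3,4,5)])
    have t0: "t > 0" using t T1 hX by (simp add: T_def)
    define E where "E = exp (t * y - g y)"
    have E: "E > 0" by (simp add: E_def)
    have ew: "exp (- \<bar>x - y\<bar> / (2 * C * s)) \<le> exp (- \<bar>x - y\<bar> / (A * s))" for x
      using A C b(4) by (simp add: frac_le)
    have up: "exp (t * x) * p x \<le> A * E * exp (- \<bar>x - y\<bar> / (A * s))" if x: "x \<ge> 0" for x
    proof (cases "X \<le> x")
      case True
      have "exp (t * x) * p x = c * exp (t * x - g x + q x)"
        using p_eq[OF x] by (simp add: exp_add[symmetric] mult.left_commute algebra_simps)
      also have "\<dots> \<le> c * exp ((t * y - g y + 1 - \<bar>x - y\<bar> / (2 * C * s)) + 1)"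
        using lap2[OF True] qX[OF True] c by (intro mult_left_mono) (auto simp: abs_le_iff)
      also have "\<dots> = c * exp 2 * E * exp (- \<bar>x - y\<bar> / (2 * C * s))"
        by (simp add: E_def exp_add[symmetric] mult.assoc)
      also have "\<dots> \<le> A * E * exp (- \<bar>x - y\<bar> / (A * s))"
        using A E c ew[of x] by (intro mult_mono) auto
      finally show ?thesis .
    next
      case False
      \<comment> \<open>Below \<open>X\<close> the exponent is not controlled. As
        \<open>t > 0\<close>, the bound on \<open>p\<close> and monotonicity of
        \<open>exp (t * x)\<close> refer the estimate to the point \<open>X\<close>, where the
        Laplace bound holds.\<close>
      have "exp (t * x) * p x \<le> exp (t * X) * Bp"
        using False t0 Bp p_nonneg by (intro mult_mono) auto
      also have "\<dots> = Bp * exp (g X) * exp (t * X - g X)" by (simp add: exp_diff)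
      also have "\<dots> \<le> Bp * exp (g X) * exp (t * y - g y + 1 - \<bar>X - y\<bar> / (2 * C * s))"
        using lap2[of X] Bp0 by (intro mult_left_mono) auto
      also have "\<dots> = Bp * exp (g X + 1) * E * exp (- \<bar>X - y\<bar> / (2 * C * s))"
        by (simp add: E_def exp_add[symmetric] mult.assoc)
      also have "\<dots> \<le> A * E * exp (- \<bar>x - y\<bar> / (A * s))"
      proof (intro mult_mono)
        \<comment> \<open>\<open>T\<close> was chosen with \<open>y >= 2 * X\<close>; hence
          \<open>y - x <= y <= 2 * (y - X)\<close>, and the factor 2 is absorbed by
          \<open>A >= 4 * C\<close>.\<close>
        have "\<bar>x - y\<bar> / (A * s) \<le> (2 * \<bar>X - y\<bar>) / (4 * C * s)"
          using A C b x False by (intro frac_le) auto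
        then show "exp (- \<bar>X - y\<bar> / (2 * C * s)) \<le> exp (- \<bar>x - y\<bar> / (A * s))" by simp
      qed (use A E Bp0 in auto)
      finally show ?thesis .
    qed
    have lo: "a0 * E \<le> exp (t * x) * p x" if x: "\<bar>x - y\<bar> \<le> s" for x
    proof -
      have "X \<le> x" using w1[OF x] by simp
      then have x0: "x \<ge> 0" using X by simp
      have "a0 * E = c * exp ((t * y - g y - C) + - 1)" by (simp add: a0_def E_def exp_add[symmetric] mult.assoc)
      also have "\<dots> \<le> c * exp (t * x - g x + q x)"
        using lap1[OF x] qX[OF \<open>X \<le> x\<close>] c by (intro mult_left_mono) (auto simp: abs_le_iff)
      also have "\<dots> = exp (t * x) * p x"
        using p_eq[OF x0] by (simp add: exp_add[symmetric] mult.left_commute algebra_simps)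
      finally show ?thesis .
    qed
    have S1: "tilt_dens t x \<le> A / (2 * a0) / s * exp (- \<bar>x - y\<bar> / (A * s))" for x
      using up lo by (rule tilt_dens_sandwich(1)[OF A(1) a0 E b(4)])
    have S2: "a0 / (A\<^sup>2 * L) / s \<le> tilt_dens t x" if "\<bar>x - y\<bar> \<le> s" for x
      using up lo that unfolding L_def by (rule tilt_dens_sandwich(2)[OF A(1) a0 E b(4)])
    have "tilt_dens t x \<le> K / s * exp (- \<bar>x - y\<bar> / (K * s))" for x
    proof -
      have "tilt_dens t x \<le> A / (2 * a0) / s * exp (- \<bar>x - y\<bar> / (A * s))" by (rule S1)
      also have "\<dots> \<le> K / s * exp (- \<bar>x - y\<bar> / (K * s))"
        using K b(4) A(1) by (intro mult_mono divide_right_mono) (auto intro!: frac_le)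
      finally show ?thesis .
    qed
    moreover have "1 / (K * s) \<le> tilt_dens t x" if "\<bar>x - y\<bar> \<le> s" for x
    proof -
      have "1 / (K * s) \<le> a0 / (A\<^sup>2 * L) / s" 
        using K(1,4) b(4) a0 A(1) L by (simp add: field_simps)
      also have "\<dots> \<le> tilt_dens t x" by (rule S2[OF that])
      finally show ?thesis .
    qed
    ultimately show ?thesis by (simp add: y_def s_def)
  qed
  \<comment> \<open>The fourth power arises when \<open>D * (\<sigma> t) ^ 3\<close> is expressed by
    the standard deviation through \<open>\<sigma> t <= D * tilt_sd p t\<close>. The factor 2 in
    \<open>E2\<close> below accounts for the bound \<open>D + 1\<close> between the mean and
    \<open>\<psi>\<close>.\<close>
  define D2 where "D2 = D\<^sup>2 * D\<^sup>2"
  have DD: "1 \<le> D * D" "D \<le> D * D" using D mult_mono[of 1 D 1 D] mult_left_mono[of 1 D D] by auto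
  have D2: "D2 \<ge> 1" "D \<le> D2" "D + 1 \<le> 2 * D2" "D * D \<le> D2"
  proof -
    show 1: "D * D \<le> D2" using DD mult_left_mono[of 1 "D * D" "D * D"] by (simp add: D2_def power2_eq_square)
    show "D2 \<ge> 1" "D \<le> D2" "D + 1 \<le> 2 * D2" using DD 1 D by linarith+
  qed
  have sd: "\<sigma> t \<le> D * tilt_sd p t" "tilt_sd p t \<le> D * \<sigma> t" if t: "t \<ge> T" for t
  proof -
    note M = mom[OF basic(4)[OF t] conjunct1[OF sand[OF t]] conjunct2[OF sand[OF t]]]
    have DD2: "D \<le> D\<^sup>2" using DD by (simp add: power2_eq_square)
    have "(\<sigma> t)\<^sup>2 \<le> D * tilt_var t" using M by blast
    also have "\<dots> \<le> D\<^sup>2 * tilt_var t" using DD2 tilt_var_pos[of t] by (intro mult_right_mono) auto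
    also have "\<dots> = (D * tilt_sd p t)\<^sup>2" by (simp add: power_mult_distrib tilt_sd_square)
    finally show "\<sigma> t \<le> D * tilt_sd p t" by (rule power2_le_imp_le) (use D tilt_sd_pos[of t] in simp)
    have "(tilt_sd p t)\<^sup>2 \<le> D * (\<sigma> t)\<^sup>2" using M by (simp add: tilt_sd_square)
    also have "\<dots> \<le> D\<^sup>2 * (\<sigma> t)\<^sup>2" using DD2 by (intro mult_right_mono) auto
    finally have "(tilt_sd p t)\<^sup>2 \<le> (D * \<sigma> t)\<^sup>2" by (simp add: power_mult_distrib)
    then show "tilt_sd p t \<le> D * \<sigma> t" by (rule power2_le_imp_le) (use D basic(4)[OF t] in simp)
  qed
  show "\<exists>T. \<forall>t\<ge>T. N \<le> t * tilt_sd p t"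
  proof -
    obtain T2 where T2: "T2 > h X" "\<And>t. t \<ge> T2 \<Longrightarrow> D * N \<le> t * \<sigma> t"
      using regular_rate_width[OF R, of "D * N"] unfolding \<sigma>_def \<psi>_def by blast
    show ?thesis
    proof (intro exI[of _ "max T T2"] allI impI)
      fix t assume t: "max T T2 \<le> t"
      then have t0: "t > 0" using T2(1) hX by simp
      have "D * N \<le> t * \<sigma> t" using T2(2) t by simp
      also have "\<dots> \<le> t * (D * tilt_sd p t)" using sd(1)[of t] t t0 by (intro mult_left_mono) auto
      finally have "D * N \<le> D * (t * tilt_sd p t)" by (simp add: mult_ac)
      then show "N \<le> t * tilt_sd p t" using D by simp
    qed
  qed
  define E2 where "E2 = 2 * D2"
  show "\<exists>D\<ge>1. \<exists>B>0. \<exists>c'>0. \<exists>r>0. \<exists>T. \<forall>t\<ge>T.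
     std_density D B c' r (\<lambda>z. tilt_sd p t * tilt_dens t (tilt_mean p t + tilt_sd p t * z)) \<and>
     \<bar>tilt_third t\<bar> \<le> D * tilt_sd p t ^ 3 \<and> h (tilt_mean p t) \<le> 2 * t \<and>
     tilt_mean p t \<le> D * gen_inverse h t \<and> 0 < deriv (gen_inverse h) t \<and> deriv (gen_inverse h) t \<le> D * tilt_var t"
  proof (rule exI[of _ E2], rule conjI, goal_cases)
    case 1 show ?case using D2 by (simp add: E2_def)
  next
    case 2
    have pos: "0 < D * K" "0 < 1 / (K * D)" "0 < 1 / D" using D K(1) by simp_all
    show ?case
    proof (rule exI[of _ "D * K"], rule conjI[OF pos(1)], rule exI[of _ "1 / (K * D)"], rule conjI[OF pos(2)],
        rule exI[of _ "1 / D"], rule conjI[OF pos(3)], rule exI[of _ T], intro allI impI conjI)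
    fix t assume t: "t \<ge> T"
    define m where "m = tilt_mean p t"
    define s where "s = tilt_sd p t"
    note M = mom[OF basic(4)[OF t] conjunct1[OF sand[OF t]] conjunct2[OF sand[OF t]], folded m_def]
    have s0: "s > 0" unfolding s_def by (rule tilt_sd_pos)
    have \<sigma>0: "\<sigma> t > 0" using basic(4)[OF t] .
    note ss = sd[OF t, folded s_def]
    have third: "(LINT x|lborel. tilt_dens t x * \<bar>x - m\<bar> ^ 3) \<le> E2 * s ^ 3"
    proof -
      have "(\<sigma> t) ^ 3 \<le> (D * s) ^ 3" using ss \<sigma>0 by (intro power_mono) auto
      then have "D * (\<sigma> t) ^ 3 \<le> D * (D * s) ^ 3" using D by (intro mult_left_mono) auto
      also have "\<dots> = D2 * s ^ 3" by (simp add: D2_def power_mult_distrib power3_eq_cube power2_eq_square)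
      also have "\<dots> \<le> E2 * s ^ 3" unfolding E2_def using D2 s0 by (intro mult_right_mono) auto
      finally show ?thesis using M by linarith
    qed
    show "\<bar>tilt_third t\<bar> \<le> E2 * tilt_sd p t ^ 3"
      using abs_tilt_third_le[of t] third by (simp add: m_def s_def)
    show "h (tilt_mean p t) \<le> 2 * t" using win[OF t, of m] M by (simp add: m_def)
    show "0 < deriv (gen_inverse h) t" using basic(6)[OF t] \<sigma>0 by simp
    show "deriv (gen_inverse h) t \<le> E2 * tilt_var t"
    proof -
      have "D * tilt_var t \<le> E2 * tilt_var t" unfolding E2_def using D2 D tilt_var_pos[of t] by (intro mult_right_mono) auto
      then show ?thesis using M basic(6)[OF t] by simp
    qed
    show "tilt_mean p t \<le> E2 * gen_inverse h t"
    proof -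
      have "m \<le> \<psi> t + D * \<sigma> t" using M by (simp add: abs_le_iff)
      also have "\<dots> \<le> \<psi> t + D * \<psi> t" using basic(7)[OF t] D by simp
      also have "\<dots> = (D + 1) * \<psi> t" by (simp add: algebra_simps)
      also have "\<dots> \<le> E2 * \<psi> t" unfolding E2_def using D2(3) basic(1)[OF t] X by (intro mult_right_mono) auto
      finally show ?thesis by (simp add: m_def \<psi>_def)
    qed
    define f where "f = (\<lambda>z. s * tilt_dens t (m + s * z))"
    have aff: "has_bochner_integral lborel (\<lambda>z. s * F (m + s * z)) I" if "has_bochner_integral lborel F I" for F :: "real \<Rightarrow> real" and I
    proof -
      have F: "integrable lborel F" "integral\<^sup>L lborel F = I" using that by (auto simp: has_bochner_integral_iff)
      have "integrable lborel (\<lambda>z. F (m + s * z))" by (rule lborel_integrable_real_affine[OF F(1)]) (use s0 in simp)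
      moreover have "I = s * (LINT z|lborel. F (m + s * z))"
        unfolding F(2)[symmetric] using s0 by (subst lborel_integral_real_affine[of s _ m]) auto
      ultimately show ?thesis by (simp add: has_bochner_integral_iff)
    qed
    have f3: "has_bochner_integral lborel (\<lambda>z. f z * \<bar>z\<bar> ^ 3) ((LINT x|lborel. tilt_dens t x * \<bar>x - m\<bar> ^ 3) / s ^ 3)"
    proof -
      have "has_bochner_integral lborel (\<lambda>x. (tilt_dens t x * \<bar>x - m\<bar> ^ 3) / s ^ 3) ((LINT x|lborel. tilt_dens t x * \<bar>x - m\<bar> ^ 3) / s ^ 3)"
        using abs_third_integrable[of t] by (simp add: has_bochner_integral_iff m_def)
      from aff[OF this] show ?thesis using s0 by (simp add: f_def abs_mult power_mult_distrib mult.assoc)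
    qed
    have f2: "has_bochner_integral lborel (\<lambda>z. f z * z\<^sup>2) 1"
    proof -
      have "has_bochner_integral lborel (\<lambda>x. (tilt_dens t x * (x - m)\<^sup>2) / s\<^sup>2) (tilt_var t / s\<^sup>2)"
        using tilt_central2[of t] by (simp add: has_bochner_integral_iff m_def)
      from aff[OF this] show ?thesis using s0 tilt_sd_square[of t] tilt_var_pos[of t]
        by (simp add: f_def power_mult_distrib s_def mult.assoc)
    qed
    have f1: "has_bochner_integral lborel (\<lambda>z. f z * z) 0"
    proof -
      have "has_bochner_integral lborel (\<lambda>x. (tilt_dens t x * (x - m)) / s) (0 / s)"
        using tilt_central1[of t] by (simp add: has_bochner_integral_iff m_def)
      from aff[OF this] show ?thesis using s0 by (simp add: f_def mult.assoc)
    qed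
    have f0: "has_bochner_integral lborel f 1"
      using aff[OF tilt_dens_moment[of t 0]] emom0_pos[of t] by (simp add: f_def)
    have fb: "f z \<le> D * K" for z
    proof -
      have "tilt_dens t (m + s * z) \<le> K / \<sigma> t * exp (- \<bar>m + s * z - \<psi> t\<bar> / (K * \<sigma> t))" using sand[OF t] by blast
      also have "\<dots> \<le> K / \<sigma> t * 1" using K \<sigma>0 by (intro mult_left_mono) auto
      finally have "f z \<le> s * (K / \<sigma> t)" unfolding f_def using s0 by (intro mult_left_mono) auto
      also have "\<dots> \<le> (D * \<sigma> t) * (K / \<sigma> t)" using ss K \<sigma>0 by (intro mult_right_mono) auto
      finally show ?thesis using \<sigma>0 by simp
    qed
    \<comment> \<open>The block of the standardised density is centred at the image of
      \<open>\<psi>\<close>; a radius \<open>1 / D\<close> in standard deviations is at most one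
      width.\<close>
    have fl: "1 / (K * D) \<le> f z" if "\<bar>z - (\<psi> t - m) / s\<bar> \<le> 1 / D" for z
    proof -
      have "\<bar>m + s * z - \<psi> t\<bar> = s * \<bar>z - (\<psi> t - m) / s\<bar>"
      proof -
        have "s * ((\<psi> t - m) / s) = \<psi> t - m" using s0 by simp
        then have "m + s * z - \<psi> t = s * (z - (\<psi> t - m) / s)" by (simp only: right_diff_distrib)
        then show ?thesis using s0 by (simp add: abs_mult)
      qed
      also have "\<dots> \<le> (D * \<sigma> t) * (1 / D)" using ss that s0 by (intro mult_mono) auto
      finally have "\<bar>m + s * z - \<psi> t\<bar> \<le> \<sigma> t" using D by simp
      then have "1 / (K * \<sigma> t) \<le> tilt_dens t (m + s * z)" using sand[OF t] by blast
      then have "s * (1 / (K * \<sigma> t)) \<le> f z" unfolding f_def using s0 by (intro mult_left_mono) auto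
      moreover have "1 / (K * D) \<le> s * (1 / (K * \<sigma> t))"
        using ss s0 \<sigma>0 K D by (simp add: field_simps)
      ultimately show ?thesis by linarith
    qed
    have "std_density E2 (D * K) (1 / (K * D)) (1 / D) f"
      unfolding std_density_def
    proof (intro conjI)
      show "f \<in> borel_measurable borel" unfolding f_def by measurable
      show "\<forall>x. 0 \<le> f x \<and> f x \<le> D * K" using fb s0 tilt_dens_nonneg by (simp add: f_def)
      show "integrable lborel (\<lambda>x. f x * \<bar>x\<bar> ^ 3)" using f3 by (simp add: has_bochner_integral_iff)
      show "(LINT x|lborel. f x * \<bar>x\<bar> ^ 3) \<le> E2"
        using third s0 has_bochner_integral_integral_eq[OF f3] by (simp add: divide_le_eq)
      show "\<exists>z. \<forall>x. \<bar>x - z\<bar> \<le> 1 / D \<longrightarrow> 1 / (K * D) \<le> f x" using fl by blast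
    qed (rule f0 f1 f2)+
    then show "std_density E2 (D * K) (1 / (K * D)) (1 / D) (\<lambda>z. tilt_sd p t * tilt_dens t (tilt_mean p t + tilt_sd p t * z))"
      by (simp add: f_def m_def s_def)
    qed
  qed
qed

end

section \<open>The approximating integral\<close>

text \<open>Integrating the derivative bounds squeezes the integrand between two exponentials. The
  upper bound is needed on the whole interval; for the lower one a short initial piece of length
  \<open>w\<close> is enough, because the exponential has all but the fraction
  \<open>exp (- \<beta> * w)\<close> of its mass there.\<close>

lemma exp_integral_bounds:
  fixes L L' :: "real \<Rightarrow> real"
  assumes \<eta>: "0 < w" "w \<le> \<eta>" and \<alpha>: "\<alpha> > 0" and \<beta>: "\<beta> > 0"
    and d: "\<And>x. a \<le> x \<Longrightarrow> x \<le> a + \<eta> \<Longrightarrow> (L has_real_derivative L' x) (at x)"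
    and up: "\<And>x. a \<le> x \<Longrightarrow> x \<le> a + \<eta> \<Longrightarrow> L' x \<le> - \<alpha>"
    and lo: "\<And>x. a \<le> x \<Longrightarrow> x \<le> a + w \<Longrightarrow> - \<beta> \<le> L' x"
  shows "(LINT x:{a..a + \<eta>}|lborel. exp (L x - L a)) \<le> 1 / \<alpha>"
    and "(1 - exp (- \<beta> * w)) / \<beta> \<le> (LINT x:{a..a + \<eta>}|lborel. exp (L x - L a))"
proof -
  have E: "has_bochner_integral lborel (\<lambda>x. exp (- \<gamma> * (x - a)) * indicator {a..a + b} x) ((1 - exp (- \<gamma> * b)) / \<gamma>)"
    if "\<gamma> > 0" "b \<ge> 0" for \<gamma> b
  proof -
    have "has_bochner_integral lborel (\<lambda>x. exp (- \<gamma> * (x - a)) * indicator {a..a + b} x)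
       ((- exp (- \<gamma> * (a + b - a)) / \<gamma>) - (- exp (- \<gamma> * (a - a)) / \<gamma>))"
      by (rule has_bochner_integral_FTC_Icc_real) (use that in \<open>auto intro!: derivative_eq_intros\<close>)
    then show ?thesis by (simp add: diff_divide_distrib)
  qed
  have cont: "continuous_on {a..a + \<eta>} L"
    by (rule DERIV_atLeastAtMost_imp_continuous_on) (use d in blast)
  have int: "integrable lborel (\<lambda>x. indicator {a..a + \<eta>} x *\<^sub>R exp (L x - L a))"
    by (rule borel_integrable_compact) (intro compact_Icc continuous_intros cont)+
  have Lu: "L x - L a \<le> - \<alpha> * (x - a)" if x: "a \<le> x" "x \<le> a + \<eta>" for x
  proof (cases "x = a")
    case False
    then obtain z where z: "a < z" "z < x" "L x - L a = (x - a) * L' z"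
      using MVT2[of a x L L'] d x by force
    have "(x - a) * L' z \<le> (x - a) * (- \<alpha>)" using up[of z] z x by (intro mult_left_mono) auto
    then show ?thesis using z by (simp add: mult.commute)
  qed simp
  have Ll: "- \<beta> * (x - a) \<le> L x - L a" if x: "a \<le> x" "x \<le> a + w" for x
  proof (cases "x = a")
    case False
    then obtain z where z: "a < z" "z < x" "L x - L a = (x - a) * L' z"
      using MVT2[of a x L L'] d x \<eta> by force
    have "(x - a) * (- \<beta>) \<le> (x - a) * L' z" using lo[of z] z x by (intro mult_left_mono) auto
    then show ?thesis using z by (simp add: mult.commute)
  qed simp
  have "(LINT x:{a..a + \<eta>}|lborel. exp (L x - L a)) \<le> (LINT x|lborel. exp (- \<alpha> * (x - a)) * indicator {a..a + \<eta>} x)"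
    unfolding set_lebesgue_integral_def
  proof (rule integral_mono[OF int])
    show "integrable lborel (\<lambda>x. exp (- \<alpha> * (x - a)) * indicator {a..a + \<eta>} x)"
      using E[of \<alpha> \<eta>] \<alpha> \<eta> by (simp add: has_bochner_integral_iff)
    show "indicator {a..a + \<eta>} x *\<^sub>R exp (L x - L a) \<le> exp (- \<alpha> * (x - a)) * indicator {a..a + \<eta>} x" for x
      using Lu[of x] by (auto simp: indicator_def)
  qed
  also have "\<dots> = (1 - exp (- \<alpha> * \<eta>)) / \<alpha>"
    by (rule has_bochner_integral_integral_eq[OF E]) (use \<alpha> \<eta> in auto)
  also have "\<dots> \<le> 1 / \<alpha>" using \<alpha> by (simp add: divide_right_mono)
  finally show "(LINT x:{a..a + \<eta>}|lborel. exp (L x - L a)) \<le> 1 / \<alpha>" .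
  have "(1 - exp (- \<beta> * w)) / \<beta> = (LINT x|lborel. exp (- \<beta> * (x - a)) * indicator {a..a + w} x)"
    by (rule has_bochner_integral_integral_eq[OF E, symmetric]) (use \<beta> \<eta> in auto)
  also have "\<dots> \<le> (LINT x:{a..a + \<eta>}|lborel. exp (L x - L a))"
    unfolding set_lebesgue_integral_def
  proof (rule integral_mono[OF _ int])
    show "integrable lborel (\<lambda>x. exp (- \<beta> * (x - a)) * indicator {a..a + w} x)"
      using E[of \<beta> w] \<beta> \<eta> by (simp add: has_bochner_integral_iff)
    show "exp (- \<beta> * (x - a)) * indicator {a..a + w} x \<le> indicator {a..a + \<eta>} x *\<^sub>R exp (L x - L a)" for x
      using Ll[of x] \<eta> by (auto simp: indicator_def)
  qed
  finally show "(1 - exp (- \<beta> * w)) / \<beta> \<le> (LINT x:{a..a + \<eta>}|lborel. exp (L x - L a))" .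
qed

context exp_density begin

section \<open>Tilt and variance as functions of the mean\<close>

lemma tilt_mean_cont: "isCont (tilt_mean p) t"
  by (rule DERIV_isCont[OF tilt_mean_deriv])

text \<open>The range of the mean function is never computed; by the intermediate value theorem it
  suffices that a value lies between two attained ones.\<close>

lemma tilt_mean_surj_between:
  assumes "tilt_mean p r \<le> x" "x \<le> tilt_mean p u"
  shows "tilt_mean p (tilt_param p x) = x"
proof -
  have "r \<le> u" using assms tilt_mean_less_iff[of u r] by linarith
  then obtain v where "tilt_mean p v = x"
    using IVT[of "tilt_mean p" r x u] assms tilt_mean_cont by blast
  then show ?thesis by auto
qed

lemma tilt_param_deriv:
  "(tilt_param p has_real_derivative 1 / tilt_var r) (at (tilt_mean p r))"
proof -
  have "isCont (tilt_param p) (tilt_mean p r)"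
    by (rule isCont_inverse_function[where d = 1 and f = "tilt_mean p"]) (auto intro: tilt_mean_cont)
  moreover have "tilt_var r \<noteq> 0" using tilt_var_pos[of r] by simp
  ultimately have "(tilt_param p has_real_derivative inverse (tilt_var r)) (at (tilt_mean p r))"
    using tilt_mean_deriv[of r] tilt_mean_surj_between[of "r - 1" _ "r + 1"]
      tilt_mean_strict_mono[of "r - 1" r] tilt_mean_strict_mono[of r "r + 1"]
    by (intro DERIV_inverse_function[where f = "tilt_mean p" and a = "tilt_mean p (r - 1)" and b = "tilt_mean p (r + 1)"]) auto
  then show ?thesis by (simp add: inverse_eq_divide)
qed

text \<open>The derivative of \<open>1 / s\<close> is minus the third central moment over
  \<open>2 * s ^ 3\<close>, so a bound on the third moment by \<open>s ^ 3\<close> is a Lipschitz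
  bound for \<open>1 / s\<close>.\<close>

lemma inverse_tilt_sd_lipschitz:
  assumes D: "\<And>r. r \<ge> T \<Longrightarrow> \<bar>tilt_third r\<bar> \<le> D * tilt_sd p r ^ 3" and "T \<le> t" "t \<le> r"
  shows "\<bar>1 / tilt_sd p r - 1 / tilt_sd p t\<bar> \<le> D / 2 * (r - t)"
proof (cases "r = t")
  case False
  have "\<exists>z. t < z \<and> z < r \<and> 1 / tilt_sd p r - 1 / tilt_sd p t = (r - t) * (- (tilt_third z / (2 * tilt_sd p z ^ 3)))"
  proof (rule MVT2)
    fix z
    have "((\<lambda>z. 1 / sqrt (tilt_var z)) has_real_derivative - (tilt_third z / (2 * tilt_sd p z ^ 3))) (at z)"
      using tilt_var_pos[of z]
      by (auto intro!: derivative_eq_intros tilt_var_deriv simp: tilt_sd_eq power3_eq_cube divide_simps)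
    then show "((\<lambda>z. 1 / tilt_sd p z) has_real_derivative - (tilt_third z / (2 * tilt_sd p z ^ 3))) (at z)"
      by (simp add: tilt_sd_eq)
  qed (use assms False in auto)
  then obtain z where z: "t < z" "z < r" "1 / tilt_sd p r - 1 / tilt_sd p t = (r - t) * (- (tilt_third z / (2 * tilt_sd p z ^ 3)))"
    by blast
  have "\<bar>tilt_third z\<bar> / (2 * tilt_sd p z ^ 3) \<le> D / 2"
    using D[of z] z assms tilt_sd_pos[of z] by (simp add: divide_le_eq)
  then have "(r - t) * (\<bar>tilt_third z\<bar> / (2 * tilt_sd p z ^ 3)) \<le> (r - t) * (D / 2)"
    using assms by (intro mult_left_mono) auto
  then show ?thesis
    using z tilt_sd_pos[of z] assms by (simp add: abs_mult abs_divide mult_ac)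
qed simp

text \<open>For tilts within \<open>1 / (D * s)\<close> of \<open>t\<close> the Lipschitz bound
  keeps the standard deviation above \<open>2 / 3 * s\<close>, so the mean grows at rate at least
  \<open>4 / 9 * s\<^sup>2\<close>. Leaving this range would raise the mean by at least
  \<open>4 / 9 * (s / D)\<close>, which exceeds \<open>w\<close>; hence \<open>r\<close> stays
  inside and the growth rate bounds \<open>r - t\<close>.\<close>

lemma tilt_param_near:
  assumes D: "\<And>r. r \<ge> T \<Longrightarrow> \<bar>tilt_third r\<bar> \<le> D * tilt_sd p r ^ 3" and "T \<le> t" "t \<le> r" and D1: "D \<ge> 1"
    and w: "tilt_mean p r \<le> tilt_mean p t + w" "w < 4 / 9 * (tilt_sd p t / D)"
  shows "r - t \<le> 9 / 4 * w / (tilt_sd p t)\<^sup>2" and "2 / 3 * tilt_sd p t \<le> tilt_sd p r"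
proof -
  define s where "s = tilt_sd p t"
  have s: "s > 0" unfolding s_def by (rule tilt_sd_pos)
  define \<rho> where "\<rho> = 1 / (D * s)"
  have \<rho>: "\<rho> > 0" using D1 s by (simp add: \<rho>_def)
  have sd: "2 / 3 * s \<le> tilt_sd p z" if z: "t \<le> z" "z \<le> t + \<rho>" for z
  proof -
    have "1 / tilt_sd p z \<le> 1 / s + D / 2 * (z - t)"
      using abs_le_D1[OF inverse_tilt_sd_lipschitz[OF D \<open>T \<le> t\<close> z(1)]] by (simp add: s_def)
    also have "D / 2 * (z - t) \<le> D / 2 * \<rho>" using z D1 by (intro mult_left_mono) auto
    also have "D / 2 * \<rho> = 1 / (2 * s)" using D1 by (simp add: \<rho>_def)
    finally have "1 / tilt_sd p z \<le> 3 / (2 * s)" by (simp add: field_simps)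
    then show ?thesis using s tilt_sd_pos[of z] by (simp add: field_simps)
  qed
  have mm: "4 / 9 * s\<^sup>2 * (z - t) \<le> tilt_mean p z - tilt_mean p t" if z: "t \<le> z" "z \<le> t + \<rho>" for z
  proof (cases "z = t")
    case False
    then obtain v where v: "t < v" "v < z" "tilt_mean p z - tilt_mean p t = (z - t) * tilt_var v"
      using MVT2[of t z "tilt_mean p" tilt_var] tilt_mean_deriv z by force
    have "(2 / 3 * s)\<^sup>2 \<le> (tilt_sd p v)\<^sup>2" using sd[of v] v z s by (intro power_mono) auto
    then have "4 / 9 * s\<^sup>2 \<le> tilt_var v" unfolding tilt_sd_square by (simp add: power_mult_distrib power_divide)
    then have "(z - t) * (4 / 9 * s\<^sup>2) \<le> (z - t) * tilt_var v"
      using z by (intro mult_left_mono) auto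
    then show ?thesis using v by (simp add: mult_ac)
  qed simp
  have r\<rho>: "r \<le> t + \<rho>"
  proof (rule ccontr)
    assume "\<not> r \<le> t + \<rho>"
    then have "tilt_mean p (t + \<rho>) < tilt_mean p r" by (intro tilt_mean_strict_mono) simp
    moreover have "4 / 9 * s\<^sup>2 * \<rho> \<le> tilt_mean p (t + \<rho>) - tilt_mean p t" using mm[of "t + \<rho>"] \<rho> by simp
    moreover have "4 / 9 * s\<^sup>2 * \<rho> = 4 / 9 * (s / D)" using s D1 by (simp add: \<rho>_def power2_eq_square)
    ultimately show False using w by (simp add: s_def)
  qed
  show "2 / 3 * tilt_sd p t \<le> tilt_sd p r" using sd[of r] r\<rho> \<open>t \<le> r\<close> by (simp add: s_def)
  have "4 / 9 * s\<^sup>2 * (r - t) \<le> w" using mm[of r] r\<rho> \<open>t \<le> r\<close> w by simp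
  then show "r - t \<le> 9 / 4 * w / (tilt_sd p t)\<^sup>2" using s by (simp add: s_def field_simps)
qed

text \<open>The prefactor of \<open>gA\<close> cancels the value of the integrand at
  \<open>a\<close> up to the tilted density and the factor \<open>n * t\<close>, so the quotient is
  \<open>n * t * J\<close> with \<open>J\<close> the integral of the integrand normalised at
  \<open>a\<close>. The assumption \<open>reach\<close> puts the whole interval into the range of
  the mean, where \<open>tilt_param\<close> is a true inverse.\<close>

lemma gA_ratio_bound:
  fixes n :: nat and t y \<eta> D :: real
  assumes D: "\<And>r. r \<ge> T \<Longrightarrow> \<bar>tilt_third r\<bar> \<le> D * tilt_sd p r ^ 3" and D1: "D \<ge> 1"
    and ts: "\<And>r. r \<ge> t \<Longrightarrow> 1 \<le> r * tilt_sd p r"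
    and t: "T \<le> t" "1 \<le> t" and y: "0 \<le> y" "y \<le> tilt_mean p t" and a1: "1 \<le> tilt_mean p t"
    and n: "real n \<ge> 2 * D" "n \<ge> 2" and reach: "\<exists>u. tilt_mean p t + \<eta> \<le> tilt_mean p u"
    and \<eta>: "ln n / (n * t) \<le> \<eta>" and w1: "ln n / (n * t) \<le> 1" and w2: "ln n / (n * t) < 4 / 9 * (tilt_sd p t / D)"
  defines "a \<equiv> tilt_mean p t"
  defines "e \<equiv> (2 * D + 1 + 9 / 4 * ln n + 7 * a\<^sup>2 / tilt_var t) / n"
  shows "\<bar>gA p n t a \<eta> y / tilted_density p a y - 1\<bar> \<le> e" and "tilted_density p a y > 0"
proof -
  define s where "s = tilt_sd p t"
  define R where "R = tilt_param p"
  have s: "s > 0" unfolding s_def by (rule tilt_sd_pos)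
  have s2: "tilt_var t = s\<^sup>2" unfolding s_def by (simp add: tilt_sd_square)
  have py: "p y > 0" using p_pos y by simp
  have Ra: "R a = t" by (simp add: R_def a_def)
  have n0: "real n > 0" using n by simp
  obtain u where u: "a + \<eta> \<le> tilt_mean p u" using reach by (auto simp: a_def)
  \<comment> \<open>The length for which \<open>exp (- (n * t) * w) = 1 / n\<close>; the part of the
    interval beyond it is an admissible error.\<close>
  define w where "w = ln n / (n * t)"
  have w0: "w > 0" using n t by (simp add: w_def)
  have \<eta>0: "w \<le> \<eta>" using \<eta> by (simp add: w_def)
  have mR: "tilt_mean p (R x) = x" if "a \<le> x" "x \<le> a + \<eta>" for x
    unfolding R_def by (rule tilt_mean_surj_between[of t _ u]) (use that u in \<open>auto simp: a_def\<close>)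
  have Rt: "t \<le> R x" if "a \<le> x" "x \<le> a + \<eta>" for x
    using mR[OF that] that(1) tilt_mean_less_iff[of "R x" t] by (simp add: a_def)
  define L where "L = (\<lambda>x. R x * y + ln (p y) - ln (mgf p (R x)) - n * (x * R x - ln (mgf p (R x))) - 1 / 2 * ln (tilt_var (R x)))"
  define L' where "L' = (\<lambda>x. (y - x) / tilt_var (R x) - n * R x - tilt_third (R x) / (2 * (tilt_var (R x))\<^sup>2))"
  have L_exp: "tilted_density p x y * exp (- real n * rate_fun p x - ln (tilt_sd p (tilt_param p x))) = exp (L x)" for x
  proof -
    have "mgf p (R x) > 0" using emom0_pos by (simp add: mgf_eq)
    moreover have "ln (tilt_sd p (R x)) = 1 / 2 * ln (tilt_var (R x))"
      using tilt_var_pos[of "R x"] by (simp add: tilt_sd_eq ln_sqrt)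
    moreover have "tilted_density p x y = exp (R x * y + ln (p y) - ln (mgf p (R x)))"
      using py calculation(1) by (simp add: tilted_density_def R_def exp_add exp_diff)
    ultimately show ?thesis
      by (simp add: L_def rate_fun_def R_def[symmetric] exp_add[symmetric] algebra_simps)
  qed
  have Ld: "(L has_real_derivative L' x) (at x)" if x: "a \<le> x" "x \<le> a + \<eta>" for x
  proof -
    define r where "r = R x"
    have mr: "tilt_mean p r = x" using mR[OF x] by (simp add: r_def)
    have V: "tilt_var r > 0" by (rule tilt_var_pos)
    have Rd: "(R has_real_derivative 1 / tilt_var r) (at x)"
      using tilt_param_deriv[of r] by (simp add: mr R_def)
    have Md: "((\<lambda>x. ln (mgf p (R x))) has_real_derivative x * (1 / tilt_var r)) (at x)"
    proof -
      have "((\<lambda>u. ln (mgf p u)) has_real_derivative x) (at (R x))"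
        using ln_mgf_deriv[of r] mr by (simp add: tilt_mean_eq r_def)
      from DERIV_chain2[OF this Rd] show ?thesis .
    qed
    have Vd: "((\<lambda>x. ln (tilt_var (R x))) has_real_derivative (tilt_third r / tilt_var r) * (1 / tilt_var r)) (at x)"
    proof -
      have "((\<lambda>u. ln (tilt_var u)) has_real_derivative tilt_third r / tilt_var r) (at (R x))"
        unfolding r_def[symmetric] using V by (auto intro!: derivative_eq_intros tilt_var_deriv)
      from DERIV_chain2[OF this Rd] show ?thesis .
    qed
    have "(L has_real_derivative ((1 / tilt_var r) * y + 0 - x * (1 / tilt_var r)
       - n * ((1 * R x + (1 / tilt_var r) * x) - x * (1 / tilt_var r)) - 1 / 2 * ((tilt_third r / tilt_var r) * (1 / tilt_var r)))) (at x)"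
      unfolding L_def
      by (intro DERIV_diff DERIV_add DERIV_cmult DERIV_cmult_right DERIV_mult DERIV_ident DERIV_const Rd Md Vd)
    moreover have "((1 / tilt_var r) * y + 0 - x * (1 / tilt_var r)
       - n * ((1 * R x + (1 / tilt_var r) * x) - x * (1 / tilt_var r)) - 1 / 2 * ((tilt_third r / tilt_var r) * (1 / tilt_var r))) = L' x"
      unfolding L'_def r_def[symmetric] by (simp add: diff_divide_distrib power2_eq_square)
    ultimately show ?thesis by simp
  qed
  have third: "\<bar>tilt_third (R x) / (2 * (tilt_var (R x))\<^sup>2)\<bar> \<le> D / (2 * tilt_sd p (R x))" if x: "a \<le> x" "x \<le> a + \<eta>" for x
  proof -
    define q where "q = tilt_sd p (R x)"
    have q: "q > 0" unfolding q_def by (rule tilt_sd_pos)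
    have "\<bar>tilt_third (R x)\<bar> \<le> D * q ^ 3" using D[of "R x"] Rt[OF x] t by (simp add: q_def)
    then have "\<bar>tilt_third (R x)\<bar> / (2 * (q\<^sup>2)\<^sup>2) \<le> D * q ^ 3 / (2 * (q\<^sup>2)\<^sup>2)" by (intro divide_right_mono) auto
    also have "\<dots> = D / (2 * q)" using q by (simp add: power2_eq_square power3_eq_cube)
    finally show ?thesis by (simp add: abs_divide q_def tilt_sd_square)
  qed
  \<comment> \<open>The skewness term is at most \<open>D / (2 * s)\<close>, with \<open>s\<close>
    taken at the current tilt \<open>r\<close>; by \<open>1 <= r * s\<close> this is at most
    \<open>D / 2 * r\<close>, a small part of \<open>n * r\<close>. The term in \<open>y - x\<close>
    is nonpositive because \<open>y <= a\<close>.\<close>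
  define \<alpha> where "\<alpha> = t * (n - D / 2)"
  have \<alpha>0: "\<alpha> > 0" using t n D1 by (simp add: \<alpha>_def)
  have up: "L' x \<le> - \<alpha>" if x: "a \<le> x" "x \<le> a + \<eta>" for x
  proof -
    define r where "r = R x"
    have r: "t \<le> r" using Rt[OF x] by (simp add: r_def)
    have "(y - x) / tilt_var r \<le> 0" using y x tilt_var_pos[of r] by (intro divide_nonpos_pos) (auto simp: a_def)
    moreover have "D / (2 * tilt_sd p r) \<le> D / 2 * r"
      using ts[OF r] tilt_sd_pos[of r] D1 by (simp add: divide_le_eq mult_ac)
    moreover have "- (tilt_third r / (2 * (tilt_var r)\<^sup>2)) \<le> D / (2 * tilt_sd p r)"
      using abs_le_D2[OF third[OF x]] by (simp only: r_def)
    ultimately have "L' x \<le> D / 2 * r - n * r" unfolding L'_def r_def[symmetric] by linarith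
    also have "\<dots> = - (r * (n - D / 2))" by (simp add: algebra_simps)
    also have "\<dots> \<le> - \<alpha>" unfolding \<alpha>_def using r n D1 by (simp add: mult_right_mono)
    finally show ?thesis .
  qed
  \<comment> \<open>The four summands bound \<open>n * t\<close>, the increase of the tilt over the
    length \<open>w\<close>, the term in \<open>x - y\<close> and the skewness term. The last three
    use that the standard deviation stays above \<open>2 / 3 * s\<close>, and
    \<open>x <= a + 1 <= 3 * a\<close>.\<close>
  define \<beta> where "\<beta> = n * t + n * (9 / 4 * w / s\<^sup>2) + 27 / 4 * a / s\<^sup>2 + 3 / 4 * D / s"
  have \<beta>nt: "n * t \<le> \<beta>" using w0 s D1 a1 by (simp add: \<beta>_def a_def)
  have nt: "n * t > 0" using n0 t by simp
  have \<beta>0: "\<beta> > 0" using \<beta>nt nt by simp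
  have lo: "- \<beta> \<le> L' x" if x: "a \<le> x" "x \<le> a + w" for x
  proof -
    define r where "r = R x"
    have x2: "x \<le> a + \<eta>" using x \<eta>0 by simp
    have r: "t \<le> r" "tilt_mean p r = x" using Rt[OF x(1) x2] mR[OF x(1) x2] by (auto simp: r_def)
    have near: "r - t \<le> 9 / 4 * w / s\<^sup>2" "2 / 3 * s \<le> tilt_sd p r"
      unfolding s_def using tilt_param_near[OF D t(1) r(1) D1, of w] r x w2 by (auto simp: a_def w_def)
    have V: "4 / 9 * s\<^sup>2 \<le> tilt_var r"
    proof -
      have "(2 / 3 * s)\<^sup>2 \<le> (tilt_sd p r)\<^sup>2" using near s by (intro power_mono) auto
      then show ?thesis unfolding tilt_sd_square by (simp add: power_mult_distrib power_divide)
    qed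
    have "(x - y) / tilt_var r \<le> 3 * a / (4 / 9 * s\<^sup>2)"
      using x y a1 w1 V s by (intro frac_le) (auto simp: a_def w_def)
    moreover have "D / (2 * tilt_sd p r) \<le> D / (2 * (2 / 3 * s))"
      using near s D1 by (intro divide_left_mono) auto
    moreover have "tilt_third r / (2 * (tilt_var r)\<^sup>2) \<le> D / (2 * tilt_sd p r)"
      using abs_le_D1[OF third[OF x(1) x2]] by (simp only: r_def)
    moreover have "n * r \<le> n * (t + 9 / 4 * w / s\<^sup>2)" using near n0 by (intro mult_left_mono) auto
    moreover have "(y - x) / tilt_var r = - ((x - y) / tilt_var r)" by (simp add: minus_divide_left)
    ultimately have "- (3 * a / (4 / 9 * s\<^sup>2) + n * (t + 9 / 4 * w / s\<^sup>2) + D / (2 * (2 / 3 * s))) \<le> L' x"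
      unfolding L'_def r_def[symmetric] by linarith
    then show ?thesis by (simp add: \<beta>_def algebra_simps)
  qed
  define J where "J = (LINT x:{a..a + \<eta>}|lborel. exp (L x - L a))"
  have J: "J \<le> 1 / \<alpha>" "(1 - exp (- \<beta> * w)) / \<beta> \<le> J"
    unfolding J_def by (rule exp_integral_bounds[OF w0 \<eta>0 \<alpha>0 \<beta>0 Ld up lo]; assumption)+
  have td: "tilted_density p a y > 0"
    unfolding tilted_density_def using py emom0_pos by (simp add: mgf_eq)
  then show "tilted_density p a y > 0" .
  have gA_eq: "gA p n t a \<eta> y = tilted_density p a y * (n * t * J)"
  proof -
    have "(LINT x:{a..a + \<eta>}|lborel. exp (L x)) = (LINT x:{a..a + \<eta>}|lborel. exp (L a) * exp (L x - L a))"
      by (simp add: exp_add[symmetric])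
    also have "\<dots> = exp (L a) * J" unfolding J_def by (rule set_integral_mult_right)
    finally have "gA p n t a \<eta> y = n * t * s * exp (n * rate_fun p a) * (exp (L a) * J)"
      unfolding gA_def L_exp s_def by simp
    also have "exp (L a) = tilted_density p a y * (exp (- n * rate_fun p a) / s)"
      using L_exp[of a] s Ra by (simp add: exp_diff R_def s_def[symmetric])
    finally show ?thesis using s by (simp add: exp_minus)
  qed
  have ratio: "gA p n t a \<eta> y / tilted_density p a y = n * t * J" using gA_eq td by simp
  have ub: "n * t * J \<le> 1 + D / n"
  proof -
    have "n * t * J \<le> n * t * (1 / \<alpha>)" using J nt by (intro mult_left_mono) auto
    also have "\<dots> = n / (n - D / 2)" using t by (simp add: \<alpha>_def)
    also have "\<dots> \<le> 1 + D / n"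
    proof -
      have "D * D \<le> D * n" using n D1 by (intro mult_left_mono) auto
      then have "real n * n \<le> (n + D) * (n - D / 2)" by (simp add: algebra_simps)
      then show ?thesis using n0 n D1 by (simp add: divide_le_eq field_simps)
    qed
    finally show ?thesis .
  qed
  \<comment> \<open>Bounds the relative excess of \<beta> over \<open>n * t\<close>. The powers of
    \<open>1 / s\<close> in the logarithmic and skewness terms are removed by
    \<open>1 <= t * s\<close>; the term with \<open>a\<close> keeps its variance, to be handled by
    the growth hypothesis.\<close>
  define \<kappa> where "\<kappa> = (9 / 4 * ln n + 7 * a\<^sup>2 / s\<^sup>2 + D) / n"
  have \<kappa>0: "\<kappa> \<ge> 0" using n D1 by (simp add: \<kappa>_def)
  have ts1: "1 \<le> t * s" using ts[of t] by (simp add: s_def)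
  have \<beta>le: "\<beta> \<le> n * t * (1 + \<kappa>)"
  proof -
    have i1: "1 / s\<^sup>2 \<le> t\<^sup>2"
    proof -
      have "1 \<le> (t * s)\<^sup>2" using ts1 by (simp add: one_le_power)
      then show ?thesis using s by (simp add: divide_le_eq power_mult_distrib)
    qed
    have i2: "1 / s \<le> t" using ts1 s by (simp add: divide_le_eq)
    have t0: "t > 0" using t by simp
    have "n * (9 / 4 * w / s\<^sup>2) = 9 / 4 * ln n / t * (1 / s\<^sup>2)" using n0 by (simp add: w_def)
    also have "\<dots> \<le> 9 / 4 * ln n / t * t\<^sup>2" using i1 n t by (intro mult_left_mono) auto
    also have "\<dots> = t * (9 / 4 * ln n)" using t0 by (simp add: power2_eq_square)
    finally have b1: "n * (9 / 4 * w / s\<^sup>2) \<le> t * (9 / 4 * ln n)" .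
    have "27 / 4 * a / s\<^sup>2 \<le> 7 * a\<^sup>2 / s\<^sup>2"
    proof (rule divide_right_mono)
      have "a * 1 \<le> a * a" using a1 by (intro mult_left_mono) (auto simp: a_def)
      then show "27 / 4 * a \<le> 7 * a\<^sup>2" using a1 unfolding power2_eq_square by (simp add: a_def)
    qed simp
    also have "\<dots> = 1 * (7 * a\<^sup>2 / s\<^sup>2)" by simp
    also have "\<dots> \<le> t * (7 * a\<^sup>2 / s\<^sup>2)" using t by (intro mult_right_mono) auto
    finally have b2: "27 / 4 * a / s\<^sup>2 \<le> t * (7 * a\<^sup>2 / s\<^sup>2)" .
    have "3 / 4 * D / s = 3 / 4 * D * (1 / s)" by simp
    also have "\<dots> \<le> 3 / 4 * D * t" using i2 D1 by (intro mult_left_mono) auto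
    also have "\<dots> \<le> t * D" using D1 t by simp
    finally have b3: "3 / 4 * D / s \<le> t * D" .
    have "n * t * (1 + \<kappa>) = n * t + t * (9 / 4 * ln n) + t * (7 * a\<^sup>2 / s\<^sup>2) + t * D"
      using n0 by (simp add: \<kappa>_def field_simps)
    then show ?thesis using b1 b2 b3 unfolding \<beta>_def by linarith
  qed
  have lb: "1 - 1 / n - \<kappa> \<le> n * t * J"
  proof -
    have "exp (- \<beta> * w) \<le> exp (- (n * t) * w)" using \<beta>nt w0 by (simp add: mult_right_mono)
    also have "- (n * t) * w = - ln n" using nt n0 t by (simp add: w_def)
    also have "exp (- ln n) = 1 / n" using n0 by (simp add: exp_minus inverse_eq_divide)
    finally have e1: "1 - 1 / n \<le> 1 - exp (- \<beta> * w)" by simp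
    have "1 - 1 / n - \<kappa> \<le> (1 - 1 / n) * (1 / (1 + \<kappa>))"
    proof -
      have "1 - \<kappa> \<le> 1 / (1 + \<kappa>)" using \<kappa>0 by (simp add: le_divide_eq algebra_simps)
      then have "(1 - 1 / n) * (1 - \<kappa>) \<le> (1 - 1 / n) * (1 / (1 + \<kappa>))" using n by (intro mult_left_mono) auto
      moreover have "1 - 1 / n - \<kappa> \<le> (1 - 1 / n) * (1 - \<kappa>)" using \<kappa>0 n0 by (simp add: algebra_simps divide_right_mono)
      ultimately show ?thesis by linarith
    qed
    also have "\<dots> = n * t * ((1 - 1 / n) / (n * t * (1 + \<kappa>)))" using nt n0 t by simp
    also have "\<dots> \<le> n * t * ((1 - exp (- \<beta> * w)) / \<beta>)"
      using e1 \<beta>le \<beta>0 nt n w0 by (intro mult_left_mono frac_le) auto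
    also have "\<dots> \<le> n * t * J" using J nt by (intro mult_left_mono) auto
    finally show ?thesis .
  qed
  have eq: "e = D / n + 1 / n + \<kappa>" unfolding e_def \<kappa>_def s2 by (simp add: add_divide_distrib)
  have nn: "0 \<le> D / n" "0 \<le> 1 / real n" using D1 by auto
  show "\<bar>gA p n t a \<eta> y / tilted_density p a y - 1\<bar> \<le> e"
  proof (rule abs_leI)
    show "gA p n t a \<eta> y / tilted_density p a y - 1 \<le> e" unfolding ratio eq using ub \<kappa>0 nn by linarith
    show "- (gA p n t a \<eta> y / tilted_density p a y - 1) \<le> e" unfolding ratio eq using lb nn by linarith
  qed
qed

end

section \<open>The conditional density\<close>

text \<open>Numerator and denominator of Bayes' rule are tails of sums of \<open>n - 1\<close> and
  \<open>n\<close> summands, both written with the same tilt \<open>t\<close>. Their prefactors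
  differ by \<open>exp (t * y) / \<Phi>\<close>, which together with \<open>p y\<close> is exactly
  the tilted density at \<open>y\<close>; the quotient of the kernels remains.\<close>

lemma (in exp_density) cond_density_ratio_bound:
  fixes M :: "'a measure" and X :: "nat \<Rightarrow> 'a \<Rightarrow> real"
  assumes M: "prob_space M" and indep: "prob_space.indep_vars M (\<lambda>_. borel) X {1..}"
    and dens: "\<And>i. i \<ge> 1 \<Longrightarrow> distributed M lborel (X i) (\<lambda>x. ennreal (p x))"
    and const: "D \<ge> 1" "B > 0" "c > 0" "r > 0"
  shows "\<exists>A>0. \<exists>N. \<forall>n t y. N \<le> n \<longrightarrow> 0 < t \<longrightarrow> 1 \<le> t * tilt_sd p t \<longrightarrow> 0 \<le> y \<longrightarrow>
     std_density D B c r (\<lambda>z. tilt_sd p t * tilt_dens t (tilt_mean p t + tilt_sd p t * z)) \<longrightarrow>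
     \<bar>cond_density_first M X p n (real n * tilt_mean p t) y / tilted_density p (tilt_mean p t) y - 1\<bar>
       \<le> A * (1 + ((tilt_mean p t - y) / tilt_sd p t)\<^sup>2) / n"
proof -
  obtain A N where A: "A > 0" and tail: "\<And>f n l \<delta>. std_density D B c r f \<Longrightarrow> N \<le> n \<Longrightarrow> 1 \<le> l \<Longrightarrow>
     (let Z = char (density lborel (\<lambda>x. ennreal (f x)));
          K = (\<lambda>k d. Re (CLINT v|lborel. Z v ^ k * iexp (- (v * d)) / (l + \<i> * v)))
      in integrable lborel (\<lambda>v. Z v ^ (n - 1)) \<and> integrable lborel (\<lambda>v. Z v ^ n) \<and>
         \<bar>K (n - 1) \<delta> - K n 0\<bar> \<le> A * (1 + \<delta>\<^sup>2) / (l * n * sqrt n) \<and> K n 0 \<ge> 1 / (l * sqrt n))"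
    using tail_kernel_estimates[OF const(1,3,4,2)] by blast
  show ?thesis
  proof (rule exI[of _ A], rule conjI[OF A], rule exI[of _ "max N 2"], intro allI impI)
    fix n and t y :: real
    define m where "m = tilt_mean p t"
    define s where "s = tilt_sd p t"
    assume n: "max N 2 \<le> n" and t: "0 < t" and ts: "1 \<le> t * tilt_sd p t" and y: "0 \<le> y"
      and sd: "std_density D B c r (\<lambda>z. tilt_sd p t * tilt_dens t (tilt_mean p t + tilt_sd p t * z))"
    have s: "s > 0" unfolding s_def by (rule tilt_sd_pos)
    define \<Phi> where "\<Phi> = emom 0 t"
    have \<Phi>: "\<Phi> = (LINT x|lborel. exp (t * x) * p x)" "\<Phi> > 0"
      using emom0_pos[of t] by (auto simp: \<Phi>_def emom_def)
    define Z where "Z = char (density lborel (\<lambda>z. ennreal (s * (exp (t * (m + s * z)) * p (m + s * z) / \<Phi>))))"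
    have Z_eq: "Z = char (density lborel (\<lambda>z. ennreal (s * tilt_dens t (m + s * z))))"
      by (simp add: Z_def tilt_dens_def \<Phi>_def)
    define K where "K = (\<lambda>k d. Re (CLINT v|lborel. Z v ^ k * iexp (- (v * d)) / (complex_of_real (t * s) + \<i> * v)))"
    define \<delta> where "\<delta> = (m - y) / s"
    have Ni: "N \<le> n" using n by simp
    from tail[OF sd Ni ts, of \<delta>]
    have Zi: "integrable lborel (\<lambda>v. Z v ^ (n - 1))" "integrable lborel (\<lambda>v. Z v ^ n)"
      and Kd: "\<bar>K (n - 1) \<delta> - K n 0\<bar> \<le> A * (1 + \<delta>\<^sup>2) / (t * s * n * sqrt n)" and Kl: "K n 0 \<ge> 1 / (t * s * sqrt n)"
      unfolding Let_def s_def[symmetric] m_def[symmetric] Z_eq[symmetric] K_def by blast+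
    have J: "{2..n} \<subseteq> {1..}" "{1..n} \<subseteq> {1..}" by auto
    have n1: "real (n - 1) = real n - 1" using n by simp
    have ind: "prob_space.indep_vars M (\<lambda>_. borel) X I" if "I \<subseteq> {1..}" for I
      by (rule prob_space.indep_vars_subset[OF M indep that])
    have Re_scaled: "u = v * Re z" if "complex_of_real u = complex_of_real v * z" for u v z
      using arg_cong[OF that, of Re] by simp
    have "complex_of_real (measure M {\<omega> \<in> space M. n * m - y \<le> (\<Sum>i\<in>{2..n}. X i \<omega>)})
      = \<Phi> ^ (n - 1) * exp (- (t * (n * m - y))) / (2 * pi)
      * (CLINT v|lborel. Z v ^ (n - 1) * iexp (- (v * ((n * m - y - real (n - 1) * m) / s))) / (complex_of_real (t * s) + \<i> * v))"
      unfolding Z_def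
      by (rule tilted_sum_tail[OF M ind[OF J(1)] dens])
         (use p_nonneg exp_int \<Phi> s t Zi(1) in \<open>auto simp: Z_def\<close>)
    \<comment> \<open>With one summand replaced by \<open>y\<close>, the level is off the mean of
      the others by \<open>m - y\<close> only, independently of \<open>n\<close>.\<close>
    also have "(n * m - y - real (n - 1) * m) / s = \<delta>" using n1 by (simp add: \<delta>_def algebra_simps)
    finally have P1: "measure M {\<omega> \<in> space M. n * m - y \<le> (\<Sum>i\<in>{2..n}. X i \<omega>)}
      = \<Phi> ^ (n - 1) * exp (- (t * (n * m - y))) / (2 * pi) * K (n - 1) \<delta>"
      unfolding K_def by (rule Re_scaled)
    have "complex_of_real (measure M {\<omega> \<in> space M. n * m \<le> (\<Sum>i\<in>{1..n}. X i \<omega>)})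
      = \<Phi> ^ n * exp (- (t * (n * m))) / (2 * pi)
      * (CLINT v|lborel. Z v ^ n * iexp (- (v * ((n * m - real n * m) / s))) / (complex_of_real (t * s) + \<i> * v))"
      unfolding Z_def
      by (rule tilted_sum_tail[OF M ind[OF J(2)] dens])
         (use p_nonneg exp_int \<Phi> s t Zi(2) in \<open>auto simp: Z_def\<close>)
    also have "(n * m - real n * m) / s = 0" by simp
    finally have P2: "measure M {\<omega> \<in> space M. n * m \<le> (\<Sum>i\<in>{1..n}. X i \<omega>)}
      = \<Phi> ^ n * exp (- (t * (n * m))) / (2 * pi) * K n 0"
      unfolding K_def by (rule Re_scaled)
    have ls: "0 < t * s * sqrt n" using t s n by simp
    have K0: "K n 0 > 0" using Kl ls by (meson divide_pos_pos less_le_trans zero_less_one)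
    have py: "p y > 0" using p_pos y by simp
    have ratio: "cond_density_first M X p n (n * m) y / tilted_density p m y = K (n - 1) \<delta> / K n 0"
    proof -
      have set_eq: "{\<omega> \<in> space M. y + (\<Sum>i = 2..n. X i \<omega>) \<ge> n * m} = {\<omega> \<in> space M. n * m - y \<le> (\<Sum>i\<in>{2..n}. X i \<omega>)}"
        by auto
      obtain k where k: "n = Suc k" using n by (cases n) auto
      have "cond_density_first M X p n (n * m) y = p y * (\<Phi> ^ (n - 1) * exp (- (t * (n * m - y))) / (2 * pi) * K (n - 1) \<delta>)
         / (\<Phi> ^ n * exp (- (t * (n * m))) / (2 * pi) * K n 0)"
        unfolding cond_density_first_def set_eq P1 P2 ..
      also have "exp (- (t * (n * m - y))) = exp (- (t * (n * m))) * exp (t * y)"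
        by (simp add: exp_add[symmetric] algebra_simps)
      also have "p y * (\<Phi> ^ (n - 1) * (exp (- (t * (n * m))) * exp (t * y)) / (2 * pi) * K (n - 1) \<delta>)
         / (\<Phi> ^ n * exp (- (t * (n * m))) / (2 * pi) * K n 0) = exp (t * y) * p y / \<Phi> * (K (n - 1) \<delta> / K n 0)"
        using \<Phi>(2) by (simp add: k)
      also have "exp (t * y) * p y / \<Phi> = tilted_density p m y"
        by (simp add: tilted_density_def m_def mgf_eq \<Phi>_def)
      finally have "cond_density_first M X p n (n * m) y = tilted_density p m y * (K (n - 1) \<delta> / K n 0)" .
      moreover have "tilted_density p m y > 0"
        using py emom0_pos by (simp add: tilted_density_def mgf_eq)
      ultimately show ?thesis by simp
    qed
    have "\<bar>K (n - 1) \<delta> / K n 0 - 1\<bar> = \<bar>K (n - 1) \<delta> - K n 0\<bar> / K n 0"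
      using K0 by (simp add: divide_diff_eq_iff abs_divide)
    \<comment> \<open>The size \<open>1 / (t * s * sqrt n)\<close> common to both kernels cancels,
      so large \<open>t * s\<close> does not spoil the relative error.\<close>
    also have "\<dots> \<le> (A * (1 + \<delta>\<^sup>2) / (t * s * n * sqrt n)) / (1 / (t * s * sqrt n))"
      using Kd Kl ls A t s n by (intro frac_le) auto
    also have "\<dots> = A * (1 + \<delta>\<^sup>2) / n" using t s n by simp
    finally show "\<bar>cond_density_first M X p n (real n * tilt_mean p t) y / tilted_density p (tilt_mean p t) y - 1\<bar>
       \<le> A * (1 + ((tilt_mean p t - y) / tilt_sd p t)\<^sup>2) / n"
      using ratio by (simp add: m_def s_def \<delta>_def)
  qed
qed

text \<open>Measurability and integrability of \<open>p\<close> are read off from its being a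
  density of \<open>Y\<close>, as the representation says nothing about the regularity of
  \<open>q\<close>. Eventually \<open>g x >= (t + 1) * x\<close>, so the tilted function is
  dominated by \<open>exp (- x)\<close> up to a constant, and before that by a multiple of
  \<open>p\<close>.\<close>

lemma exp_density_from_exponent:
  fixes p g q :: "real \<Rightarrow> real"
  assumes M: "prob_space M" and dens: "distributed M lborel Y (\<lambda>x. ennreal (p x))"
    and c: "c > 0" and p_eq: "\<And>x. x \<ge> 0 \<Longrightarrow> p x = c * exp (- (g x - q x))"
    and p_neg: "\<And>x. x < 0 \<Longrightarrow> p x = 0"
    and g: "filterlim (\<lambda>x. g x / x) at_top at_top" and q: "\<forall>\<^sub>F x in at_top. \<bar>q x\<bar> \<le> 1"
  shows "exp_density p"
proof
  have p0: "0 \<le> p x" for x using p_eq[of x] p_neg[of x] c by (cases "x \<ge> 0") auto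
  show pm: "p \<in> borel_measurable borel"
  proof -
    have "(\<lambda>x. ennreal (p x)) \<in> borel_measurable borel" using dens by (auto simp: distributed_def)
    then have "(\<lambda>x. enn2real (ennreal (p x))) \<in> borel_measurable borel" by measurable
    then show ?thesis using p0 by simp
  qed
  show "0 \<le> p x" for x by (rule p0)
  show "p x = 0" if "x < 0" for x using p_neg that .
  show "p x > 0" if "x \<ge> 0" for x using p_eq[OF that] c by simp
  have pint: "integrable lborel p"
  proof (rule integrableI_nonneg)
    interpret prob_space M by fact
    have "(\<integral>\<^sup>+x. ennreal (p x) \<partial>lborel) = emeasure (density lborel (\<lambda>x. ennreal (p x))) UNIV"
      using pm by (subst emeasure_density) auto
    also have "\<dots> = emeasure (distr M lborel Y) UNIV"
      using dens by (simp add: distributed_def)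
    also have "\<dots> \<le> 1"
      using dens by (subst emeasure_distr) (auto simp: distributed_def emeasure_space_1 intro: emeasure_le_1)
    finally show "(\<integral>\<^sup>+x. ennreal (p x) \<partial>lborel) < \<infinity>" by (rule order_le_less_trans) simp
  qed (use pm p0 in auto)
  fix t :: real
  have "\<forall>\<^sub>F x in at_top. t + 1 \<le> g x / x" using g by (simp add: filterlim_at_top)
  with q have "\<forall>\<^sub>F x in at_top. \<bar>q x\<bar> \<le> 1 \<and> t + 1 \<le> g x / x" by (rule eventually_conj)
  then obtain X0 where X0: "\<And>x. x \<ge> X0 \<Longrightarrow> \<bar>q x\<bar> \<le> 1 \<and> t + 1 \<le> g x / x"
    unfolding eventually_at_top_linorder by blast
  define X1 where "X1 = max X0 1"
  show "integrable lborel (\<lambda>x. exp (t * x) * p x)"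
  proof (rule Bochner_Integration.integrable_bound)
    show "integrable lborel (\<lambda>x. exp (\<bar>t\<bar> * X1) * p x + c * exp 1 * (\<bar>x\<bar> ^ 0 * exp (- \<bar>x\<bar>)))"
      using pint integrable_abs_power_exp[of 0]
      by (intro Bochner_Integration.integrable_add integrable_mult_right) auto
    show "AE x in lborel. norm (exp (t * x) * p x) \<le> norm (exp (\<bar>t\<bar> * X1) * p x + c * exp 1 * (\<bar>x\<bar> ^ 0 * exp (- \<bar>x\<bar>)))"
    proof (rule AE_I2)
      fix x :: real
      have "exp (t * x) * p x \<le> exp (\<bar>t\<bar> * X1) * p x + c * exp 1 * (\<bar>x\<bar> ^ 0 * exp (- \<bar>x\<bar>))"
      proof -
        consider "x < 0" | "0 \<le> x" "x < X1" | "X1 \<le> x" by linarith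
        then show ?thesis
        proof cases
          case 1 then show ?thesis using p_neg[of x] c by simp
        next
          case 2
          have "t * x \<le> \<bar>t\<bar> * X1" using 2 by (intro mult_mono) auto
          then have "exp (t * x) * p x \<le> exp (\<bar>t\<bar> * X1) * p x" using p0 by (intro mult_right_mono) auto
          moreover have "0 \<le> c * exp 1 * (\<bar>x\<bar> ^ 0 * exp (- \<bar>x\<bar>))" using c by simp
          ultimately show ?thesis by linarith
        next
          case 3
          then have x: "x > 0" "X0 \<le> x" by (auto simp: X1_def)
          have "(t + 1) * x \<le> g x" using X0[OF x(2)] x(1) by (simp add: le_divide_eq)
          moreover have "q x \<le> 1" using X0[OF x(2)] by (simp add: abs_le_iff)
          ultimately have le: "t * x - g x + q x \<le> 1 - x" by (simp add: distrib_right)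
          have "exp (t * x) * p x = c * exp (t * x - g x + q x)"
            using p_eq[of x] x by (simp add: exp_add[symmetric] mult.left_commute algebra_simps)
          also have "\<dots> \<le> c * exp (1 - x)" using le c by (intro mult_left_mono) auto
          also have "\<dots> = c * exp 1 * (\<bar>x\<bar> ^ 0 * exp (- \<bar>x\<bar>))" using x by (simp add: exp_diff exp_minus divide_inverse)
          finally have "exp (t * x) * p x \<le> c * exp 1 * (\<bar>x\<bar> ^ 0 * exp (- \<bar>x\<bar>))" .
          moreover have "0 \<le> exp (\<bar>t\<bar> * X1) * p x" using p0 by simp
          ultimately show ?thesis by linarith
        qed
      qed
      moreover have "0 \<le> exp (t * x) * p x" using p0 by simp
      ultimately show "norm (exp (t * x) * p x) \<le> norm (exp (\<bar>t\<bar> * X1) * p x + c * exp 1 * (\<bar>x\<bar> ^ 0 * exp (- \<bar>x\<bar>)))"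
        by simp
    qed
  qed (use pm in measurable)
qed

theorem proposition6p1:
  fixes M :: "'a measure" and X :: "nat \<Rightarrow> 'a \<Rightarrow> real"
    and p g h q :: "real \<Rightarrow> real" and c \<theta> y :: real
    and a t \<eta> :: "nat \<Rightarrow> real"
  assumes prob: "prob_space M"
    and indep: "prob_space.indep_vars M (\<lambda>_. borel) X {1..}"
    and dens: "\<And>i. i \<ge> 1 \<Longrightarrow> distributed M lborel (X i) (\<lambda>x. ennreal (p x))"
    and p_bounded: "\<exists>B. \<forall>x. p x \<le> B"
    and c_pos: "c > 0"
    and p_nonneg_arg: "\<And>x. x \<ge> 0 \<Longrightarrow> p x = c * exp (- (g x - q x))"
    and p_neg_arg: "\<And>x. x < 0 \<Longrightarrow> p x = 0"
    and g_pos: "\<And>x. x \<ge> 0 \<Longrightarrow> g x > 0"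
    and g_superlinear: "filterlim (\<lambda>x. g x / x) at_top at_top"
    and g_deriv: "\<And>x. x > 0 \<Longrightarrow> (g has_real_derivative h x) (at x)"
    and h_locally_bounded: "\<And>b. bdd_above (h ` {0<..b})"
    and h_class: "h \<in> R_class"
    and theta_pos: "\<theta> > 0"
    and q_small: "\<forall>\<^sub>F x in at_top. \<forall>v\<ge>0. \<bar>v - x\<bar> < \<theta> * x \<longrightarrow> \<bar>q v\<bar> \<le> 1 / sqrt (x * h x)"
    and a_lim: "filterlim a at_top sequentially"
    and t_def: "\<And>n. n \<ge> 1 \<Longrightarrow> tilt_mean p (t n) = a n"
    and growth: "(\<lambda>n. (gen_inverse h (t n))\<^sup>2 / (sqrt (real n) * deriv (gen_inverse h) (t n)))
                   \<longlonglongrightarrow> 0"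
    and eta_pos: "\<And>n. n \<ge> 1 \<Longrightarrow> \<eta> n > 0"
    and eta_lim: "\<eta> \<longlonglongrightarrow> 0"
    and eta_rate: "filterlim (\<lambda>n. real n * h (a n) * \<eta> n / ln (real n)) at_top sequentially"
  shows "\<exists>\<rho>. \<rho> \<in> o(\<lambda>n. 1 / sqrt (real n)) \<and>
           (\<forall>\<^sub>F n in sequentially.
              cond_density_first M X p n (real n * a n) y
                = gA p n (t n) (a n) (\<eta> n) y * (1 + \<rho> n))"
proof (cases "y < 0")
  case True
  \<comment> \<open>Both sides contain the factor \<open>p y\<close>, so the identity is
    \<open>0 = 0\<close> and the error may be taken to be 0.\<close>
  then have "p y = 0" by (rule p_neg_arg)
  then have "cond_density_first M X p n (real n * a n) y = gA p n (t n) (a n) (\<eta> n) y * (1 + 0)" for n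
    by (simp add: cond_density_first_def gA_def tilted_density_def)
  then show ?thesis by (intro exI[of _ "\<lambda>_. 0"]) simp
next
  case False
  then have y: "0 \<le> y" by simp
  obtain h' X0 C where R: "regular_rate h h' X0 C"
    using regular_rate_R_class[OF h_class h_locally_bounded] by blast
  \<comment> \<open>The hypothesis on \<open>q\<close> at \<open>v = x\<close>, once
    \<open>x\<close> and \<open>h x\<close> are at least 1.\<close>
  have q1: "\<forall>\<^sub>F x in at_top. \<bar>q x\<bar> \<le> 1"
  proof -
    have "\<forall>\<^sub>F x in at_top. 1 \<le> h x" using R unfolding regular_rate_def filterlim_at_top by blast
    with q_small eventually_ge_at_top[of "1::real"] show ?thesis
    proof eventually_elim
      case (elim x)
      have "\<bar>q x\<bar> \<le> 1 / sqrt (x * h x)" using elim(1,2) theta_pos by simp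
      also have "\<dots> \<le> 1"
        using elim mult_mono[of 1 x 1 "h x"] by simp
      finally show ?case .
    qed
  qed
  interpret exp_density p
    by (rule exp_density_from_exponent[OF prob dens[of 1] c_pos p_nonneg_arg p_neg_arg g_superlinear q1]) auto
  obtain Bp where Bp: "\<And>x. p x \<le> Bp" using p_bounded by blast
  obtain D B c' r T where const: "D \<ge> 1" "B > 0" "c' > 0" "r > 0" and unif: "\<And>t. t \<ge> T \<Longrightarrow>
     std_density D B c' r (\<lambda>z. tilt_sd p t * tilt_dens t (tilt_mean p t + tilt_sd p t * z)) \<and>
     \<bar>tilt_third t\<bar> \<le> D * tilt_sd p t ^ 3 \<and> h (tilt_mean p t) \<le> 2 * t \<and>
     tilt_mean p t \<le> D * gen_inverse h t \<and> 0 < deriv (gen_inverse h) t \<and> deriv (gen_inverse h) t \<le> D * tilt_var t"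
    using uniform_tilt_estimates(1)[OF R g_deriv c_pos p_nonneg_arg Bp q1] by blast
  \<comment> \<open>The constant \<open>3 * D\<close> gives \<open>1 <= t * s\<close> and also
    \<open>4 / 3 * (1 / t) <= 4 / 9 * (s / D)\<close>, the room needed to follow the tilt over the
    length \<open>ln n / (n * t)\<close>.\<close>
  obtain T2 where T2: "\<And>t. t \<ge> T2 \<Longrightarrow> 3 * D \<le> t * tilt_sd p t"
    using uniform_tilt_estimates(2)[OF R g_deriv c_pos p_nonneg_arg Bp q1] by blast
  obtain A N where A: "A > 0" and cond: "\<And>n t y. N \<le> n \<Longrightarrow> 0 < t \<Longrightarrow> 1 \<le> t * tilt_sd p t \<Longrightarrow> 0 \<le> y \<Longrightarrow>
     std_density D B c' r (\<lambda>z. tilt_sd p t * tilt_dens t (tilt_mean p t + tilt_sd p t * z)) \<Longrightarrow>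
     \<bar>cond_density_first M X p n (real n * tilt_mean p t) y / tilted_density p (tilt_mean p t) y - 1\<bar>
       \<le> A * (1 + ((tilt_mean p t - y) / tilt_sd p t)\<^sup>2) / n"
    using cond_density_ratio_bound[OF prob indep dens const] by blast
  define T3 where "T3 = max (max T T2) 1"
  define u where "u = (\<lambda>n. (a n)\<^sup>2 / tilt_var (t n))"
  define e1 where "e1 = (\<lambda>n. A * (1 + 4 * u n) / real n)"
  define e2 where "e2 = (\<lambda>n. (2 * D + 1 + 9 / 4 * ln (real n) + 7 * u n) / real n)"
  have t_ev: "\<forall>\<^sub>F n in sequentially. T3 \<le> t n"
    using filterlim_at_top[THEN iffD1, OF a_lim, rule_format, of "tilt_mean p T3"] eventually_ge_at_top[of 1]
  proof eventually_elim
    case (elim n)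
    then show ?case using t_def[of n] tilt_mean_less_iff[of "t n" T3] by linarith
  qed
  have a_ev: "\<forall>\<^sub>F n in sequentially. max 1 y \<le> a n"
    using a_lim unfolding filterlim_at_top by blast
  \<comment> \<open>This is the growth hypothesis up to constants: \<open>D\<^sup>2\<close> from
    comparing \<open>a n\<close> with \<open>\<psi>\<close>, and one more \<open>D\<close> from
    comparing \<open>\<psi>'\<close> with the variance.\<close>
  have u0: "(\<lambda>n. u n / sqrt (real n)) \<longlonglongrightarrow> 0"
  proof (rule Lim_null_comparison)
    show "(\<lambda>n. D ^ 3 * ((gen_inverse h (t n))\<^sup>2 / (sqrt (real n) * deriv (gen_inverse h) (t n)))) \<longlonglongrightarrow> 0"
      using tendsto_mult_right_zero[OF growth] by simp
    show "\<forall>\<^sub>F n in sequentially. norm (u n / sqrt (real n))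
      \<le> D ^ 3 * ((gen_inverse h (t n))\<^sup>2 / (sqrt (real n) * deriv (gen_inverse h) (t n)))"
      using t_ev a_ev eventually_ge_at_top[of 1]
    proof eventually_elim
      case (elim n)
      define d where "d = deriv (gen_inverse h) (t n)"
      define \<psi> where "\<psi> = gen_inverse h (t n)"
      have U: "a n \<le> D * \<psi>" "0 < d" "d \<le> D * tilt_var (t n)"
        using unif[of "t n"] elim t_def[of n] by (auto simp: T3_def d_def \<psi>_def)
      have V: "tilt_var (t n) > 0" by (rule tilt_var_pos)
      have "(a n)\<^sup>2 \<le> (D * \<psi>)\<^sup>2" using U(1) elim by (intro power_mono) auto
      then have "(a n)\<^sup>2 / tilt_var (t n) \<le> (D * \<psi>)\<^sup>2 / (d / D)"
        using U V const(1) by (intro frac_le) (auto simp: divide_le_eq mult.commute)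
      also have "\<dots> = D ^ 3 * (\<psi>\<^sup>2 / d)"
        using const(1) by (simp add: power2_eq_square power3_eq_cube)
      finally have "u n / sqrt n \<le> D ^ 3 * (\<psi>\<^sup>2 / d) / sqrt n"
        unfolding u_def by (intro divide_right_mono) auto
      moreover have "0 \<le> u n" using V by (simp add: u_def)
      ultimately show ?case by (simp add: d_def \<psi>_def mult_ac)
    qed
  qed
  have e1_lim: "(\<lambda>n. sqrt (real n) * e1 n) \<longlonglongrightarrow> 0"
  proof -
    have "(\<lambda>n. A * (1 / sqrt (real n)) + 4 * A * (u n / sqrt (real n))) \<longlonglongrightarrow> A * 0 + 4 * A * 0"
      by (intro tendsto_intros u0) real_asymp
    moreover have "\<forall>\<^sub>F n in sequentially. A * (1 / sqrt (real n)) + 4 * A * (u n / sqrt (real n)) = sqrt (real n) * e1 n"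
      using eventually_gt_at_top[of 0]
    proof eventually_elim
      case (elim n)
      then have "sqrt n / n = 1 / sqrt n" by (simp add: divide_simps)
      moreover have "sqrt n * e1 n = A * (1 + 4 * u n) * (sqrt n / n)" by (simp add: e1_def)
      ultimately show ?case by (simp add: algebra_simps add_divide_distrib)
    qed
    ultimately show ?thesis using Lim_transform_eventually by force
  qed
  have e2_lim: "(\<lambda>n. sqrt (real n) * e2 n) \<longlonglongrightarrow> 0"
  proof -
    have "(\<lambda>n. (2 * D + 1) * (1 / sqrt (real n)) + 9 / 4 * (ln (real n) / sqrt (real n)) + 7 * (u n / sqrt (real n)))
       \<longlonglongrightarrow> (2 * D + 1) * 0 + 9 / 4 * 0 + 7 * 0"
      by (intro tendsto_add tendsto_mult tendsto_const u0) real_asymp+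
    moreover have "\<forall>\<^sub>F n in sequentially. (2 * D + 1) * (1 / sqrt (real n)) + 9 / 4 * (ln (real n) / sqrt (real n)) + 7 * (u n / sqrt (real n))
       = sqrt (real n) * e2 n"
      using eventually_gt_at_top[of 0]
    proof eventually_elim
      case (elim n)
      then have "sqrt n / n = 1 / sqrt n" by (simp add: divide_simps)
      moreover have "sqrt n * e2 n = (2 * D + 1 + 9 / 4 * ln n + 7 * u n) * (sqrt n / n)" by (simp add: e2_def)
      ultimately show ?case by (simp add: algebra_simps add_divide_distrib)
    qed
    ultimately show ?thesis using Lim_transform_eventually by force
  qed
  \<comment> \<open>Keeps the quotient of \<open>gA\<close> and the tilted density above
    \<open>1 / 2\<close>, so that dividing by it costs only a factor 2.\<close>
  have e2_small: "\<forall>\<^sub>F n in sequentially. e2 n \<le> 1 / 2"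
    using order_tendstoD(2)[OF e2_lim half_gt_zero[OF zero_less_one]] eventually_ge_at_top[of 1]
  proof eventually_elim
    case (elim n)
    show ?case
    proof (cases "e2 n \<ge> 0")
      case True
      have "1 * e2 n \<le> sqrt n * e2 n" using True elim by (intro mult_right_mono) auto
      then show ?thesis using elim by linarith
    qed simp
  qed
  \<comment> \<open>The value 2 pays for \<open>h (a n) <= 2 * t n\<close> and yields
    \<open>\<eta> n >= ln n / (n * t n)\<close>.\<close>
  have rate: "\<forall>\<^sub>F n in sequentially. 2 \<le> real n * h (a n) * \<eta> n / ln (real n)"
    using eta_rate by (simp add: filterlim_at_top)
  have n_ev: "\<forall>\<^sub>F n in sequentially. N \<le> n \<and> 2 \<le> n \<and> nat \<lceil>2 * D\<rceil> \<le> n"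
    by (intro eventually_conj eventually_ge_at_top)
  define \<rho> where "\<rho> = (\<lambda>n. cond_density_first M X p n (real n * a n) y / gA p n (t n) (a n) (\<eta> n) y - 1)"
  have main: "\<forall>\<^sub>F n in sequentially. gA p n (t n) (a n) (\<eta> n) y \<noteq> 0 \<and> \<bar>\<rho> n\<bar> \<le> 2 * (e1 n + e2 n)"
    using t_ev a_ev e2_small rate n_ev
  proof eventually_elim
    case (elim n)
    have n: "N \<le> n" "2 \<le> n" "1 \<le> n" and nD: "2 * D \<le> real n" using elim(5) by linarith+
    have tm: "tilt_mean p (t n) = a n" using t_def n by simp
    have tn: "T \<le> t n" "T2 \<le> t n" "1 \<le> t n" using elim(1) by (auto simp: T3_def)
    have ay: "1 \<le> a n" "y \<le> a n" using elim(2) by auto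
    define s where "s = tilt_sd p (t n)"
    have s: "s > 0" unfolding s_def by (rule tilt_sd_pos)
    have s2: "tilt_var (t n) = s\<^sup>2" unfolding s_def by (simp add: tilt_sd_square)
    have ts: "3 * D \<le> t n * s" using T2 tn by (simp add: s_def)
    note U = unif[OF tn(1)]
    have ln0: "ln (real n) > 0" "ln (real n) \<le> real n" using n ln_bound[of "real n"] by auto
    have n0: "real n > 0" using n by simp
    define td where "td = tilted_density p (a n) y"
    have c1: "\<bar>cond_density_first M X p n (real n * a n) y / td - 1\<bar> \<le> e1 n"
    proof -
      have "\<bar>cond_density_first M X p n (real n * a n) y / td - 1\<bar> \<le> A * (1 + ((a n - y) / s)\<^sup>2) / n"
        using cond[OF n(1), of "t n" y] tn ts const(1) U y unfolding tm td_def s_def by simp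
      also have "\<dots> \<le> e1 n"
        unfolding e1_def
      proof (intro divide_right_mono mult_left_mono add_left_mono)
        have "(a n - y)\<^sup>2 \<le> (a n)\<^sup>2" using ay y by (intro power_mono) auto
        also have "\<dots> \<le> 4 * (a n)\<^sup>2" by simp
        finally have "(a n - y)\<^sup>2 / s\<^sup>2 \<le> 4 * (a n)\<^sup>2 / s\<^sup>2" by (rule divide_right_mono) simp
        then show "((a n - y) / s)\<^sup>2 \<le> 4 * u n" by (simp add: u_def s2 power_divide)
      qed (use A in auto)
      finally show ?thesis .
    qed
    have w: "ln (real n) / (real n * t n) \<le> 1 / t n"
      using ln0 n0 tn by (simp add: divide_simps)
    have c2: "\<bar>gA p n (t n) (a n) (\<eta> n) y / td - 1\<bar> \<le> e2 n" and td0: "td > 0"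
    proof -
      have third: "\<bar>tilt_third r\<bar> \<le> D * tilt_sd p r ^ 3" if "r \<ge> T" for r using unif[OF that] by blast
      have ts1: "1 \<le> r * tilt_sd p r" if "r \<ge> t n" for r using T2[of r] that tn const(1) by simp
      \<comment> \<open>A later member of the sequence \<open>a\<close> exceeds
        \<open>a n + \<eta> n\<close>, and it is a value of the mean function by hypothesis.\<close>
      have reach: "\<exists>u. tilt_mean p (t n) + \<eta> n \<le> tilt_mean p u"
      proof -
        have "\<forall>\<^sub>F k in sequentially. a n + \<eta> n \<le> a k" using a_lim by (simp add: filterlim_at_top)
        with eventually_ge_at_top[of 1] have "\<forall>\<^sub>F k in sequentially. 1 \<le> k \<and> a n + \<eta> n \<le> a k"
          by (rule eventually_conj)
        then obtain k where "1 \<le> k" "a n + \<eta> n \<le> a k" using eventually_happens' sequentially_bot by blast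
        then show ?thesis using t_def[of k] tm by (intro exI[of _ "t k"]) simp
      qed
      have eta: "ln (real n) / (real n * t n) \<le> \<eta> n"
      proof -
        have "2 * ln (real n) \<le> real n * h (a n) * \<eta> n" using elim(4) ln0 by (simp add: le_divide_eq)
        also have "\<dots> \<le> real n * (2 * t n) * \<eta> n"
          using U tm eta_pos[OF n(3)] n0 by (intro mult_right_mono mult_left_mono) auto
        finally show ?thesis using n0 tn by (simp add: divide_le_eq mult_ac)
      qed
      have w1: "ln (real n) / (real n * t n) \<le> 1" by (rule order_trans[OF w]) (use tn in simp)
      have w2: "ln (real n) / (real n * t n) < 4 / 9 * (tilt_sd p (t n) / D)"
      proof -
        have "0 < 1 / t n" using tn by simp
        then have "1 / t n < 4 / 3 * (1 / t n)" by linarith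
        also have "\<dots> \<le> 4 / 9 * (s / D)" using ts tn const(1) by (simp add: field_simps)
        finally show ?thesis using w by (simp add: s_def)
      qed
      note G = gA_ratio_bound[of T D "t n" y n "\<eta> n", OF third const(1) ts1 tn(1,3) y _ _ nD n(2) reach eta w1 w2]
      show "\<bar>gA p n (t n) (a n) (\<eta> n) y / td - 1\<bar> \<le> e2 n" "td > 0"
        using G ay unfolding tm td_def e2_def u_def by simp_all
    qed
    define P where "P = cond_density_first M X p n (real n * a n) y / td"
    define Q where "Q = gA p n (t n) (a n) (\<eta> n) y / td"
    have Q: "Q \<ge> 1 / 2" using c2 elim(3) unfolding Q_def[symmetric] by (simp add: abs_le_iff)
    have "\<rho> n = P / Q - 1" using td0 by (simp add: \<rho>_def P_def Q_def)
    also have "\<dots> = (P - Q) / Q" using Q by (simp add: diff_divide_distrib)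
    finally have "\<bar>\<rho> n\<bar> = \<bar>P - Q\<bar> / Q" using Q by (simp add: abs_divide)
    also have "\<dots> \<le> (e1 n + e2 n) / (1 / 2)"
      using c1 c2 Q unfolding P_def[symmetric] Q_def[symmetric] by (intro frac_le) auto
    finally have "\<bar>\<rho> n\<bar> \<le> 2 * (e1 n + e2 n)" by simp
    moreover have "gA p n (t n) (a n) (\<eta> n) y \<noteq> 0" using Q by (auto simp: Q_def)
    ultimately show ?case by blast
  qed
  have "\<rho> \<in> o(\<lambda>n. 1 / sqrt (real n))"
  proof (rule smalloI_tendsto)
    show "(\<lambda>n. \<rho> n / (1 / sqrt (real n))) \<longlonglongrightarrow> 0"
    proof (rule Lim_null_comparison)
      show "(\<lambda>n. 2 * (sqrt (real n) * e1 n + sqrt (real n) * e2 n)) \<longlonglongrightarrow> 0"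
        using tendsto_mult_right_zero[OF tendsto_add_zero[OF e1_lim e2_lim]] .
      show "\<forall>\<^sub>F n in sequentially. norm (\<rho> n / (1 / sqrt (real n))) \<le> 2 * (sqrt (real n) * e1 n + sqrt (real n) * e2 n)"
        using main
      proof eventually_elim
        case (elim n)
        then have "sqrt n * \<bar>\<rho> n\<bar> \<le> sqrt n * (2 * (e1 n + e2 n))" by (intro mult_left_mono) auto
        then show ?case by (simp add: abs_mult algebra_simps)
      qed
    qed
    show "\<forall>\<^sub>F n in sequentially. 1 / sqrt (real n) \<noteq> 0"
      using eventually_gt_at_top[of 0] by eventually_elim simp
  qed
  moreover have "\<forall>\<^sub>F n in sequentially. cond_density_first M X p n (real n * a n) y
                = gA p n (t n) (a n) (\<eta> n) y * (1 + \<rho> n)"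
    using main by eventually_elim (simp add: \<rho>_def)
  ultimately show ?thesis by blast
qed

end
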